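(* Let $R$ be a commutative ring and $S\subset R$ a multiplicative subset such that $R$ is $S$-h-nil. Then the projective dimension of the $R$-module $R_S$ does not exceed $1$.
   Context: $R_S$ denotes the localization of $R$ at $S$; the multiplicative subset $S$ may contain zero-divisors. The ring $R$ is $S$-h-nil if every element $s\in S$ is contained in only finitely many maximal ideals of $R$ and every prime ideal of $R$ intersecting $S$ is maximal. *)

theory Defs
  imports "HOL-Library.Extended_Nat" "HOL-Algebra.Ideal" "HOL-Algebra.Module"
begin

section \<open>Localization at a multiplicative subset\<close>

text \<open>A multiplicative subset of \<open>R\<close> is a \<open>submonoid S R\<close>. It may contain zero-divisors (even zero),
  so equality of fractions is the relation with an auxiliary annihilating factor from \<open>S\<close>.\<close>

definition fraction :: "('a, 'c) ring_scheme \<Rightarrow> 'a set \<Rightarrow> 'a \<Rightarrow> 'a \<Rightarrow> ('a \<times> 'a) set"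
  where "fraction R S a s =
    {(b, t). b \<in> carrier R \<and> t \<in> S \<and>
       (\<exists>u\<in>S. u \<otimes>\<^bsub>R\<^esub> (a \<otimes>\<^bsub>R\<^esub> t) = u \<otimes>\<^bsub>R\<^esub> (b \<otimes>\<^bsub>R\<^esub> s))}"

text \<open>The operations are given on equivalence classes by the union over all representatives, in the
  style of \<open>HOL.Equiv_Relations\<close>; the lemmas \<open>localization_add\<close>, \<open>localization_mult\<close> and
  \<open>localization_smult\<close> below are the usual formulas.\<close>

definition localization :: "('a, 'c) ring_scheme \<Rightarrow> 'a set \<Rightarrow> ('a, ('a \<times> 'a) set) module"
  where "localization R S =
    \<lparr> carrier = {fraction R S a s | a s. a \<in> carrier R \<and> s \<in> S},
      mult = (\<lambda>X Y. \<Union>(a, s)\<in>X. \<Union>(b, t)\<in>Y. fraction R S (a \<otimes>\<^bsub>R\<^esub> b) (s \<otimes>\<^bsub>R\<^esub> t)),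
      one = fraction R S \<one>\<^bsub>R\<^esub> \<one>\<^bsub>R\<^esub>,
      zero = fraction R S \<zero>\<^bsub>R\<^esub> \<one>\<^bsub>R\<^esub>,
      add = (\<lambda>X Y. \<Union>(a, s)\<in>X. \<Union>(b, t)\<in>Y.
               fraction R S ((a \<otimes>\<^bsub>R\<^esub> t) \<oplus>\<^bsub>R\<^esub> (b \<otimes>\<^bsub>R\<^esub> s)) (s \<otimes>\<^bsub>R\<^esub> t)),
      smult = (\<lambda>r X. \<Union>(a, s)\<in>X. fraction R S (r \<otimes>\<^bsub>R\<^esub> a) s) \<rparr>"

definition S_h_nil :: "('a, 'c) ring_scheme \<Rightarrow> 'a set \<Rightarrow> bool"
  where "S_h_nil R S \<longleftrightarrow>
    (\<forall>s\<in>S. finite {\<mm>. maximalideal \<mm> R \<and> s \<in> \<mm>}) \<and>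
    (\<forall>\<pp>. primeideal \<pp> R \<and> \<pp> \<inter> S \<noteq> {} \<longrightarrow> maximalideal \<pp> R)"


section \<open>Projective modules\<close>

definition mod_hom ::
    "('a, 'c) ring_scheme \<Rightarrow> ('a, 'b, 'd) module_scheme \<Rightarrow> ('a, 'e, 'f) module_scheme \<Rightarrow> ('b \<Rightarrow> 'e) set"
  where "mod_hom R M N =
    {h. h \<in> carrier M \<rightarrow> carrier N \<and>
        (\<forall>x\<in>carrier M. \<forall>y\<in>carrier M. h (x \<oplus>\<^bsub>M\<^esub> y) = h x \<oplus>\<^bsub>N\<^esub> h y) \<and>
        (\<forall>r\<in>carrier R. \<forall>x\<in>carrier M. h (r \<odot>\<^bsub>M\<^esub> x) = r \<odot>\<^bsub>N\<^esub> h x)}"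

text \<open>Projectivity is the lifting property against surjections. A definition cannot quantify over
  all carrier types, so the modules \<open>M\<close> and \<open>N\<close> range over two fixed types, which are large enough
  to include \<open>P\<close> itself and the free module on the underlying set of \<open>P\<close>. Lemma
  \<open>projective_module_lift\<close> below shows that the lifting property then holds against
  surjections between modules over arbitrary types.\<close>

definition projective_module :: "('a, 'c) ring_scheme \<Rightarrow> ('a, 'b) module \<Rightarrow> bool"
  where "projective_module R P \<longleftrightarrow> module R P \<and>
    (\<forall>(M :: ('a, 'b \<Rightarrow> 'a) module) (N :: ('a, 'b) module) g f.
       module R M \<and> module R N \<and> g \<in> mod_hom R M N \<and> g ` carrier M = carrier N \<and> f \<in> mod_hom R P N
       \<longrightarrow> (\<exists>h\<in>mod_hom R P M. \<forall>x\<in>carrier P. g (h x) = f x))"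


section \<open>Projective dimension\<close>

text \<open>\<open>projective_resolution R M P d e\<close>: the complex
  \<open>\<dots> \<rightarrow> P 2 \<rightarrow> P 1 \<rightarrow> P 0 \<rightarrow> M \<rightarrow> 0\<close> with differentials \<open>d i\<close> from \<open>P (i + 1)\<close> to \<open>P i\<close> and
  augmentation \<open>e\<close> is exact, with all \<open>P i\<close> projective.\<close>

definition projective_resolution ::
    "('a, 'c) ring_scheme \<Rightarrow> ('a, 'm, 'd) module_scheme \<Rightarrow> (nat \<Rightarrow> ('a, 'p) module)
      \<Rightarrow> (nat \<Rightarrow> 'p \<Rightarrow> 'p) \<Rightarrow> ('p \<Rightarrow> 'm) \<Rightarrow> bool"
  where "projective_resolution R M P d e \<longleftrightarrow>
    (\<forall>i. projective_module R (P i)) \<and>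
    (\<forall>i. d i \<in> mod_hom R (P (Suc i)) (P i)) \<and>
    e \<in> mod_hom R (P 0) M \<and>
    e ` carrier (P 0) = carrier M \<and>
    d 0 ` carrier (P 1) = a_kernel (P 0) M e \<and>
    (\<forall>i. d (Suc i) ` carrier (P (Suc (Suc i))) = a_kernel (P (Suc i)) (P i) (d i))"

text \<open>The carriers of the resolving modules are taken in the type \<open>('m \<times> 'a) list \<Rightarrow> 'a\<close>. This does not
  exclude any length: \<open>M\<close> and, inductively, every syzygy in a resolution by free modules on
  generating sets has cardinality at most that of \<open>('m \<times> 'a) list\<close>, so the generators can be indexed by
  such lists. The free modules then consist of finitely supported functions from these lists to
  \<open>R\<close>, and the last, projective, syzygy is a submodule of one of them.\<close>

definition has_projective_resolution_of_length ::
    "('a, 'c) ring_scheme \<Rightarrow> ('a, 'm, 'd) module_scheme \<Rightarrow> nat \<Rightarrow> bool"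
  where "has_projective_resolution_of_length R M n \<longleftrightarrow>
    (\<exists>(P :: nat \<Rightarrow> ('a, ('m \<times> 'a) list \<Rightarrow> 'a) module) d e.
       projective_resolution R M P d e \<and> (\<forall>i>n. carrier (P i) = {\<zero>\<^bsub>P i\<^esub>}))"

text \<open>The infimum of the empty set is \<open>\<infinity>\<close>. The zero module gets dimension \<open>0\<close> (some authors
  use \<open>-\<infinity>\<close> or \<open>-1\<close>), which makes no difference for upper bounds by natural numbers.\<close>

definition proj_dim :: "('a, 'c) ring_scheme \<Rightarrow> ('a, 'm, 'd) module_scheme \<Rightarrow> enat"
  where "proj_dim R M = Inf {enat n | n. has_projective_resolution_of_length R M n}"


section \<open>The localization is a commutative algebra\<close>

lemma UN_const1:
  "(a, s) \<in> X \<Longrightarrow> (\<And>a' s'. (a', s') \<in> X \<Longrightarrow> F a' s' = C) \<Longrightarrow> (\<Union>(a, s)\<in>X. F a s) = C"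
  by fastforce

lemma UN_const2:
  assumes "(a, s) \<in> X" "(b, t) \<in> Y"
    and "\<And>a' s' b' t'. (a', s') \<in> X \<Longrightarrow> (b', t') \<in> Y \<Longrightarrow> F a' s' b' t' = C"
  shows "(\<Union>(a, s)\<in>X. \<Union>(b, t)\<in>Y. F a s b t) = C"
  using assms by (intro UN_const1) auto

locale mult_subset = cring R + submonoid S R for R (structure) and S
begin

lemma S_carrier: "s \<in> S \<Longrightarrow> s \<in> carrier R"
  using subset by blast

lemma frac_rel_trans:
  assumes "a \<in> carrier R" "s \<in> S" "b \<in> carrier R" "t \<in> S" "c \<in> carrier R" "w \<in> S"
    and "\<exists>u\<in>S. u \<otimes> (a \<otimes> t) = u \<otimes> (b \<otimes> s)" "\<exists>u\<in>S. u \<otimes> (b \<otimes> w) = u \<otimes> (c \<otimes> t)"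
  shows "\<exists>u\<in>S. u \<otimes> (a \<otimes> w) = u \<otimes> (c \<otimes> s)"
proof -
  obtain u v where u: "u \<in> S" "u \<otimes> (a \<otimes> t) = u \<otimes> (b \<otimes> s)"
    and v: "v \<in> S" "v \<otimes> (b \<otimes> w) = v \<otimes> (c \<otimes> t)"
    using assms(7,8) by blast
  note [simp] = assms(1,3,5) S_carrier[OF assms(2)] S_carrier[OF assms(4)] S_carrier[OF assms(6)]
    S_carrier[OF u(1)] S_carrier[OF v(1)]
  have "(u \<otimes> v \<otimes> t) \<otimes> (a \<otimes> w) = (v \<otimes> w) \<otimes> (u \<otimes> (a \<otimes> t))"
    by (simp add: m_ac)
  also have "\<dots> = (u \<otimes> s) \<otimes> (v \<otimes> (b \<otimes> w))"
    unfolding u(2) by (simp add: m_ac)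
  also have "\<dots> = (u \<otimes> v \<otimes> t) \<otimes> (c \<otimes> s)"
    unfolding v(2) by (simp add: m_ac)
  finally show ?thesis
    using u v assms by (intro bexI[of _ "u \<otimes> v \<otimes> t"]) auto
qed

lemma frac_rel_sym:
  "\<exists>u\<in>S. u \<otimes> (a \<otimes> t) = u \<otimes> (b \<otimes> s) \<Longrightarrow> \<exists>u\<in>S. u \<otimes> (b \<otimes> s) = u \<otimes> (a \<otimes> t)"
  by (metis (no_types))

lemma frac_eq_iff:
  assumes "a \<in> carrier R" "s \<in> S" "b \<in> carrier R" "t \<in> S"
  shows "fraction R S a s = fraction R S b t \<longleftrightarrow> (\<exists>u\<in>S. u \<otimes> (a \<otimes> t) = u \<otimes> (b \<otimes> s))"
proof
  assume eq: "fraction R S a s = fraction R S b t"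
  have "(b, t) \<in> fraction R S b t"
    using assms one_closed by (auto simp: fraction_def)
  then have "(b, t) \<in> fraction R S a s"
    using eq by simp
  then show "\<exists>u\<in>S. u \<otimes> (a \<otimes> t) = u \<otimes> (b \<otimes> s)"
    by (auto simp: fraction_def)
next
  assume rel: "\<exists>u\<in>S. u \<otimes> (a \<otimes> t) = u \<otimes> (b \<otimes> s)"
  have "(\<exists>u\<in>S. u \<otimes> (a \<otimes> w) = u \<otimes> (c \<otimes> s)) \<longleftrightarrow> (\<exists>u\<in>S. u \<otimes> (b \<otimes> w) = u \<otimes> (c \<otimes> t))"
    if "c \<in> carrier R" "w \<in> S" for c w
    using frac_rel_trans[OF assms(3,4,1,2) that frac_rel_sym[OF rel]]
      frac_rel_trans[OF assms that rel] by (rule iffI)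
  then show "fraction R S a s = fraction R S b t"
    unfolding fraction_def by (intro Collect_cong) (simp add: split_beta cong: conj_cong)
qed

lemma mem_frac_iff:
  assumes "a \<in> carrier R" "s \<in> S"
  shows "(b, t) \<in> fraction R S a s \<longleftrightarrow> b \<in> carrier R \<and> t \<in> S \<and> fraction R S b t = fraction R S a s"
proof (cases "b \<in> carrier R \<and> t \<in> S")
  case True
  then have "(b, t) \<in> fraction R S a s \<longleftrightarrow> (\<exists>u\<in>S. u \<otimes> (a \<otimes> t) = u \<otimes> (b \<otimes> s))"
    by (simp add: fraction_def)
  with True show ?thesis
    using frac_eq_iff[OF assms, of b t] by metis
qed (auto simp: fraction_def)

lemma frac_self: "a \<in> carrier R \<Longrightarrow> s \<in> S \<Longrightarrow> (a, s) \<in> fraction R S a s"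
  by (simp add: mem_frac_iff)

lemma frac_cancel:
  assumes "a \<in> carrier R" "s \<in> S" "t \<in> S"
  shows "fraction R S (t \<otimes> a) (t \<otimes> s) = fraction R S a s"
  using assms S_carrier one_closed
  by (subst frac_eq_iff) (auto simp: m_ac intro!: bexI[of _ \<one>])

lemma frac_add_cong_left:
  assumes "a \<in> carrier R" "s \<in> S" "a' \<in> carrier R" "s' \<in> S" "b \<in> carrier R" "t \<in> S"
    and "fraction R S a s = fraction R S a' s'"
  shows "fraction R S (a \<otimes> t \<oplus> b \<otimes> s) (s \<otimes> t) = fraction R S (a' \<otimes> t \<oplus> b \<otimes> s') (s' \<otimes> t)"
proof -
  obtain u where u: "u \<in> S" "u \<otimes> (a \<otimes> s') = u \<otimes> (a' \<otimes> s)"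
    using assms frac_eq_iff by metis
  note [simp] = assms(1,3,5) S_carrier[OF assms(2)] S_carrier[OF assms(4)] S_carrier[OF assms(6)]
    S_carrier[OF u(1)]
  have "u \<otimes> ((a \<otimes> t \<oplus> b \<otimes> s) \<otimes> (s' \<otimes> t)) = t \<otimes> t \<otimes> (u \<otimes> (a \<otimes> s')) \<oplus> u \<otimes> b \<otimes> s \<otimes> s' \<otimes> t"
    by (simp add: l_distr r_distr m_ac)
  also have "\<dots> = u \<otimes> ((a' \<otimes> t \<oplus> b \<otimes> s') \<otimes> (s \<otimes> t))"
    unfolding u(2) by (simp add: l_distr r_distr m_ac)
  finally show ?thesis
    using u assms by (subst frac_eq_iff) auto
qed

lemma frac_mult_cong_left:
  assumes "a \<in> carrier R" "s \<in> S" "a' \<in> carrier R" "s' \<in> S" "b \<in> carrier R" "t \<in> S"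
    and "fraction R S a s = fraction R S a' s'"
  shows "fraction R S (a \<otimes> b) (s \<otimes> t) = fraction R S (a' \<otimes> b) (s' \<otimes> t)"
proof -
  obtain u where u: "u \<in> S" "u \<otimes> (a \<otimes> s') = u \<otimes> (a' \<otimes> s)"
    using assms frac_eq_iff by metis
  note [simp] = assms(1,3,5) S_carrier[OF assms(2)] S_carrier[OF assms(4)] S_carrier[OF assms(6)]
    S_carrier[OF u(1)]
  have "u \<otimes> ((a \<otimes> b) \<otimes> (s' \<otimes> t)) = t \<otimes> b \<otimes> (u \<otimes> (a \<otimes> s'))"
    by (simp add: m_ac)
  also have "\<dots> = u \<otimes> ((a' \<otimes> b) \<otimes> (s \<otimes> t))"
    unfolding u(2) by (simp add: m_ac)
  finally show ?thesis
    using u assms by (subst frac_eq_iff) auto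
qed

lemma localization_add:
  assumes "a \<in> carrier R" "s \<in> S" "b \<in> carrier R" "t \<in> S"
  shows "fraction R S a s \<oplus>\<^bsub>localization R S\<^esub> fraction R S b t =
    fraction R S (a \<otimes> t \<oplus> b \<otimes> s) (s \<otimes> t)"
proof -
  have "fraction R S (a' \<otimes> t' \<oplus> b' \<otimes> s') (s' \<otimes> t') = fraction R S (a \<otimes> t \<oplus> b \<otimes> s) (s \<otimes> t)"
    if m: "(a', s') \<in> fraction R S a s" "(b', t') \<in> fraction R S b t" for a' s' b' t'
  proof -
    have c: "a' \<in> carrier R" "s' \<in> S" "b' \<in> carrier R" "t' \<in> S"
      "fraction R S a' s' = fraction R S a s" "fraction R S b' t' = fraction R S b t"
      using m assms by (auto simp: mem_frac_iff)
    have comm: "x \<otimes> w \<oplus> y \<otimes> v = y \<otimes> v \<oplus> x \<otimes> w" "v \<otimes> w = w \<otimes> v"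
      if "x \<in> carrier R" "y \<in> carrier R" "v \<in> S" "w \<in> S" for x y v w
      using that S_carrier by (auto simp: a_comm m_comm)
    have "fraction R S (a' \<otimes> t' \<oplus> b' \<otimes> s') (s' \<otimes> t') = fraction R S (a \<otimes> t' \<oplus> b' \<otimes> s) (s \<otimes> t')"
      using frac_add_cong_left[of a' s' a s b' t'] c assms by simp
    also have "\<dots> = fraction R S (a \<otimes> t \<oplus> b \<otimes> s) (s \<otimes> t)"
      using frac_add_cong_left[of b' t' b t a s] c assms comm by simp
    finally show ?thesis .
  qed
  then have "(\<Union>(a', s')\<in>fraction R S a s. \<Union>(b', t')\<in>fraction R S b t. fraction R S (a' \<otimes> t' \<oplus> b' \<otimes> s') (s' \<otimes> t')) = fraction R S (a \<otimes> t \<oplus> b \<otimes> s) (s \<otimes> t)"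
    by (rule UN_const2[OF frac_self[OF assms(1,2)] frac_self[OF assms(3,4)]])
  then show ?thesis
    by (simp add: localization_def)
qed

lemma localization_mult:
  assumes "a \<in> carrier R" "s \<in> S" "b \<in> carrier R" "t \<in> S"
  shows "fraction R S a s \<otimes>\<^bsub>localization R S\<^esub> fraction R S b t = fraction R S (a \<otimes> b) (s \<otimes> t)"
proof -
  have "fraction R S (a' \<otimes> b') (s' \<otimes> t') = fraction R S (a \<otimes> b) (s \<otimes> t)"
    if m: "(a', s') \<in> fraction R S a s" "(b', t') \<in> fraction R S b t" for a' s' b' t'
  proof -
    have c: "a' \<in> carrier R" "s' \<in> S" "b' \<in> carrier R" "t' \<in> S"
      "fraction R S a' s' = fraction R S a s" "fraction R S b' t' = fraction R S b t"
      using m assms by (auto simp: mem_frac_iff)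
    have "fraction R S (a' \<otimes> b') (s' \<otimes> t') = fraction R S (a \<otimes> b') (s \<otimes> t')"
      using frac_mult_cong_left[of a' s' a s b' t'] c assms by simp
    also have "\<dots> = fraction R S (a \<otimes> b) (s \<otimes> t)"
      using frac_mult_cong_left[of b' t' b t a s] c assms S_carrier by (simp add: m_comm)
    finally show ?thesis .
  qed
  then have "(\<Union>(a', s')\<in>fraction R S a s. \<Union>(b', t')\<in>fraction R S b t. fraction R S (a' \<otimes> b') (s' \<otimes> t')) = fraction R S (a \<otimes> b) (s \<otimes> t)"
    by (rule UN_const2[OF frac_self[OF assms(1,2)] frac_self[OF assms(3,4)]])
  then show ?thesis
    by (simp add: localization_def)
qed

lemma localization_smult:
  assumes "r \<in> carrier R" "a \<in> carrier R" "s \<in> S"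
  shows "r \<odot>\<^bsub>localization R S\<^esub> fraction R S a s = fraction R S (r \<otimes> a) s"
proof -
  have "fraction R S (r \<otimes> a') s' = fraction R S (r \<otimes> a) s" if m: "(a', s') \<in> fraction R S a s" for a' s'
    using m assms frac_mult_cong_left[of a' s' a s r \<one>] S_carrier
    by (auto simp: mem_frac_iff m_comm)
  then have "(\<Union>(a', s')\<in>fraction R S a s. fraction R S (r \<otimes> a') s') = fraction R S (r \<otimes> a) s"
    by (rule UN_const1[OF frac_self[OF assms(2,3)]])
  then show ?thesis
    by (simp add: localization_def)
qed

lemma localization_carrier:
  "carrier (localization R S) = {fraction R S a s | a s. a \<in> carrier R \<and> s \<in> S}"
  by (simp add: localization_def)

lemma localization_zero: "\<zero>\<^bsub>localization R S\<^esub> = fraction R S \<zero> \<one>"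
  by (simp add: localization_def)

lemma localization_one: "\<one>\<^bsub>localization R S\<^esub> = fraction R S \<one> \<one>"
  by (simp add: localization_def)

lemma frac_same_denominator:
  assumes "a \<in> carrier R" "b \<in> carrier R" "s \<in> S"
  shows "fraction R S a s \<oplus>\<^bsub>localization R S\<^esub> fraction R S b s = fraction R S (a \<oplus> b) s"
  using assms S_carrier frac_cancel[of "a \<oplus> b" s s]
  by (simp add: localization_add r_distr m_comm)

lemma common_denominator:
  assumes "X \<in> carrier (localization R S)" "Y \<in> carrier (localization R S)"
  obtains a b s where "a \<in> carrier R" "b \<in> carrier R" "s \<in> S"
    "X = fraction R S a s" "Y = fraction R S b s"
proof -
  obtain a s b t where *: "a \<in> carrier R" "s \<in> S" "b \<in> carrier R" "t \<in> S"
    "X = fraction R S a s" "Y = fraction R S b t"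
    using assms by (auto simp: localization_carrier)
  have "X = fraction R S (t \<otimes> a) (s \<otimes> t)" "Y = fraction R S (s \<otimes> b) (s \<otimes> t)"
    using * frac_cancel[of a s t] frac_cancel[of b t s] S_carrier by (auto simp: m_comm)
  with * show thesis
    using S_carrier by (intro that[of "t \<otimes> a" "s \<otimes> b" "s \<otimes> t"]) auto
qed

lemma common_denominator3:
  assumes "X \<in> carrier (localization R S)" "Y \<in> carrier (localization R S)"
    "Z \<in> carrier (localization R S)"
  obtains a b c s where "a \<in> carrier R" "b \<in> carrier R" "c \<in> carrier R" "s \<in> S"
    "X = fraction R S a s" "Y = fraction R S b s" "Z = fraction R S c s"
proof -
  obtain a b s where *: "a \<in> carrier R" "b \<in> carrier R" "s \<in> S"
    "X = fraction R S a s" "Y = fraction R S b s"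
    using assms(1,2) by (rule common_denominator)
  obtain c t where **: "c \<in> carrier R" "t \<in> S" "Z = fraction R S c t"
    using assms by (auto simp: localization_carrier)
  have "X = fraction R S (t \<otimes> a) (s \<otimes> t)" "Y = fraction R S (t \<otimes> b) (s \<otimes> t)" "Z = fraction R S (s \<otimes> c) (s \<otimes> t)"
    using * ** frac_cancel[of a s t] frac_cancel[of b s t] frac_cancel[of c t s] S_carrier
    by (auto simp: m_comm)
  with * ** show thesis
    using S_carrier by (intro that[of "t \<otimes> a" "t \<otimes> b" "s \<otimes> c" "s \<otimes> t"]) auto
qed

lemma frac_in_carrier [simp, intro]:
  "a \<in> carrier R \<Longrightarrow> s \<in> S \<Longrightarrow> fraction R S a s \<in> carrier (localization R S)"
  by (auto simp: localization_carrier)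

lemma frac_zero: "s \<in> S \<Longrightarrow> fraction R S \<zero> s = \<zero>\<^bsub>localization R S\<^esub>"
  using S_carrier by (auto simp: localization_zero frac_eq_iff intro!: bexI[of _ \<one>])

lemma localization_abelian_group: "abelian_group (localization R S)"
proof (rule abelian_groupI)
  fix X Y Z
  assume XYZ: "X \<in> carrier (localization R S)" "Y \<in> carrier (localization R S)"
    "Z \<in> carrier (localization R S)"
  obtain a b c s where *: "a \<in> carrier R" "b \<in> carrier R" "c \<in> carrier R" "s \<in> S"
    "X = fraction R S a s" "Y = fraction R S b s" "Z = fraction R S c s"
    using XYZ by (rule common_denominator3)
  then show "X \<oplus>\<^bsub>localization R S\<^esub> Y \<oplus>\<^bsub>localization R S\<^esub> Z =
      X \<oplus>\<^bsub>localization R S\<^esub> (Y \<oplus>\<^bsub>localization R S\<^esub> Z)"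
    by (simp add: frac_same_denominator a_assoc)
next
  fix X Y
  assume XY: "X \<in> carrier (localization R S)" "Y \<in> carrier (localization R S)"
  obtain a b s where *: "a \<in> carrier R" "b \<in> carrier R" "s \<in> S"
    "X = fraction R S a s" "Y = fraction R S b s"
    using XY by (rule common_denominator)
  then show "X \<oplus>\<^bsub>localization R S\<^esub> Y = Y \<oplus>\<^bsub>localization R S\<^esub> X"
    and "X \<oplus>\<^bsub>localization R S\<^esub> Y \<in> carrier (localization R S)"
    by (simp_all add: frac_same_denominator a_comm frac_in_carrier)
next
  fix X
  assume X: "X \<in> carrier (localization R S)"
  obtain a s where *: "a \<in> carrier R" "s \<in> S" "X = fraction R S a s"
    using X by (auto simp: localization_carrier)
  then show "\<zero>\<^bsub>localization R S\<^esub> \<oplus>\<^bsub>localization R S\<^esub> X = X"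
    using frac_zero[of s] by (metis frac_same_denominator l_zero zero_closed)
  have "fraction R S (\<ominus> a) s \<oplus>\<^bsub>localization R S\<^esub> X = \<zero>\<^bsub>localization R S\<^esub>"
    using * by (simp add: frac_same_denominator frac_zero l_neg)
  then show "\<exists>Y\<in>carrier (localization R S). Y \<oplus>\<^bsub>localization R S\<^esub> X = \<zero>\<^bsub>localization R S\<^esub>"
    using * by (intro bexI[of _ "fraction R S (\<ominus> a) s"]) auto
qed (simp add: localization_zero frac_in_carrier)

lemma localization_cring: "cring (localization R S)"
proof (rule cringI[OF localization_abelian_group])
  show "Group.comm_monoid (localization R S)"
  proof (rule comm_monoidI)
    fix X Y Z
    assume XYZ: "X \<in> carrier (localization R S)" "Y \<in> carrier (localization R S)"
      "Z \<in> carrier (localization R S)"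
    obtain a b c s where *: "a \<in> carrier R" "b \<in> carrier R" "c \<in> carrier R" "s \<in> S"
      "X = fraction R S a s" "Y = fraction R S b s" "Z = fraction R S c s"
      using XYZ by (rule common_denominator3)
    then show "X \<otimes>\<^bsub>localization R S\<^esub> Y \<otimes>\<^bsub>localization R S\<^esub> Z =
        X \<otimes>\<^bsub>localization R S\<^esub> (Y \<otimes>\<^bsub>localization R S\<^esub> Z)"
      using S_carrier by (simp add: localization_mult m_assoc)
  next
    fix X Y
    assume XY: "X \<in> carrier (localization R S)" "Y \<in> carrier (localization R S)"
    obtain a b s where *: "a \<in> carrier R" "b \<in> carrier R" "s \<in> S"
      "X = fraction R S a s" "Y = fraction R S b s"
      using XY by (rule common_denominator)
    then show "X \<otimes>\<^bsub>localization R S\<^esub> Y = Y \<otimes>\<^bsub>localization R S\<^esub> X"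
      and "X \<otimes>\<^bsub>localization R S\<^esub> Y \<in> carrier (localization R S)"
      by (simp_all add: localization_mult m_comm frac_in_carrier)
  next
    fix X
    assume X: "X \<in> carrier (localization R S)"
    obtain a s where *: "a \<in> carrier R" "s \<in> S" "X = fraction R S a s"
      using X by (auto simp: localization_carrier)
    then show "\<one>\<^bsub>localization R S\<^esub> \<otimes>\<^bsub>localization R S\<^esub> X = X"
      using S_carrier by (simp add: localization_one localization_mult)
  qed (simp add: localization_one frac_in_carrier)
next
  fix X Y Z
  assume XYZ: "X \<in> carrier (localization R S)" "Y \<in> carrier (localization R S)"
    "Z \<in> carrier (localization R S)"
  obtain a b c s where *: "a \<in> carrier R" "b \<in> carrier R" "c \<in> carrier R" "s \<in> S"
    "X = fraction R S a s" "Y = fraction R S b s" "Z = fraction R S c s"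
    using XYZ by (rule common_denominator3)
  then show "(X \<oplus>\<^bsub>localization R S\<^esub> Y) \<otimes>\<^bsub>localization R S\<^esub> Z =
      X \<otimes>\<^bsub>localization R S\<^esub> Z \<oplus>\<^bsub>localization R S\<^esub> Y \<otimes>\<^bsub>localization R S\<^esub> Z"
    by (simp add: frac_same_denominator localization_mult l_distr)
qed

lemma localization_algebra: "algebra R (localization R S)"
proof (rule algebraI[OF is_cring localization_cring])
  fix r q X Y
  assume r: "r \<in> carrier R" and X: "X \<in> carrier (localization R S)"
  obtain a s where *: "a \<in> carrier R" "s \<in> S" "X = fraction R S a s"
    using X by (auto simp: localization_carrier)
  show "r \<odot>\<^bsub>localization R S\<^esub> X \<in> carrier (localization R S)"
    using * r by (simp add: localization_smult)
  {
    assume q: "q \<in> carrier R"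
    show "(r \<oplus> q) \<odot>\<^bsub>localization R S\<^esub> X =
        r \<odot>\<^bsub>localization R S\<^esub> X \<oplus>\<^bsub>localization R S\<^esub> q \<odot>\<^bsub>localization R S\<^esub> X"
      using * r q by (simp add: localization_smult frac_same_denominator l_distr)
    show "(r \<otimes> q) \<odot>\<^bsub>localization R S\<^esub> X = r \<odot>\<^bsub>localization R S\<^esub> (q \<odot>\<^bsub>localization R S\<^esub> X)"
      using * r q by (simp add: localization_smult m_assoc)
  }
  assume Y: "Y \<in> carrier (localization R S)"
  obtain a b s where *: "a \<in> carrier R" "b \<in> carrier R" "s \<in> S"
    "X = fraction R S a s" "Y = fraction R S b s"
    using X Y by (rule common_denominator)
  show "r \<odot>\<^bsub>localization R S\<^esub> (X \<oplus>\<^bsub>localization R S\<^esub> Y) =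
      r \<odot>\<^bsub>localization R S\<^esub> X \<oplus>\<^bsub>localization R S\<^esub> r \<odot>\<^bsub>localization R S\<^esub> Y"
    using * r by (simp add: localization_smult frac_same_denominator r_distr)
  show "(r \<odot>\<^bsub>localization R S\<^esub> X) \<otimes>\<^bsub>localization R S\<^esub> Y =
      r \<odot>\<^bsub>localization R S\<^esub> (X \<otimes>\<^bsub>localization R S\<^esub> Y)"
    using * r by (simp add: localization_smult localization_mult m_assoc)
next
  fix X
  assume X: "X \<in> carrier (localization R S)"
  obtain a s where *: "a \<in> carrier R" "s \<in> S" "X = fraction R S a s"
    using X by (auto simp: localization_carrier)
  then show "\<one> \<odot>\<^bsub>localization R S\<^esub> X = X"
    by (simp add: localization_smult)
qed

end


section \<open>The lifting property in arbitrary types\<close>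

definition free_module :: "('a, 'c) ring_scheme \<Rightarrow> 'b set \<Rightarrow> ('a, 'b \<Rightarrow> 'a) module"
  where "free_module R X =
    \<lparr> carrier = {\<phi>. (\<forall>x. \<phi> x \<in> carrier R) \<and> finite {x. \<phi> x \<noteq> \<zero>\<^bsub>R\<^esub>} \<and> {x. \<phi> x \<noteq> \<zero>\<^bsub>R\<^esub>} \<subseteq> X},
      mult = undefined, one = undefined,
      zero = (\<lambda>_. \<zero>\<^bsub>R\<^esub>),
      add = (\<lambda>\<phi> \<psi> x. \<phi> x \<oplus>\<^bsub>R\<^esub> \<psi> x),
      smult = (\<lambda>r \<phi> x. r \<otimes>\<^bsub>R\<^esub> \<phi> x) \<rparr>"

lemma (in cring) free_module_module: "module R (free_module R X)"
proof (rule moduleI[OF is_cring])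
  show "abelian_group (free_module R X)"
  proof (rule abelian_groupI)
    fix \<phi> \<psi>
    assume *: "\<phi> \<in> carrier (free_module R X)" "\<psi> \<in> carrier (free_module R X)"
    have "{x. \<phi> x \<oplus> \<psi> x \<noteq> \<zero>} \<subseteq> {x. \<phi> x \<noteq> \<zero>} \<union> {x. \<psi> x \<noteq> \<zero>}"
      by auto
    with * show "\<phi> \<oplus>\<^bsub>free_module R X\<^esub> \<psi> \<in> carrier (free_module R X)"
      by (auto simp: free_module_def intro: finite_subset)
  next
    fix \<phi>
    assume \<phi>: "\<phi> \<in> carrier (free_module R X)"
    have [simp]: "\<ominus> r = \<zero> \<longleftrightarrow> r = \<zero>" if "r \<in> carrier R" for r
      using that by (metis minus_minus minus_zero)
    show "\<exists>\<psi>\<in>carrier (free_module R X). \<psi> \<oplus>\<^bsub>free_module R X\<^esub> \<phi> = \<zero>\<^bsub>free_module R X\<^esub>"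
      using \<phi> by (intro bexI[of _ "\<lambda>x. \<ominus> \<phi> x"]) (auto simp: free_module_def l_neg)
  qed (auto simp: free_module_def a_ac)
next
  fix r \<phi>
  assume *: "r \<in> carrier R" "\<phi> \<in> carrier (free_module R X)"
  then have "{x. r \<otimes> \<phi> x \<noteq> \<zero>} \<subseteq> {x. \<phi> x \<noteq> \<zero>}"
    by auto
  with * show "r \<odot>\<^bsub>free_module R X\<^esub> \<phi> \<in> carrier (free_module R X)"
    by (auto simp: free_module_def intro: finite_subset)
qed (auto simp: free_module_def l_distr r_distr m_assoc)

definition free_eval ::
    "('a, 'c) ring_scheme \<Rightarrow> ('a, 'm, 'd) module_scheme \<Rightarrow> ('b \<Rightarrow> 'm) \<Rightarrow> ('b \<Rightarrow> 'a) \<Rightarrow> 'm"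
  where "free_eval R M k \<phi> = (\<Oplus>\<^bsub>M\<^esub>x\<in>{x. \<phi> x \<noteq> \<zero>\<^bsub>R\<^esub>}. \<phi> x \<odot>\<^bsub>M\<^esub> k x)"

context module
begin

lemma free_eval_superset:
  assumes "k \<in> X \<rightarrow> carrier M" "\<phi> \<in> carrier (free_module R X)"
    "finite B" "{x. \<phi> x \<noteq> \<zero>} \<subseteq> B" "B \<subseteq> X"
  shows "free_eval R M k \<phi> = (\<Oplus>\<^bsub>M\<^esub>x\<in>B. \<phi> x \<odot>\<^bsub>M\<^esub> k x)"
  unfolding free_eval_def
proof (rule M.add.finprod_mono_neutral_cong_left)
  show "\<And>i. i \<in> B - {x. \<phi> x \<noteq> \<zero>} \<Longrightarrow> \<phi> i \<odot>\<^bsub>M\<^esub> k i = \<zero>\<^bsub>M\<^esub>"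
    using assms by (auto simp: Pi_iff)
  show "(\<lambda>x. \<phi> x \<odot>\<^bsub>M\<^esub> k x) \<in> B \<rightarrow> carrier M"
    using assms by (auto simp: free_module_def Pi_iff)
qed (use assms in auto)

lemma smult_finsum:
  assumes "r \<in> carrier R" "finite B" "f \<in> B \<rightarrow> carrier M"
  shows "r \<odot>\<^bsub>M\<^esub> (\<Oplus>\<^bsub>M\<^esub>x\<in>B. f x) = (\<Oplus>\<^bsub>M\<^esub>x\<in>B. r \<odot>\<^bsub>M\<^esub> f x)"
  using assms(2,3)
proof (induction B rule: finite_induct)
  case (insert x B)
  then have "(\<lambda>x. r \<odot>\<^bsub>M\<^esub> f x) \<in> B \<rightarrow> carrier M" "r \<odot>\<^bsub>M\<^esub> f x \<in> carrier M"
    "f x \<in> carrier M" "f \<in> B \<rightarrow> carrier M" "finsum M f B \<in> carrier M"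
    using assms(1) by (auto simp: Pi_iff)
  then show ?case
    using insert assms(1) by (simp add: smult_r_distr)
qed (use assms(1) in simp)

lemma free_eval_hom:
  assumes k: "k \<in> X \<rightarrow> carrier M"
  shows "free_eval R M k \<in> mod_hom R (free_module R X) M"
proof -
  let ?F = "free_module R X"
  interpret F: module R ?F by (rule R.free_module_module)
  have carrF: "\<And>\<phi> x. \<phi> \<in> carrier ?F \<Longrightarrow> \<phi> x \<in> carrier R"
    "\<And>\<phi>. \<phi> \<in> carrier ?F \<Longrightarrow> finite {x. \<phi> x \<noteq> \<zero>}"
    "\<And>\<phi>. \<phi> \<in> carrier ?F \<Longrightarrow> {x. \<phi> x \<noteq> \<zero>} \<subseteq> X"
    by (auto simp: free_module_def)
  have closed: "free_eval R M k \<phi> \<in> carrier M" if "\<phi> \<in> carrier ?F" for \<phi>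
    unfolding free_eval_def
    by (rule M.finsum_closed) (use carrF(1,3)[OF that] k in \<open>auto intro!: smult_closed\<close>)
  moreover have "free_eval R M k (\<phi> \<oplus>\<^bsub>?F\<^esub> \<psi>) = free_eval R M k \<phi> \<oplus>\<^bsub>M\<^esub> free_eval R M k \<psi>"
    if \<phi>: "\<phi> \<in> carrier ?F" and \<psi>: "\<psi> \<in> carrier ?F" for \<phi> \<psi>
  proof -
    let ?B = "{x. \<phi> x \<noteq> \<zero>} \<union> {x. \<psi> x \<noteq> \<zero>}"
    have B: "finite ?B" "?B \<subseteq> X" "{x. \<phi> x \<noteq> \<zero>} \<subseteq> ?B" "{x. \<psi> x \<noteq> \<zero>} \<subseteq> ?B"
      using carrF[OF \<phi>] carrF[OF \<psi>] by auto
    have B': "{x. (\<phi> \<oplus>\<^bsub>?F\<^esub> \<psi>) x \<noteq> \<zero>} \<subseteq> ?B"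
      by (auto simp: free_module_def)
    have kB: "k x \<in> carrier M" if "x \<in> ?B" for x
      using that k B(2) by auto
    have "free_eval R M k (\<phi> \<oplus>\<^bsub>?F\<^esub> \<psi>) = (\<Oplus>\<^bsub>M\<^esub>x\<in>?B. (\<phi> \<oplus>\<^bsub>?F\<^esub> \<psi>) x \<odot>\<^bsub>M\<^esub> k x)"
      by (rule free_eval_superset[OF k F.add.m_closed[OF \<phi> \<psi>] B(1) B' B(2)])
    also have "\<dots> = (\<Oplus>\<^bsub>M\<^esub>x\<in>?B. \<phi> x \<odot>\<^bsub>M\<^esub> k x \<oplus>\<^bsub>M\<^esub> \<psi> x \<odot>\<^bsub>M\<^esub> k x)"
      by (rule M.finsum_cong')
        (use kB carrF[OF \<phi>] carrF[OF \<psi>] in \<open>auto simp: free_module_def smult_l_distr\<close>)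
    also have "\<dots> = (\<Oplus>\<^bsub>M\<^esub>x\<in>?B. \<phi> x \<odot>\<^bsub>M\<^esub> k x) \<oplus>\<^bsub>M\<^esub> (\<Oplus>\<^bsub>M\<^esub>x\<in>?B. \<psi> x \<odot>\<^bsub>M\<^esub> k x)"
      by (rule M.finsum_addf) (use kB carrF[OF \<phi>] carrF[OF \<psi>] in \<open>auto simp: Pi_iff\<close>)
    finally show ?thesis
      using free_eval_superset[OF k \<phi> B(1,3,2)] free_eval_superset[OF k \<psi> B(1,4,2)] by simp
  qed
  moreover have "free_eval R M k (r \<odot>\<^bsub>?F\<^esub> \<phi>) = r \<odot>\<^bsub>M\<^esub> free_eval R M k \<phi>"
    if r: "r \<in> carrier R" and \<phi>: "\<phi> \<in> carrier ?F" for r \<phi>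
  proof -
    let ?B = "{x. \<phi> x \<noteq> \<zero>}"
    have B: "finite ?B" "?B \<subseteq> X"
      using carrF[OF \<phi>] by auto
    have B': "{x. (r \<odot>\<^bsub>?F\<^esub> \<phi>) x \<noteq> \<zero>} \<subseteq> ?B"
      using r by (auto simp: free_module_def)
    have kB: "k x \<in> carrier M" if "x \<in> ?B" for x
      using that k B(2) by auto
    have "free_eval R M k (r \<odot>\<^bsub>?F\<^esub> \<phi>) = (\<Oplus>\<^bsub>M\<^esub>x\<in>?B. (r \<odot>\<^bsub>?F\<^esub> \<phi>) x \<odot>\<^bsub>M\<^esub> k x)"
      by (rule free_eval_superset[OF k F.smult_closed[OF r \<phi>] B(1) B' B(2)])
    also have "\<dots> = (\<Oplus>\<^bsub>M\<^esub>x\<in>?B. r \<odot>\<^bsub>M\<^esub> (\<phi> x \<odot>\<^bsub>M\<^esub> k x))"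
      by (rule M.finsum_cong')
        (use r kB carrF[OF \<phi>] in \<open>auto simp: free_module_def smult_assoc1\<close>)
    also have "\<dots> = r \<odot>\<^bsub>M\<^esub> free_eval R M k \<phi>"
      unfolding free_eval_def
      by (rule smult_finsum[symmetric]) (use r B kB carrF[OF \<phi>] in \<open>auto simp: Pi_iff\<close>)
    finally show ?thesis .
  qed
  ultimately show ?thesis
    by (auto simp: mod_hom_def)
qed

end

lemma mod_hom_finsum:
  assumes "module R M" "module R N" "g \<in> mod_hom R M N" "finite B" "f \<in> B \<rightarrow> carrier M"
  shows "g (\<Oplus>\<^bsub>M\<^esub>x\<in>B. f x) = (\<Oplus>\<^bsub>N\<^esub>x\<in>B. g (f x))"
proof -
  interpret M: module R M by fact
  interpret N: module R N by fact
  have g0: "g \<zero>\<^bsub>M\<^esub> = \<zero>\<^bsub>N\<^esub>"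
  proof -
    have "g (\<zero>\<^bsub>R\<^esub> \<odot>\<^bsub>M\<^esub> \<zero>\<^bsub>M\<^esub>) = \<zero>\<^bsub>R\<^esub> \<odot>\<^bsub>N\<^esub> g \<zero>\<^bsub>M\<^esub>" "g \<zero>\<^bsub>M\<^esub> \<in> carrier N"
      using assms(3) M.R.zero_closed M.M.zero_closed unfolding mod_hom_def by blast+
    then show ?thesis by simp
  qed
  show ?thesis
    using assms(4,5)
  proof (induction B rule: finite_induct)
    case (insert x B)
    then have "f x \<in> carrier M" "f \<in> B \<rightarrow> carrier M" "finsum M f B \<in> carrier M"
      "(\<lambda>x. g (f x)) \<in> B \<rightarrow> carrier N" "g (f x) \<in> carrier N"
      using assms(3) by (auto simp: mod_hom_def Pi_iff)
    then show ?case
      using insert assms(3) by (simp add: mod_hom_def)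
  qed (simp add: g0)
qed

lemma mod_hom_free_eval:
  assumes M: "module R M" and N: "module R N" and g: "g \<in> mod_hom R M N"
    and k: "k \<in> X \<rightarrow> carrier M" and \<phi>: "\<phi> \<in> carrier (free_module R X)"
  shows "g (free_eval R M k \<phi>) = free_eval R N (g \<circ> k) \<phi>"
proof -
  interpret M: module R M by fact
  interpret N: module R N by fact
  let ?B = "{x. \<phi> x \<noteq> \<zero>\<^bsub>R\<^esub>}"
  have B: "finite ?B" "?B \<subseteq> X" "\<And>x. \<phi> x \<in> carrier R"
    using \<phi> by (auto simp: free_module_def)
  then have kB: "k x \<in> carrier M" if "x \<in> ?B" for x
    using that k by auto
  have "g (free_eval R M k \<phi>) = (\<Oplus>\<^bsub>N\<^esub>x\<in>?B. g (\<phi> x \<odot>\<^bsub>M\<^esub> k x))"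
    unfolding free_eval_def
    by (rule mod_hom_finsum[OF M N g B(1)]) (use B kB in \<open>auto simp: Pi_iff\<close>)
  also have "\<dots> = free_eval R N (g \<circ> k) \<phi>"
    unfolding free_eval_def
    by (rule N.finsum_cong') (use g B kB in \<open>auto simp: mod_hom_def Pi_iff\<close>)
  finally show ?thesis .
qed

lemma (in module) free_eval_unit:
  assumes "k \<in> X \<rightarrow> carrier M" "x \<in> X"
  shows "(\<lambda>y. if y = x then \<one> else \<zero>) \<in> carrier (free_module R X)"
    and "free_eval R M k (\<lambda>y. if y = x then \<one> else \<zero>) = k x"
proof -
  have sub: "{y. (if y = x then \<one> else \<zero>) \<noteq> \<zero>} \<subseteq> {x}"
    by auto
  show *: "(\<lambda>y. if y = x then \<one> else \<zero>) \<in> carrier (free_module R X)"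
    using assms sub by (auto simp: free_module_def intro: finite_subset split: if_splits)
  show "free_eval R M k (\<lambda>y. if y = x then \<one> else \<zero>) = k x"
    using free_eval_superset[OF assms(1) *, OF _ sub] assms by (auto simp: Pi_iff)
qed

theorem projective_module_lift:
  fixes R :: "('a, 'c) ring_scheme" and P :: "('a, 'b) module"
    and M :: "('a, 'm, 'd) module_scheme" and N :: "('a, 'n, 'e) module_scheme"
  assumes P: "projective_module R P"
    and M: "module R M" and N: "module R N"
    and g: "g \<in> mod_hom R M N" "g ` carrier M = carrier N"
    and f: "f \<in> mod_hom R P N"
  obtains h where "h \<in> mod_hom R P M" "\<And>x. x \<in> carrier P \<Longrightarrow> g (h x) = f x"
proof -
  interpret P: module R P using P by (simp add: projective_module_def)
  interpret M: module R M by fact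
  interpret N: module R N by fact
  let ?X = "carrier P" and ?F = "free_module R (carrier P)"
  have F: "module R ?F" by (rule P.R.free_module_module)
  let ?p = "free_eval R P (\<lambda>x. x)"
  have p: "?p \<in> mod_hom R ?F P"
    by (rule P.free_eval_hom) auto
  have "x \<in> ?p ` carrier ?F" if "x \<in> ?X" for x
    using P.free_eval_unit[of "\<lambda>x. x" ?X x] that
    by (intro image_eqI[of _ _ "\<lambda>y. if y = x then \<one>\<^bsub>R\<^esub> else \<zero>\<^bsub>R\<^esub>"]) simp_all
  then have p_surj: "?p ` carrier ?F = carrier P"
    using p by (auto simp: mod_hom_def)
  have "(\<lambda>x. x) \<in> mod_hom R P P"
    by (auto simp: mod_hom_def)
  with P F p p_surj P.module_axioms obtain s
    where s: "s \<in> mod_hom R P ?F" "\<And>x. x \<in> carrier P \<Longrightarrow> ?p (s x) = x"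
    unfolding projective_module_def by meson
  have "\<exists>y\<in>carrier M. g y = f x" if "x \<in> carrier P" for x
  proof -
    have "f x \<in> g ` carrier M"
      unfolding g(2) using f that by (auto simp: mod_hom_def)
    then show ?thesis by auto
  qed
  then obtain k where k: "\<And>x. x \<in> carrier P \<Longrightarrow> k x \<in> carrier M \<and> g (k x) = f x"
    by metis
  have k_Pi: "k \<in> ?X \<rightarrow> carrier M" using k by auto
  let ?h = "\<lambda>x. free_eval R M k (s x)"
  have sF: "s x \<in> carrier ?F" if "x \<in> carrier P" for x
    using s(1) that by (auto simp: mod_hom_def)
  have "?h \<in> mod_hom R P M"
    using M.free_eval_hom[OF k_Pi] s(1) by (auto simp: mod_hom_def Pi_iff)
  moreover have "g (?h x) = f x" if x: "x \<in> carrier P" for x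
  proof -
    have fsupp: "{y. s x y \<noteq> \<zero>\<^bsub>R\<^esub>} \<subseteq> carrier P" "\<And>y. s x y \<in> carrier R"
      using sF[OF x] by (auto simp: free_module_def)
    have fN: "f y \<in> carrier N" if "y \<in> carrier P" for y
      using f that by (auto simp: mod_hom_def)
    have "g (?h x) = free_eval R N (g \<circ> k) (s x)"
      by (rule mod_hom_free_eval[OF M N g(1) k_Pi sF[OF x]])
    also have "\<dots> = free_eval R N (f \<circ> (\<lambda>x. x)) (s x)"
      unfolding free_eval_def
      by (rule N.finsum_cong') (use k fsupp fN in \<open>auto simp: Pi_iff subset_iff\<close>)
    also have "\<dots> = f (?p (s x))"
      by (rule mod_hom_free_eval[OF P.module_axioms N f _ sF[OF x], symmetric]) auto
    finally show ?thesis using s(2)[OF x] by simp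
  qed
  ultimately show thesis by (rule that)
qed

end

theory Submission
  imports Defs
begin

text \<open>For every maximal ideal \<open>\<mm>\<close> meeting \<open>S\<close>, pick \<open>s\<close> in \<open>S \<inter> \<mm>\<close>. Since \<open>R/sR\<close> is semilocal with all
  primes maximal, it has an idempotent cutting out its local factor at \<open>\<mm>\<close>. Lifting these idempotents
  compatibly along \<open>s, s\<^sup>2, s\<^sup>4, \<dots>\<close> gives pairs \<open>(s\<^sub>n, f\<^sub>n)\<close> that vanish simultaneously only at \<open>\<mm>\<close>,
  with \<open>f\<^sub>n (1 - f\<^sub>n)\<close> divisible by \<open>s\<^sub>n\<close>, so that \<open>s\<^sub>n\<close> and \<open>f\<^sub>n\<close> behave like generators of an invertible
  ideal even when \<open>S\<close> contains zero-divisors. The union of the inverses of these "ideals" is a flat module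
  \<open>U\<^sub>\<mm>\<close> ("functions with poles only at \<open>\<mm>\<close>") that is the colimit of a sequence of free modules of
  rank \<open>2\<close>, hence has a telescope resolution of length \<open>1\<close>. The cones of \<open>R \<rightarrow> U\<^sub>\<mm>\<close> have pairwise disjoint
  supports and add up to the cone of \<open>R \<rightarrow> R\<^sub>S\<close>. Gluing the telescopes along their common term \<open>R\<close>
  therefore gives a free resolution of \<open>R\<^sub>S\<close> of length \<open>1\<close>, whose exactness is checked one maximal ideal
  at a time.\<close>

section \<open>Primes and maximal ideals of R, idempotents modulo \<open>s\<close>, and their
  successive lifts\<close>

section \<open>Isolating a maximal ideal\<close>

lemma (in primeideal) one_notin: "\<one> \<notin> I"
  using one_imp_carrier I_notcarr by auto

lemma (in primeideal) pow_mem: "r [^] (n::nat) \<in> I \<Longrightarrow> r \<in> carrier R \<Longrightarrow> r \<in> I"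
proof (induction n)
  case (Suc n)
  then show ?case
    using I_prime[of "r [^] n" r] by auto
qed (simp add: one_notin)

context cring
begin

text \<open>Serves identities that hold only modulo a relation such as
  \<open>s \<otimes> x = f \<ominus> f \<otimes> f\<close>: the difference of the two sides is a
  multiple of that relation, which is a plain polynomial identity.\<close>

lemma eq_minusI:
  assumes "a \<ominus> b = \<zero>" "a \<in> carrier R" "b \<in> carrier R"
  shows "a = b"
proof -
  have "a = (a \<ominus> b) \<oplus> b"
    using assms(2,3) by (simp add: minus_eq a_assoc l_neg)
  then show ?thesis
    using assms by simp
qed

text \<open>Krull's argument: Zorn's lemma gives an ideal that is maximal among those containing
  \<open>I\<close> and disjoint from \<open>T\<close>, and every such ideal is prime.\<close>

lemma prime_avoiding:
  assumes I: "ideal I R" and T: "submonoid T R" and disj: "I \<inter> T = {}"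
  obtains \<pp> where "primeideal \<pp> R" "I \<subseteq> \<pp>" "\<pp> \<inter> T = {}"
proof -
  let ?A = "{J. ideal J R \<and> I \<subseteq> J \<and> J \<inter> T = {}}"
  have "\<exists>M\<in>?A. \<forall>X\<in>?A. M \<subseteq> X \<longrightarrow> X = M"
  proof (rule subset_Zorn_nonempty)
    show "?A \<noteq> {}" using I disj by auto
  next
    fix C assume C: "C \<noteq> {}" "subset.chain ?A C"
    then have CA: "C \<subseteq> ?A"
      by (simp add: subset_chain_def)
    then have CI: "ideal J R" if "J \<in> C" for J
      using that by auto
    have lin: "J \<subseteq> K \<or> K \<subseteq> J" if "J \<in> C" "K \<in> C" for J K
      using C(2) that unfolding subset_chain_def by blast
    have "ideal (\<Union>C) R"
    proof (rule idealI[OF ring_axioms])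
      show "subgroup (\<Union>C) (add_monoid R)"
      proof (rule group.subgroupI[OF a_group])
        show "\<Union>C \<subseteq> carrier (add_monoid R)"
          using additive_subgroup.a_subset[OF ideal.axioms(1)[OF CI]] by auto
        show "\<Union>C \<noteq> {}"
          using additive_subgroup.zero_closed[OF ideal.axioms(1)[OF CI]] C(1) by auto
        fix a assume a: "a \<in> \<Union>C"
        then show "inv\<^bsub>add_monoid R\<^esub> a \<in> \<Union>C"
          using additive_subgroup.a_inv_closed[OF ideal.axioms(1)[OF CI]] by (auto simp: a_inv_def)
        fix b assume "b \<in> \<Union>C"
        with a obtain J where "J \<in> C" "a \<in> J" "b \<in> J"
          using lin by blast
        then have "a \<oplus> b \<in> J"
          using CA by (auto intro: additive_subgroup.a_closed[OF ideal.axioms(1)])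
        then show "a \<otimes>\<^bsub>add_monoid R\<^esub> b \<in> \<Union>C"
          using \<open>J \<in> C\<close> by auto
      qed
    qed (use CI in \<open>auto intro: ideal.I_l_closed ideal.I_r_closed\<close>)
    then show "\<Union>C \<in> ?A"
      using C(1) CA by auto
  qed
  then obtain P where P: "ideal P R" "I \<subseteq> P" "P \<inter> T = {}"
    and max: "\<And>J. ideal J R \<Longrightarrow> P \<subseteq> J \<Longrightarrow> J \<inter> T = {} \<Longrightarrow> J = P"
    by (smt (verit) mem_Collect_eq subset_trans)
  interpret P: ideal P R by fact
  interpret T: submonoid T R by fact
  \<comment> \<open>If P + (a) were disjoint from \<open>T\<close>, maximality of \<open>P\<close>
    would put \<open>a\<close> into \<open>P\<close>.\<close>
  have meet: "\<exists>p\<in>P. \<exists>r\<in>carrier R. p \<oplus> r \<otimes> a \<in> T" if a: "a \<in> carrier R" "a \<notin> P" for a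
  proof (rule ccontr)
    assume neg: "\<not> ?thesis"
    have id: "ideal (P <+>\<^bsub>R\<^esub> PIdl a) R"
      using add_ideals[OF P(1) cgenideal_ideal[OF a(1)]] .
    have mem: "x \<in> P <+>\<^bsub>R\<^esub> PIdl a \<longleftrightarrow> (\<exists>p\<in>P. \<exists>r\<in>carrier R. x = p \<oplus> r \<otimes> a)" for x
      by (auto simp: set_add_def' cgenideal_def)
    have "P \<subseteq> P <+>\<^bsub>R\<^esub> PIdl a"
    proof
      fix p assume "p \<in> P"
      then show "p \<in> P <+>\<^bsub>R\<^esub> PIdl a"
        unfolding mem using a by (intro bexI[of _ p] bexI[of _ \<zero>]) auto
    qed
    moreover have "(P <+>\<^bsub>R\<^esub> PIdl a) \<inter> T = {}"
      using neg mem by auto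
    moreover have "a \<in> P <+>\<^bsub>R\<^esub> PIdl a"
      unfolding mem using a by (intro bexI[of _ \<zero>] bexI[of _ \<one>]) auto
    ultimately show False
      using max[OF id] a(2) by auto
  qed
  have "primeideal P R"
  proof (rule primeidealI[OF P(1) is_cring])
    show "carrier R \<noteq> P"
      using P(3) T.one_closed by auto
    fix a b assume ab: "a \<in> carrier R" "b \<in> carrier R" "a \<otimes> b \<in> P"
    show "a \<in> P \<or> b \<in> P"
    proof (rule ccontr)
      assume "\<not> ?thesis"
      then obtain p r q t where *: "p \<in> P" "r \<in> carrier R" "p \<oplus> r \<otimes> a \<in> T"
          "q \<in> P" "t \<in> carrier R" "q \<oplus> t \<otimes> b \<in> T"
        using meet ab by metis
      have [simp]: "p \<in> carrier R" "q \<in> carrier R"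
        using * P.a_subset by auto
      note [simp] = *(2,5) ab(1,2)
      \<comment> \<open>A product of two elements of \<open>T\<close> stays in \<open>T\<close>.
        Expanded, each of its terms contains \<open>p\<close>, \<open>q\<close> or
        \<open>a \<otimes> b\<close>, so it also lies in \<open>P\<close>.\<close>
      have "(p \<oplus> r \<otimes> a) \<otimes> (q \<oplus> t \<otimes> b) = (p \<otimes> (q \<oplus> t \<otimes> b) \<oplus> (r \<otimes> a) \<otimes> q) \<oplus> (r \<otimes> t) \<otimes> (a \<otimes> b)"
        by (simp add: l_distr r_distr m_ac a_ac)
      also have "\<dots> \<in> P"
        using P.I_r_closed[OF *(1), of "q \<oplus> t \<otimes> b"] P.I_l_closed[OF *(4), of "r \<otimes> a"]
          P.I_l_closed[OF ab(3), of "r \<otimes> t"] by (auto intro!: P.a_closed)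
      finally show False
        using T.m_closed[OF *(3,6)] P(3) by auto
    qed
  qed
  with P show thesis by (intro that)
qed

text \<open>The localization of R/J at \<mm> is zero or has \<mm> as its only prime, because all
  primes over \<open>J\<close> are maximal. Hence \<open>r\<close> is nilpotent there, and
  \<open>q\<close> is the denominator that witnesses this in R.\<close>

lemma local_power:
  assumes m: "maximalideal \<mm> R" and J: "ideal J R"
    and max: "\<And>\<pp>. primeideal \<pp> R \<Longrightarrow> J \<subseteq> \<pp> \<Longrightarrow> maximalideal \<pp> R"
    and r: "r \<in> \<mm>"
  obtains q n where "q \<in> carrier R - \<mm>" "q \<otimes> r [^] (n::nat) \<in> J"
proof -
  interpret m: maximalideal \<mm> R by fact
  interpret pm: primeideal \<mm> R using maximalideal_prime[OF m] .
  have rR [simp]: "r \<in> carrier R" using r m.a_subset by auto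
  have one: "\<one> \<notin> \<mm>"
    using m.I_notcarr m.one_imp_carrier by auto
  \<comment> \<open>A prime over \<open>J\<close> avoiding \<open>?T\<close> lies inside \<mm> (take
    exponent 0), so it equals \<mm> by maximality; but it misses \<open>r\<close> (take
    \<open>q\<close> = 1 and exponent 1).\<close>
  let ?T = "{q \<otimes> r [^] n | q (n::nat). q \<in> carrier R - \<mm>}"
  have "J \<inter> ?T \<noteq> {}"
  proof
    assume disj: "J \<inter> ?T = {}"
    have "submonoid ?T R"
    proof
      show "?T \<subseteq> carrier R" by auto
      show "\<one> \<in> ?T"
        using one by (auto intro!: exI[of _ \<one>] exI[of _ "0::nat"])
      fix a b assume "a \<in> ?T" "b \<in> ?T"
      then obtain q k p l where *: "a = q \<otimes> r [^] (k::nat)" "b = p \<otimes> r [^] (l::nat)"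
          "q \<in> carrier R - \<mm>" "p \<in> carrier R - \<mm>"
        by auto
      then have "a \<otimes> b = (q \<otimes> p) \<otimes> r [^] (k + l)"
        by (simp add: nat_pow_mult[symmetric] m_ac)
      moreover have "q \<otimes> p \<in> carrier R - \<mm>"
        using * pm.I_prime by auto
      ultimately show "a \<otimes> b \<in> ?T" by blast
    qed
    from prime_avoiding[OF J this disj] obtain \<pp>
      where p: "primeideal \<pp> R" "J \<subseteq> \<pp>" "\<pp> \<inter> ?T = {}" .
    interpret p: primeideal \<pp> R by fact
    have "\<pp> \<subseteq> \<mm>"
    proof
      fix a assume a: "a \<in> \<pp>"
      then have "a = a \<otimes> r [^] (0::nat)" "a \<in> carrier R"
        using p.a_subset by auto
      then show "a \<in> \<mm>"
        using a p(3) by blast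
    qed
    then have "\<mm> = \<pp>"
      using maximalideal.I_maximal[OF max[OF p(1,2)] m.ideal_axioms _ m.a_subset] m.I_notcarr by auto
    moreover have "\<one> \<otimes> r [^] (1::nat) \<in> ?T"
      using one by blast
    ultimately show False
      using r p(3) by auto
  qed
  then show thesis
    using that by auto
qed

lemma maximalideal_comaximal:
  assumes "maximalideal \<mm> R" "maximalideal \<nn> R" "\<mm> \<noteq> \<nn>"
  obtains r where "r \<in> \<mm>" "\<one> \<ominus> r \<in> \<nn>"
proof -
  interpret m: maximalideal \<mm> R by fact
  interpret n: maximalideal \<nn> R by fact
  have id: "ideal (\<mm> <+>\<^bsub>R\<^esub> \<nn>) R"
    using add_ideals[OF m.ideal_axioms n.ideal_axioms] .
  have mem: "a \<oplus> b \<in> \<mm> <+>\<^bsub>R\<^esub> \<nn>" if "a \<in> \<mm>" "b \<in> \<nn>" for a b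
    using that by (auto simp: set_add_def')
  have subm: "\<mm> \<subseteq> \<mm> <+>\<^bsub>R\<^esub> \<nn>"
    using mem[OF _ n.zero_closed] m.a_subset by (auto simp: subset_iff)
  have subn: "\<nn> \<subseteq> \<mm> <+>\<^bsub>R\<^esub> \<nn>"
    using mem[OF m.zero_closed] n.a_subset by (auto simp: subset_iff)
  have "\<mm> <+>\<^bsub>R\<^esub> \<nn> = carrier R"
  proof (rule ccontr)
    assume "\<mm> <+>\<^bsub>R\<^esub> \<nn> \<noteq> carrier R"
    moreover have "\<mm> <+>\<^bsub>R\<^esub> \<nn> \<subseteq> carrier R"
      using ideal.axioms(1)[OF id] additive_subgroup.a_subset by blast
    ultimately have "\<mm> <+>\<^bsub>R\<^esub> \<nn> = \<mm>" "\<mm> <+>\<^bsub>R\<^esub> \<nn> = \<nn>"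
      using m.I_maximal[OF id subm] n.I_maximal[OF id subn] by auto
    with assms(3) show False by simp
  qed
  then have "\<one> \<in> \<mm> <+>\<^bsub>R\<^esub> \<nn>" by simp
  then obtain r t where rt: "r \<in> \<mm>" "t \<in> \<nn>" "\<one> = r \<oplus> t"
    by (auto simp: set_add_def')
  then have [simp]: "r \<in> carrier R" "t \<in> carrier R"
    using m.a_subset n.a_subset by auto
  have "(r \<oplus> t) \<ominus> r = t"
    by (simp add: minus_eq a_comm[of r t] a_assoc r_neg)
  then have "\<one> \<ominus> r = t"
    using rt(3) by simp
  with rt show thesis by (intro that[of r]) auto
qed

lemma maximalideal_separating_element:
  assumes "maximalideal \<mm> R" "finite A" "\<And>\<nn>. \<nn> \<in> A \<Longrightarrow> maximalideal \<nn> R \<and> \<nn> \<noteq> \<mm>"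
  obtains r where "r \<in> \<mm>" "\<forall>\<nn>\<in>A. \<one> \<ominus> r \<in> \<nn>"
proof -
  interpret m: maximalideal \<mm> R by fact
  have "\<exists>r\<in>\<mm>. \<forall>\<nn>\<in>A. \<one> \<ominus> r \<in> \<nn>"
    using assms(2,3)
  proof (induction A rule: finite_induct)
    case empty
    show ?case
      using additive_subgroup.zero_closed[OF m.additive_subgroup_axioms] by (intro bexI[of _ \<zero>]) auto
  next
    case (insert \<nn> A)
    then obtain r where r: "r \<in> \<mm>" "\<And>\<nn>. \<nn> \<in> A \<Longrightarrow> \<one> \<ominus> r \<in> \<nn>"
      by auto
    have "maximalideal \<nn> R" "\<mm> \<noteq> \<nn>"
      using insert.prems[of \<nn>] by auto
    then obtain t where t: "t \<in> \<mm>" "\<one> \<ominus> t \<in> \<nn>"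
      by (rule maximalideal_comaximal[OF assms(1)])
    have [simp]: "r \<in> carrier R" "t \<in> carrier R"
      using r t m.a_subset by auto
    \<comment> \<open>Chosen so that 1 - \<open>?u\<close> factors as (1 - r)(1 - t), which lies in
      \<nn> and in every ideal of \<open>A\<close>.\<close>
    let ?u = "r \<oplus> (\<one> \<ominus> r) \<otimes> t"
    have eq: "\<one> \<ominus> ?u = (\<one> \<ominus> r) \<otimes> (\<one> \<ominus> t)"
      using \<open>r \<in> carrier R\<close> \<open>t \<in> carrier R\<close> by algebra
    have "?u \<in> \<mm>"
      using m.a_closed[OF r(1) m.I_l_closed[OF t(1), of "\<one> \<ominus> r"]] by simp
    moreover have "\<one> \<ominus> ?u \<in> \<kk>" if "\<kk> \<in> insert \<nn> A" for \<kk>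
    proof -
      interpret k: ideal \<kk> R
        using insert.prems[OF that] by (auto dest: maximalideal.axioms)
      show ?thesis
        unfolding eq using that r(2) k.I_l_closed[of "\<one> \<ominus> t" "\<one> \<ominus> r"] t(2)
          k.I_r_closed[of "\<one> \<ominus> r" "\<one> \<ominus> t"] by auto
    qed
    ultimately show ?case by blast
  qed
  with that show thesis by blast
qed

lemma S_h_nil_prime:
  assumes "S_h_nil R S" "s \<in> S" "s \<in> \<pp>" "primeideal \<pp> R"
  shows "maximalideal \<pp> R"
  using assms unfolding S_h_nil_def by blast

text \<open>Any prime over \<open>J\<close> contains \<open>s\<close> and is therefore maximal; a
  prime over \<open>J\<close> comes from \<open>prime_avoiding\<close> with the multiplicative set
  {1}.\<close>

lemma proper_ideal_maximal:
  assumes S: "S_h_nil R S" and J: "ideal J R" "\<one> \<notin> J" and s: "s \<in> S" "s \<in> J"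
  obtains \<mm> where "maximalideal \<mm> R" "J \<subseteq> \<mm>"
proof -
  have "submonoid {\<one>} R"
    by unfold_locales auto
  from prime_avoiding[OF J(1) this] J(2) obtain \<pp> where p: "primeideal \<pp> R" "J \<subseteq> \<pp>"
    by auto
  with S_h_nil_prime[OF S s(1)] s(2) show thesis
    by (intro that[of \<pp>]) auto
qed

text \<open>Modulo \<open>s\<close>, the element 1 - f is the idempotent of the local factor at
  \<mm>. It is found from \<open>r\<close> in \<mm> that is 1 at the other maximal ideals over
  \<open>s\<close>, together with some \<open>q\<close> outside \<mm> annihilating a power of
  \<open>r\<close> modulo \<open>s\<close>: the two generate the unit ideal modulo \<open>s\<close>
  and have product zero there, so they split 1 into idempotents.\<close>

lemma isolating_element:
  assumes S: "S_h_nil R S" and sub: "S \<subseteq> carrier R"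
    and m: "maximalideal \<mm> R" and s: "s \<in> S" "s \<in> \<mm>"
  obtains f x where "f \<in> \<mm>" "x \<in> carrier R" "f \<otimes> (\<one> \<ominus> f) = s \<otimes> x"
    "\<And>\<nn>. maximalideal \<nn> R \<Longrightarrow> s \<in> \<nn> \<Longrightarrow> f \<in> \<nn> \<Longrightarrow> \<nn> = \<mm>"
proof -
  interpret m: maximalideal \<mm> R by fact
  have [simp]: "s \<in> carrier R" using s sub by auto
  let ?A = "{\<nn>. maximalideal \<nn> R \<and> s \<in> \<nn>} - {\<mm>}"
  have "finite ?A"
    using S s(1) unfolding S_h_nil_def by auto
  moreover have "maximalideal \<nn> R \<and> \<nn> \<noteq> \<mm>" if "\<nn> \<in> ?A" for \<nn>
    using that by auto
  ultimately obtain r where r: "r \<in> \<mm>" "\<forall>\<nn>\<in>?A. \<one> \<ominus> r \<in> \<nn>"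
    by (rule maximalideal_separating_element[OF m])
  have [simp]: "r \<in> carrier R"
    using r(1) m.a_subset by auto
  have max: "maximalideal \<pp> R" if "primeideal \<pp> R" "PIdl s \<subseteq> \<pp>" for \<pp>
    using S_h_nil_prime[OF S s(1) _ that(1)] that(2) cgenideal_self[of s] by auto
  obtain q n where q: "q \<in> carrier R - \<mm>" "q \<otimes> r [^] (n::nat) \<in> PIdl s"
    using local_power[OF m cgenideal_ideal max r(1)] by (metis (no_types) \<open>s \<in> carrier R\<close>)
  then obtain y where y: "y \<in> carrier R" "q \<otimes> r [^] n = y \<otimes> s"
    by (auto simp: cgenideal_def)
  \<comment> \<open>The extra factor \<open>r\<close> puts \<open>t\<close> into \<mm> even when
    \<open>n\<close> is 0.\<close>
  define t where "t = r [^] n \<otimes> r"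
  have [simp]: "q \<in> carrier R" "t \<in> carrier R" "y \<in> carrier R"
    using q y by (auto simp: t_def)
  have qt: "q \<otimes> t = y \<otimes> s \<otimes> r"
    by (simp add: t_def y(2)[symmetric] m_assoc)
  have not_r: "r \<notin> \<nn>" if "\<nn> \<in> ?A" for \<nn>
  proof
    assume "r \<in> \<nn>"
    interpret n: maximalideal \<nn> R using that by auto
    have "(\<one> \<ominus> r) \<oplus> r \<in> \<nn>"
      using bspec[OF r(2) that] \<open>r \<in> \<nn>\<close> by (rule n.a_closed)
    then have "\<one> \<in> \<nn>"
      by (simp add: minus_eq a_assoc l_neg)
    then show False
      using n.one_imp_carrier n.I_notcarr by auto
  qed
  let ?K = "PIdl q <+>\<^bsub>R\<^esub> (PIdl t <+>\<^bsub>R\<^esub> PIdl s)"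
  have K: "z \<in> ?K \<longleftrightarrow> (\<exists>a\<in>carrier R. \<exists>b\<in>carrier R. \<exists>c\<in>carrier R. z = a \<otimes> q \<oplus> (b \<otimes> t \<oplus> c \<otimes> s))" for z
    by (auto simp: set_add_def' cgenideal_def)
  have "q \<in> ?K"
    unfolding K by (rule bexI[of _ \<one>], rule bexI[of _ \<zero>], rule bexI[of _ \<zero>]) simp_all
  moreover have "t \<in> ?K"
    unfolding K by (rule bexI[of _ \<zero>], rule bexI[of _ \<one>], rule bexI[of _ \<zero>]) simp_all
  moreover have "s \<in> ?K"
    unfolding K by (rule bexI[of _ \<zero>], rule bexI[of _ \<zero>], rule bexI[of _ \<one>]) simp_all
  ultimately have K_mem: "q \<in> ?K" "t \<in> ?K" "s \<in> ?K"
    by auto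
  have K_ideal: "ideal ?K R"
    by (intro add_ideals cgenideal_ideal) auto
  \<comment> \<open>A maximal ideal containing \<open>s\<close> is either \<mm>, which misses
    \<open>q\<close>, or a member of \<open>?A\<close>, which misses \<open>r\<close> and hence
    \<open>t\<close>. So none contains \<open>?K\<close>.\<close>
  have "\<one> \<in> ?K"
  proof (rule ccontr)
    assume "\<one> \<notin> ?K"
    from proper_ideal_maximal[OF S K_ideal this s(1) K_mem(3)]
    obtain \<nn> where n: "maximalideal \<nn> R" "?K \<subseteq> \<nn>" .
    interpret n: primeideal \<nn> R using maximalideal_prime[OF n(1)] .
    have "\<nn> \<noteq> \<mm>"
      using K_mem(1) n(2) q(1) by auto
    then have nA: "\<nn> \<in> ?A"
      using n K_mem(3) by auto
    have "t \<in> \<nn>"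
      using K_mem(2) n(2) by auto
    then have "r [^] n \<in> \<nn>"
      using n.I_prime[of "r [^] n" r] not_r[OF nA] by (auto simp: t_def)
    then show False
      using n.pow_mem not_r[OF nA] by auto
  qed
  then obtain a b c where abc: "a \<in> carrier R" "b \<in> carrier R" "c \<in> carrier R"
      "\<one> = a \<otimes> q \<oplus> (b \<otimes> t \<oplus> c \<otimes> s)"
    unfolding K by auto
  note [simp] = abc(1-3)
  \<comment> \<open>\<open>f\<close> collects the terms of the partition of 1 that lie in \<mm>. The
    rest is \<open>a \<otimes> q\<close>, so f (1 - f) involves only multiples of
    \<open>q \<otimes> t\<close> and of \<open>s\<close>, all divisible by \<open>s\<close>.\<close>
  define f where "f = b \<otimes> t \<oplus> c \<otimes> s"
  have [simp]: "f \<in> carrier R" by (simp add: f_def)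
  have e: "\<one> \<ominus> f = a \<otimes> q"
  proof -
    have "(a \<otimes> q \<oplus> f) \<ominus> f = a \<otimes> q"
      by (simp add: minus_eq a_assoc r_neg)
    then show ?thesis
      using abc(4) by (simp add: f_def)
  qed
  have "t \<in> \<mm>"
    using r(1) by (auto simp: t_def intro: m.I_l_closed)
  then have "f \<in> \<mm>"
    using s(2) by (auto simp: f_def intro!: m.a_closed intro: m.I_l_closed)
  moreover have "f \<otimes> (\<one> \<ominus> f) = s \<otimes> (a \<otimes> b \<otimes> y \<otimes> r \<oplus> c \<otimes> a \<otimes> q)"
  proof -
    have "f \<otimes> (\<one> \<ominus> f) = (a \<otimes> b) \<otimes> (q \<otimes> t) \<oplus> s \<otimes> (c \<otimes> a \<otimes> q)"
      unfolding e unfolding f_def by (simp add: l_distr r_distr m_ac)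
    then show ?thesis
      unfolding qt by (simp add: r_distr m_ac)
  qed
  moreover have "\<nn> = \<mm>" if n: "maximalideal \<nn> R" "s \<in> \<nn>" "f \<in> \<nn>" for \<nn>
  proof (rule ccontr)
    assume "\<nn> \<noteq> \<mm>"
    with n have nA: "\<nn> \<in> ?A" by auto
    interpret n: primeideal \<nn> R using maximalideal_prime[OF n(1)] .
    have "q \<otimes> r [^] n \<in> \<nn>"
      unfolding y(2) using n(2) by (intro n.I_l_closed) auto
    then have "q \<in> \<nn>"
      using n.I_prime[of q "r [^] n"] n.pow_mem[of r n] not_r[OF nA] by auto
    then have "a \<otimes> q \<oplus> f \<in> \<nn>"
      using n(3) by (intro n.a_closed n.I_l_closed) auto
    then have "\<one> \<in> \<nn>"
      using abc(4) by (simp add: f_def)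
    then show False
      using n.one_imp_carrier n.I_notcarr by auto
  qed
  ultimately show thesis
    by (intro that[of f "a \<otimes> b \<otimes> y \<otimes> r \<oplus> c \<otimes> a \<otimes> q"]) auto
qed

text \<open>The classical lifting step for idempotents sends f to f^2 (3 - 2f), whose complement is
  (1 - f)^2 (1 + 2f). It squares f (1 - f) up to a factor, so divisibility by \<open>s\<close>
  becomes divisibility by \<open>s \<otimes> s\<close>. Here \<open>h\<close> is 3 - 2f.\<close>

lemma idempotent_step_identity:
  assumes [simp]: "s \<in> carrier R" "f \<in> carrier R" "x \<in> carrier R"
    and sx: "s \<otimes> x = f \<ominus> f \<otimes> f"
  defines "h \<equiv> \<one> \<oplus> ((\<one> \<ominus> f) \<oplus> (\<one> \<ominus> f))"
  shows "(s \<otimes> s) \<otimes> ((x \<otimes> x) \<otimes> (h \<otimes> (\<one> \<oplus> (f \<oplus> f)))) =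
    f \<otimes> (f \<otimes> h) \<ominus> (f \<otimes> (f \<otimes> h)) \<otimes> (f \<otimes> (f \<otimes> h))"
proof -
  define e k where "e = \<one> \<ominus> f" and "k = \<one> \<oplus> (f \<oplus> f)"
  have [simp]: "e \<in> carrier R" "h \<in> carrier R" "k \<in> carrier R"
    by (simp_all add: e_def h_def k_def)
  have fe: "f \<ominus> f \<otimes> f = f \<otimes> e"
    using assms(2) unfolding e_def by algebra
  have "\<one> \<ominus> f \<otimes> (f \<otimes> h) = e \<otimes> (e \<otimes> k)"
    using assms(2) unfolding e_def h_def k_def by algebra
  then have "f \<otimes> (f \<otimes> h) \<otimes> (\<one> \<ominus> f \<otimes> (f \<otimes> h)) = (f \<otimes> e) \<otimes> (f \<otimes> e) \<otimes> (h \<otimes> k)"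
    by (simp add: m_ac)
  also have "\<dots> = (s \<otimes> x) \<otimes> (s \<otimes> x) \<otimes> (h \<otimes> k)"
    by (simp add: sx fe)
  also have "\<dots> = (s \<otimes> s) \<otimes> ((x \<otimes> x) \<otimes> (h \<otimes> k))"
    by (simp add: m_ac)
  finally show ?thesis
    by (simp add: k_def minus_eq r_distr r_minus)
qed

text \<open>The four sequences are bundled into one tuple so that they can be chosen for all \<mm>
  at once. The last clause says that the \<open>s k\<close> are cofinal among the denominators at
  \<mm>: every \<open>u\<close> in \<open>S\<close> divides some late \<open>s k\<close> after
  localizing at \<mm>.\<close>

definition isolating_sequence :: "'a set \<Rightarrow> 'a set \<Rightarrow> (nat \<Rightarrow> 'a) \<times> (nat \<Rightarrow> 'a) \<times> (nat \<Rightarrow> 'a) \<times> (nat \<Rightarrow> 'a) \<Rightarrow> bool"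
  where "isolating_sequence S \<mm> = (\<lambda>(s, f, x, g).
    (\<forall>n. s n \<in> S \<and> f n \<in> \<mm> \<and> x n \<in> carrier R \<and> g n \<in> carrier R \<and>
      s n \<otimes> x n = f n \<ominus> f n \<otimes> f n \<and> s (Suc n) = s n \<otimes> s n \<and> f (Suc n) = f n \<otimes> g n \<and>
      (\<forall>\<nn>. maximalideal \<nn> R \<longrightarrow> s n \<in> \<nn> \<longrightarrow> f n \<in> \<nn> \<longrightarrow> \<nn> = \<mm>) \<and>
      (\<forall>u\<in>S. \<exists>q\<in>carrier R - \<mm>. \<exists>k\<ge>n. \<exists>v\<in>carrier R. q \<otimes> s k = u \<otimes> v)))"

lemma isolating_sequence_exists:
  assumes nil: "S_h_nil R S" and S: "submonoid S R"
    and m: "maximalideal \<mm> R" and meet: "\<mm> \<inter> S \<noteq> {}"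
  shows "\<exists>sfxg. isolating_sequence S \<mm> sfxg"
proof -
  interpret S: submonoid S R by fact
  interpret m: maximalideal \<mm> R by fact
  obtain s0 where s0: "s0 \<in> S" "s0 \<in> \<mm>" using meet by blast
  obtain f0 x0 where f0: "f0 \<in> \<mm>" "x0 \<in> carrier R" "f0 \<otimes> (\<one> \<ominus> f0) = s0 \<otimes> x0"
    and iso: "\<And>\<nn>. maximalideal \<nn> R \<Longrightarrow> s0 \<in> \<nn> \<Longrightarrow> f0 \<in> \<nn> \<Longrightarrow> \<nn> = \<mm>"
    using isolating_element[OF nil S.subset m s0] by metis
  have [simp]: "s0 \<in> carrier R" "f0 \<in> carrier R" "x0 \<in> carrier R"
    using s0 f0 S.subset m.a_subset by auto
  \<comment> \<open>The exponent doubles at each stage to match the quadratic lifting step.\<close>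
  define s where "s n = s0 [^] (2 ^ n :: nat)" for n :: nat
  have s_Suc: "s (Suc n) = s n \<otimes> s n" for n
    by (simp add: s_def nat_pow_mult mult_2)
  have s_S: "s n \<in> S" for n
    by (induction n) (simp_all add: s_Suc s0, simp add: s_def s0)
  have sR [simp]: "s n \<in> carrier R" for n
    by (simp add: s_def)
  define h where "h f = \<one> \<oplus> ((\<one> \<ominus> f) \<oplus> (\<one> \<ominus> f))" for f
  \<comment> \<open>\<open>f\<close> and \<open>x\<close> come from one recursion, since the next
    cofactor \<open>x\<close> depends on the current \<open>f\<close>.\<close>
  define fx where "fx = rec_nat (f0, x0) (\<lambda>_ (f, x). (f \<otimes> (f \<otimes> h f), (x \<otimes> x) \<otimes> (h f \<otimes> (\<one> \<oplus> (f \<oplus> f)))))"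
  define f x g where "f n = fst (fx n)" and "x n = snd (fx n)" and "g n = f n \<otimes> h (f n)" for n
  have f_0: "f 0 = f0" "x 0 = x0"
    by (simp_all add: f_def x_def fx_def)
  have f_Suc: "f (Suc n) = f n \<otimes> g n" "x (Suc n) = (x n \<otimes> x n) \<otimes> (h (f n) \<otimes> (\<one> \<oplus> (f n \<oplus> f n)))" for n
    by (simp_all add: f_def x_def fx_def g_def split_beta)
  have hR: "h a \<in> carrier R" if "a \<in> carrier R" for a
    using that by (simp add: h_def)
  have fxR: "f n \<in> carrier R \<and> x n \<in> carrier R" for n
    by (induction n) (simp_all add: f_0 f_Suc g_def hR)
  have gR: "g n \<in> carrier R" for n
    using fxR[of n] by (simp add: g_def hR)
  note [simp] = fxR[THEN conjunct1] fxR[THEN conjunct2] gR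
  have sx: "s n \<otimes> x n = f n \<ominus> f n \<otimes> f n" for n
  proof (induction n)
    case 0
    show ?case
      using f0(3) by (simp add: f_0 s_def minus_eq r_distr r_minus)
  next
    case (Suc n)
    show ?case
      unfolding s_Suc f_Suc g_def h_def by (rule idempotent_step_identity) (simp_all add: Suc)
  qed
  have fm: "f n \<in> \<mm>" for n
    by (induction n) (simp_all add: f_0 f0 f_Suc m.I_r_closed)
  \<comment> \<open>Membership in \<nn> descends from \<open>f (Suc k)\<close> to
    \<open>f k\<close>: if \<open>f k\<close> were outside \<nn>, then 1 - \<open>f k\<close> would
    be inside, so \<open>h (f k)\<close> would be 1 modulo \<nn> and \<open>f (Suc k)\<close> would
    lie outside. At index 0 the choice of \<open>f0\<close> applies.\<close>
  have sep: "\<nn> = \<mm>" if n: "maximalideal \<nn> R" "s k \<in> \<nn>" "f k \<in> \<nn>" for \<nn> k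
  proof -
    interpret n: primeideal \<nn> R using maximalideal_prime[OF n(1)] .
    have s0n: "s0 \<in> \<nn>"
      using n.pow_mem[of s0 "2 ^ k"] n(2) by (simp add: s_def)
    have sn: "s l \<in> \<nn>" for l
      by (induction l) (simp_all add: s_Suc n.I_l_closed, simp add: s_def s0n)
    have "f 0 \<in> \<nn>"
      using n(3)
    proof (induction k)
      case (Suc k)
      have "f k \<in> \<nn>"
      proof (rule ccontr)
        assume f: "f k \<notin> \<nn>"
        have "f k \<otimes> (\<one> \<ominus> f k) = s k \<otimes> x k"
          by (simp add: sx minus_eq r_distr r_minus)
        also have "\<dots> \<in> \<nn>"
          using sn by (intro n.I_r_closed) simp_all
        finally have e: "\<one> \<ominus> f k \<in> \<nn>"
          using n.I_prime[of "f k" "\<one> \<ominus> f k"] f by simp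
        have "f k \<otimes> (f k \<otimes> h (f k)) \<in> \<nn>"
          using Suc.prems by (simp add: f_Suc g_def)
        then have "h (f k) \<in> \<nn>"
          using n.I_prime[of "f k" "f k \<otimes> h (f k)"] n.I_prime[of "f k" "h (f k)"] f by (simp add: hR)
        then have "h (f k) \<oplus> \<ominus> ((\<one> \<ominus> f k) \<oplus> (\<one> \<ominus> f k)) \<in> \<nn>"
          using e by (intro n.a_closed n.a_inv_closed)
        moreover have "h (f k) \<oplus> \<ominus> ((\<one> \<ominus> f k) \<oplus> (\<one> \<ominus> f k)) = \<one>"
          by (simp add: h_def a_assoc r_neg)
        ultimately show False
          using n.one_notin by simp
      qed
      then show ?case by (rule Suc.IH)
    qed
    then show ?thesis
      using iso[OF n(1) s0n] by (simp add: f_0)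
  qed
  have absorb: "\<exists>q\<in>carrier R - \<mm>. \<exists>k\<ge>n. \<exists>v\<in>carrier R. q \<otimes> s k = u \<otimes> v" if u: "u \<in> S" for u n
  proof -
    have uR: "u \<in> carrier R" using u S.subset by auto
    have max: "maximalideal \<pp> R" if "primeideal \<pp> R" "PIdl u \<subseteq> \<pp>" for \<pp>
      using S_h_nil_prime[OF nil u _ that(1)] that(2) cgenideal_self[OF uR] by auto
    obtain q l where q: "q \<in> carrier R - \<mm>" "q \<otimes> s0 [^] (l::nat) \<in> PIdl u"
      using local_power[OF m cgenideal_ideal[OF uR] max s0(2)] by metis
    then obtain v where v: "v \<in> carrier R" "q \<otimes> s0 [^] l = v \<otimes> u"
      by (auto simp: cgenideal_def)
    \<comment> \<open>Since k \<le> 2^k, this \<open>k\<close> makes \<open>s k\<close> divisible by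
      \<open>s0 [^] l\<close>.\<close>
    define k where "k = max n l"
    have "l \<le> k" by (simp add: k_def)
    also have "k \<le> 2 ^ k" by (simp add: less_imp_le)
    finally have "l \<le> 2 ^ k" .
    then have "s k = s0 [^] l \<otimes> s0 [^] (2 ^ k - l)"
      by (simp add: s_def nat_pow_mult)
    then have "q \<otimes> s k = (q \<otimes> s0 [^] l) \<otimes> s0 [^] (2 ^ k - l)"
      using q by (simp add: m_assoc)
    also have "\<dots> = u \<otimes> (v \<otimes> s0 [^] (2 ^ k - l))"
      unfolding v(2) using v uR by (simp add: m_ac)
    finally show ?thesis
      using v(1) by (intro bexI[OF _ q(1)] exI[of _ k] conjI bexI[of _ "v \<otimes> s0 [^] (2 ^ k - l)"]) (simp_all add: k_def)
  qed
  have "isolating_sequence S \<mm> (s, f, x, g)"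
    unfolding isolating_sequence_def using s_S fm sx s_Suc f_Suc(1) sep absorb by simp
  then show ?thesis by blast
qed

end

section \<open>Coordinates, induction and projectivity for free modules\<close>

section \<open>Free modules\<close>

lemma mod_homD:
  assumes "h \<in> mod_hom R M N"
  shows "\<And>x. x \<in> carrier M \<Longrightarrow> h x \<in> carrier N"
    and "\<And>x y. x \<in> carrier M \<Longrightarrow> y \<in> carrier M \<Longrightarrow> h (x \<oplus>\<^bsub>M\<^esub> y) = h x \<oplus>\<^bsub>N\<^esub> h y"
    and "\<And>r x. r \<in> carrier R \<Longrightarrow> x \<in> carrier M \<Longrightarrow> h (r \<odot>\<^bsub>M\<^esub> x) = r \<odot>\<^bsub>N\<^esub> h x"
  using assms by (auto simp: mod_hom_def)

lemma mod_hom_zero: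
  assumes "module R M" "module R N" "h \<in> mod_hom R M N"
  shows "h \<zero>\<^bsub>M\<^esub> = \<zero>\<^bsub>N\<^esub>"
proof -
  interpret M: module R M by fact
  interpret N: module R N by fact
  show ?thesis
    using mod_hom_finsum[OF assms, of "{}"] by simp
qed

definition unit_vec :: "('a, 'c) ring_scheme \<Rightarrow> 'b \<Rightarrow> 'b \<Rightarrow> 'a"
  where "unit_vec R x = (\<lambda>y. if y = x then \<one>\<^bsub>R\<^esub> else \<zero>\<^bsub>R\<^esub>)"

lemma unit_vec_apply: "unit_vec R x y = (if y = x then \<one>\<^bsub>R\<^esub> else \<zero>\<^bsub>R\<^esub>)"
  by (simp add: unit_vec_def)

lemma free_module_simps [simp]:
  "\<zero>\<^bsub>free_module R X\<^esub> = (\<lambda>_. \<zero>\<^bsub>R\<^esub>)"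
  "\<phi> \<oplus>\<^bsub>free_module R X\<^esub> \<psi> = (\<lambda>x. \<phi> x \<oplus>\<^bsub>R\<^esub> \<psi> x)"
  "r \<odot>\<^bsub>free_module R X\<^esub> \<phi> = (\<lambda>x. r \<otimes>\<^bsub>R\<^esub> \<phi> x)"
  by (simp_all add: free_module_def)

lemma free_moduleD:
  assumes "\<phi> \<in> carrier (free_module R X)"
  shows "\<phi> x \<in> carrier R" "finite {x. \<phi> x \<noteq> \<zero>\<^bsub>R\<^esub>}" "{x. \<phi> x \<noteq> \<zero>\<^bsub>R\<^esub>} \<subseteq> X"
  using assms by (auto simp: free_module_def)

context cring
begin

lemma unit_vec_carrier [simp]: "x \<in> X \<Longrightarrow> unit_vec R x \<in> carrier (free_module R X)"
  unfolding unit_vec_def free_module_def by (auto intro: finite_subset[of _ "{x}"])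

lemma unit_vec_coord [simp]: "unit_vec R x y \<in> carrier R"
  by (simp add: unit_vec_def)

lemma finsum_free_module_apply:
  assumes "finite B" "f \<in> B \<rightarrow> carrier (free_module R X)"
  shows "(\<Oplus>\<^bsub>free_module R X\<^esub>j\<in>B. f j) i = (\<Oplus>j\<in>B. f j i)"
  using assms
proof (induction B rule: finite_induct)
  case (insert x B)
  interpret F: module R "free_module R X" by (rule free_module_module)
  have "f x \<in> carrier (free_module R X)" "f \<in> B \<rightarrow> carrier (free_module R X)"
    "f x i \<in> carrier R" "(\<lambda>j. f j i) \<in> B \<rightarrow> carrier R"
    using insert.prems by (auto simp: Pi_iff dest: free_moduleD(1))
  then show ?case
    using insert by simp
next
  case empty
  interpret F: module R "free_module R X" by (rule free_module_module)
  show ?case by simp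
qed

text \<open>Lets a single coordinate be computed over any finite set outside which all summands
  vanish there, without knowing the support of \<phi>.\<close>

lemma free_eval_apply:
  assumes k: "k \<in> X \<rightarrow> carrier (free_module R Y)" and \<phi>: "\<phi> \<in> carrier (free_module R X)"
    and A: "finite A" "A \<subseteq> X" "\<And>j. j \<in> X - A \<Longrightarrow> \<phi> j = \<zero> \<or> k j i = \<zero>"
  shows "free_eval R (free_module R Y) k \<phi> i = (\<Oplus>j\<in>A. \<phi> j \<otimes> k j i)"
proof -
  interpret F: module R "free_module R Y" by (rule free_module_module)
  note \<phi>' = free_moduleD[OF \<phi>]
  have k': "k j i \<in> carrier R" if "j \<in> X" for j
    using k that by (auto intro: free_moduleD(1))
  let ?B = "{x. \<phi> x \<noteq> \<zero>} \<union> A"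
  have B: "finite ?B" "{x. \<phi> x \<noteq> \<zero>} \<subseteq> ?B" "?B \<subseteq> X"
    using \<phi>' A by auto
  have "free_eval R (free_module R Y) k \<phi> i = (\<Oplus>\<^bsub>free_module R Y\<^esub>j\<in>?B. \<phi> j \<odot>\<^bsub>free_module R Y\<^esub> k j) i"
    by (simp only: F.free_eval_superset[OF k \<phi> B])
  also have "\<dots> = (\<Oplus>j\<in>?B. (\<phi> j \<odot>\<^bsub>free_module R Y\<^esub> k j) i)"
    using B k \<phi>'(1) by (intro finsum_free_module_apply Pi_I F.smult_closed) auto
  also have "\<dots> = (\<Oplus>j\<in>?B. \<phi> j \<otimes> k j i)"
    by simp
  also have "\<dots> = (\<Oplus>j\<in>A. \<phi> j \<otimes> k j i)"
  proof (rule add.finprod_mono_neutral_cong_right)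
    show "\<phi> j \<otimes> k j i = \<zero>\<^bsub>R\<^esub>" if "j \<in> ?B - A" for j
      using A(3)[of j] that B(3) k'[of j] \<phi>'(1) by auto
    show "(\<lambda>j. \<phi> j \<otimes> k j i) \<in> ?B \<rightarrow> carrier R"
      using B(3) k' \<phi>'(1) by auto
  qed (use B in auto)
  finally show ?thesis .
qed

lemma free_eval_unit_vec:
  assumes "\<phi> \<in> carrier (free_module R X)"
  shows "free_eval R (free_module R X) (unit_vec R) \<phi> = \<phi>"
proof
  fix i
  let ?A = "{i} \<inter> {x. \<phi> x \<noteq> \<zero>}"
  have "free_eval R (free_module R X) (unit_vec R) \<phi> i = (\<Oplus>j\<in>?A. \<phi> j \<otimes> unit_vec R j i)"
    using assms by (intro free_eval_apply) (auto simp: unit_vec_apply dest: free_moduleD(3))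
  also have "\<dots> = \<phi> i"
  proof (cases "\<phi> i = \<zero>")
    case False
    then have "?A = {i}" by auto
    then show ?thesis
      using free_moduleD(1)[OF assms] by (simp add: unit_vec_def)
  qed simp
  finally show "free_eval R (free_module R X) (unit_vec R) \<phi> i = \<phi> i" .
qed

text \<open>By \<open>free_eval_unit_vec\<close> a vector is the finite sum of its coordinates times
  unit vectors, so induction over the finite support suffices.\<close>

lemma free_module_induct [consumes 1, case_names zero add smult unit]:
  assumes \<phi>: "\<phi> \<in> carrier (free_module R X)"
    and zero: "P (\<lambda>_. \<zero>)"
    and add: "\<And>\<phi> \<psi>. \<phi> \<in> carrier (free_module R X) \<Longrightarrow> \<psi> \<in> carrier (free_module R X) \<Longrightarrow>
      P \<phi> \<Longrightarrow> P \<psi> \<Longrightarrow> P (\<lambda>x. \<phi> x \<oplus> \<psi> x)"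
    and smult: "\<And>r \<phi>. r \<in> carrier R \<Longrightarrow> \<phi> \<in> carrier (free_module R X) \<Longrightarrow> P \<phi> \<Longrightarrow> P (\<lambda>x. r \<otimes> \<phi> x)"
    and unit: "\<And>x. x \<in> X \<Longrightarrow> P (unit_vec R x)"
  shows "P \<phi>"
proof -
  let ?F = "free_module R X"
  interpret F: module R ?F by (rule free_module_module)
  note \<phi>' = free_moduleD[OF \<phi>]
  have "P (\<Oplus>\<^bsub>?F\<^esub>j\<in>B. \<phi> j \<odot>\<^bsub>?F\<^esub> unit_vec R j)" if "finite B" "B \<subseteq> X" for B
    using that
  proof (induction B rule: finite_induct)
    case empty
    then show ?case using zero by simp
  next
    case (insert x B)
    have c: "\<phi> j \<odot>\<^bsub>?F\<^esub> unit_vec R j \<in> carrier ?F" if "j \<in> X" for j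
      using that \<phi>'(1) by (intro F.smult_closed) auto
    have "(\<Oplus>\<^bsub>?F\<^esub>j\<in>insert x B. \<phi> j \<odot>\<^bsub>?F\<^esub> unit_vec R j) =
        \<phi> x \<odot>\<^bsub>?F\<^esub> unit_vec R x \<oplus>\<^bsub>?F\<^esub> (\<Oplus>\<^bsub>?F\<^esub>j\<in>B. \<phi> j \<odot>\<^bsub>?F\<^esub> unit_vec R j)"
      using insert c by (intro F.finsum_insert) (auto simp del: free_module_simps)
    moreover have "P (\<phi> x \<odot>\<^bsub>?F\<^esub> unit_vec R x \<oplus>\<^bsub>?F\<^esub> (\<Oplus>\<^bsub>?F\<^esub>j\<in>B. \<phi> j \<odot>\<^bsub>?F\<^esub> unit_vec R j))"
      unfolding free_module_simps(2)
    proof (rule add)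
      show "P (\<phi> x \<odot>\<^bsub>?F\<^esub> unit_vec R x)"
        using smult[OF \<phi>'(1) unit_vec_carrier unit] insert.prems by simp
      show "P (\<Oplus>\<^bsub>?F\<^esub>j\<in>B. \<phi> j \<odot>\<^bsub>?F\<^esub> unit_vec R j)"
        using insert by simp
      show "\<phi> x \<odot>\<^bsub>?F\<^esub> unit_vec R x \<in> carrier ?F"
        using insert c by simp
      show "(\<Oplus>\<^bsub>?F\<^esub>j\<in>B. \<phi> j \<odot>\<^bsub>?F\<^esub> unit_vec R j) \<in> carrier ?F"
        using insert c by (intro F.finsum_closed) (auto simp del: free_module_simps)
    qed
    ultimately show ?case by (simp only:)
  qed
  from this[OF \<phi>'(2,3)] show ?thesis
    using free_eval_unit_vec[OF \<phi>] by (simp only: free_eval_def)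
qed

lemma projective_free_module: "projective_module R (free_module R X)"
  unfolding projective_module_def
proof (intro conjI allI impI)
  let ?F = "free_module R X"
  show F: "module R ?F" by (rule free_module_module)
  fix M :: "('a, ('c \<Rightarrow> 'a) \<Rightarrow> 'a) module" and N :: "('a, 'c \<Rightarrow> 'a) module" and g f
  assume *: "module R M \<and> module R N \<and> g \<in> mod_hom R M N \<and> g ` carrier M = carrier N \<and> f \<in> mod_hom R ?F N"
  then interpret M: module R M by simp
  interpret N: module R N using * by simp
  have "\<exists>y\<in>carrier M. g y = f (unit_vec R x)" if "x \<in> X" for x
  proof -
    have "f (unit_vec R x) \<in> g ` carrier M"
      using * mod_homD(1)[of f R ?F N] unit_vec_carrier[OF that] by auto
    then show ?thesis by auto
  qed
  then obtain k where k: "\<And>x. x \<in> X \<Longrightarrow> k x \<in> carrier M \<and> g (k x) = f (unit_vec R x)"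
    by metis
  have kX: "k \<in> X \<rightarrow> carrier M" using k by auto
  show "\<exists>h\<in>mod_hom R ?F M. \<forall>x\<in>carrier ?F. g (h x) = f x"
  proof (intro bexI[of _ "free_eval R M k"] ballI)
    show "free_eval R M k \<in> mod_hom R ?F M"
      by (rule M.free_eval_hom[OF kX])
    fix \<phi> assume \<phi>: "\<phi> \<in> carrier ?F"
    have "g (free_eval R M k \<phi>) = free_eval R N (g \<circ> k) \<phi>"
      using * by (intro mod_hom_free_eval[OF M.module_axioms N.module_axioms _ kX \<phi>]) auto
    also have "\<dots> = free_eval R N (f \<circ> unit_vec R) \<phi>"
      unfolding free_eval_def
      using k * free_moduleD[OF \<phi>]
      by (intro N.finsum_cong') (auto simp: subset_iff intro!: N.smult_closed mod_homD(1)[of f R ?F N])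
    also have "\<dots> = f (free_eval R ?F (unit_vec R) \<phi>)"
      using * by (intro mod_hom_free_eval[OF F N.module_axioms _ _ \<phi>, symmetric]) auto
    finally show "g (free_eval R M k \<phi>) = f \<phi>"
      by (simp only: free_eval_unit_vec[OF \<phi>])
  qed
qed

end

section \<open>The presentation of the cokernel and its basic relations\<close>

section \<open>The glued telescope\<close>

context cring
begin

text \<open>The right-hand side is relation 2n plus s times relation 2n+1 plus f - 1 times relation
  2n+2. The terms in \<open>y0\<close> and \<open>y1\<close> cancel outright, the one in
  \<open>o2\<close> by \<open>h\<close>.\<close>

lemma o_step_identity:
  assumes [simp]: "s \<in> carrier R" "f \<in> carrier R" "x \<in> carrier R" "g \<in> carrier R"
    "o0 \<in> carrier R" "o1 \<in> carrier R" "o2 \<in> carrier R" "y0 \<in> carrier R" "y1 \<in> carrier R"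
    and h: "s \<otimes> x = f \<ominus> f \<otimes> f"
  shows "o0 \<ominus> o1 = (o0 \<ominus> (s \<otimes> y0 \<oplus> f \<otimes> o1) \<oplus> s \<otimes> (y0 \<ominus> (s \<otimes> (\<one> \<ominus> f) \<otimes> y1 \<oplus> x \<otimes> g \<otimes> o2)))
    \<oplus> (f \<ominus> \<one>) \<otimes> (o1 \<ominus> (s \<otimes> s \<otimes> y1 \<oplus> f \<otimes> g \<otimes> o2))"
    (is "?l = ?r")
proof (rule eq_minusI)
  have "?l \<ominus> ?r = (s \<otimes> x \<ominus> (f \<ominus> f \<otimes> f)) \<otimes> (g \<otimes> o2)"
    using assms(1-9) by algebra
  also have "\<dots> = \<zero>"
    using h by (simp add: minus_eq r_neg)
  finally show "?l \<ominus> ?r = \<zero>" .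
qed simp_all

lemma e_step_identity:
  assumes [simp]: "s \<in> carrier R" "f \<in> carrier R" "o0 \<in> carrier R" "o1 \<in> carrier R" "o2 \<in> carrier R" "y \<in> carrier R"
  shows "(\<one> \<ominus> f) \<otimes> o0 \<ominus> s \<otimes> y =
    ((o1 \<ominus> (s \<otimes> y \<oplus> f \<otimes> o2)) \<oplus> (o0 \<ominus> o1)) \<oplus> (\<ominus> f) \<otimes> (o0 \<ominus> o2)"
  using assms by algebra

text \<open>Combines relation 2n+1, the congruence of \<open>e_o\<close> at stage n+1 and a
  difference of two o-generators; only the terms in \<open>y1\<close> require \<open>h\<close> to
  cancel.\<close>

lemma f_step_identity:
  assumes [simp]: "s \<in> carrier R" "f \<in> carrier R" "x \<in> carrier R" "g \<in> carrier R"
    "o0 \<in> carrier R" "o2 \<in> carrier R" "y0 \<in> carrier R" "y1 \<in> carrier R"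
    and h: "s \<otimes> x = f \<ominus> f \<otimes> f"
  shows "f \<otimes> y0 \<ominus> x \<otimes> o0 = (f \<otimes> (y0 \<ominus> (s \<otimes> (\<one> \<ominus> f) \<otimes> y1 \<oplus> x \<otimes> g \<otimes> o2))
    \<oplus> (\<ominus> x) \<otimes> ((\<one> \<ominus> f \<otimes> g) \<otimes> o0 \<ominus> (s \<otimes> s) \<otimes> y1)) \<oplus> (\<ominus> (f \<otimes> g \<otimes> x)) \<otimes> (o0 \<ominus> o2)"
    (is "?l = ?r")
proof (rule eq_minusI)
  have "?l \<ominus> ?r = (s \<otimes> x \<ominus> (f \<ominus> f \<otimes> f)) \<otimes> (\<ominus> (s \<otimes> y1))"
    using assms(1-8) by algebra
  also have "\<dots> = \<zero>"
    using h by (simp add: minus_eq r_neg)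
  finally show "?l \<ominus> ?r = \<zero>" .
qed simp_all

end

text \<open>\<Omega> stands for the maximal ideals meeting \<open>S\<close>.
  \<open>separated\<close> makes the supports of the cones disjoint, \<open>cover\<close> is the
  local-global principle for ideals meeting \<open>S\<close>, and \<open>absorb\<close> says that
  the denominators of one telescope suffice at its own \<mm>.\<close>

locale telescope = mult_subset +
  fixes \<Omega> :: "'a set set" and s f x g :: "'a set \<Rightarrow> nat \<Rightarrow> 'a"
  assumes prime: "\<mm> \<in> \<Omega> \<Longrightarrow> primeideal \<mm> R"
    and s_S [simp]: "\<mm> \<in> \<Omega> \<Longrightarrow> s \<mm> n \<in> S"
    and f_mem: "\<mm> \<in> \<Omega> \<Longrightarrow> f \<mm> n \<in> \<mm>"
    and x_carrier [simp]: "\<mm> \<in> \<Omega> \<Longrightarrow> x \<mm> n \<in> carrier R"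
    and g_carrier [simp]: "\<mm> \<in> \<Omega> \<Longrightarrow> g \<mm> n \<in> carrier R"
    and s_x: "\<mm> \<in> \<Omega> \<Longrightarrow> s \<mm> n \<otimes> x \<mm> n = f \<mm> n \<ominus> f \<mm> n \<otimes> f \<mm> n"
    and s_Suc: "\<mm> \<in> \<Omega> \<Longrightarrow> s \<mm> (Suc n) = s \<mm> n \<otimes> s \<mm> n"
    and f_Suc: "\<mm> \<in> \<Omega> \<Longrightarrow> f \<mm> (Suc n) = f \<mm> n \<otimes> g \<mm> n"
    and separated: "\<mm> \<in> \<Omega> \<Longrightarrow> \<nn> \<in> \<Omega> \<Longrightarrow> \<mm> \<noteq> \<nn> \<Longrightarrow> s \<mm> n \<notin> \<nn> \<or> f \<mm> n \<notin> \<nn>"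
    and cover: "ideal J R \<Longrightarrow> t \<in> S \<Longrightarrow> t \<in> J \<Longrightarrow> \<one> \<notin> J \<Longrightarrow> \<exists>\<mm>\<in>\<Omega>. J \<subseteq> \<mm>"
    and absorb: "\<mm> \<in> \<Omega> \<Longrightarrow> u \<in> S \<Longrightarrow>
      \<exists>q\<in>carrier R - \<mm>. \<exists>k\<ge>n. \<exists>v\<in>carrier R. q \<otimes> s \<mm> k = u \<otimes> v"
begin

lemma s_carrier [simp]: "\<mm> \<in> \<Omega> \<Longrightarrow> s \<mm> n \<in> carrier R"
  by (simp add: S_carrier)

lemma f_carrier [simp]: "\<mm> \<in> \<Omega> \<Longrightarrow> f \<mm> n \<in> carrier R"
  using ideal.Icarr[OF primeideal.axioms(1)[OF prime] f_mem] by simp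

definition e :: "'a set \<Rightarrow> nat \<Rightarrow> 'a"
  where "e \<mm> n = \<one> \<ominus> f \<mm> n"

lemma e_carrier [simp]: "\<mm> \<in> \<Omega> \<Longrightarrow> e \<mm> n \<in> carrier R"
  by (simp add: e_def)

lemma e_plus_f: "\<mm> \<in> \<Omega> \<Longrightarrow> e \<mm> n \<oplus> f \<mm> n = \<one>"
  by (simp add: e_def minus_eq a_assoc l_neg)

lemma e_notin: "\<mm> \<in> \<Omega> \<Longrightarrow> e \<mm> n \<notin> \<mm>"
  using additive_subgroup.a_closed[OF ideal.axioms(1)[OF primeideal.axioms(1)[OF prime]], of \<mm> "e \<mm> n" "f \<mm> n"]
    f_mem e_plus_f primeideal.one_notin[OF prime] by auto

text \<open>The lists prescribed by \<^const>\<open>has_projective_resolution_of_length\<close> serve as indices: \<open>\<mm>\<close> is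
  encoded by the relation \<open>Id_on \<mm>\<close>, a number by the length of the list.\<close>

definition idx :: "'a set \<Rightarrow> nat \<Rightarrow> (('a \<times> 'a) set \<times> 'a) list"
  where "idx \<mm> k = replicate k (Id_on \<mm>, \<zero>)"

lemma idx_0 [simp]: "idx \<mm> 0 = []"
  by (simp add: idx_def)

lemma idx_eq_iff [simp]: "idx \<mm> k = idx \<nn> l \<longleftrightarrow> k = l \<and> (k = 0 \<or> \<mm> = \<nn>)"
proof -
  have "Id_on \<mm> = Id_on \<nn> \<longleftrightarrow> \<mm> = \<nn>"
    by (metis Domain_Id_on)
  then show ?thesis
    by (auto simp: idx_def replicate_eq_replicate)
qed

text \<open>The empty list is inserted separately so that the common generator exists even when
  \<Omega> is empty.\<close>

definition gens :: "(('a \<times> 'a) set \<times> 'a) list set"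
  where "gens = insert [] {idx \<mm> k | \<mm> k. \<mm> \<in> \<Omega>}"

text \<open>Relation k of \<mm> has index \<open>idx \<mm> (Suc k)\<close>. The shift keeps the
  relations of different telescopes apart, whereas at position 0 all generators coincide.\<close>

definition rels :: "(('a \<times> 'a) set \<times> 'a) list set"
  where "rels = {idx \<mm> (Suc k) | \<mm> k. \<mm> \<in> \<Omega>}"

lemma gens_idx [simp]: "\<mm> \<in> \<Omega> \<Longrightarrow> idx \<mm> k \<in> gens" and gens_Nil [simp]: "[] \<in> gens"
  by (auto simp: gens_def)

lemma rels_idx [simp]: "\<mm> \<in> \<Omega> \<Longrightarrow> idx \<mm> (Suc k) \<in> rels"
  by (auto simp: rels_def)

abbreviation F0 :: "('a, (('a \<times> 'a) set \<times> 'a) list \<Rightarrow> 'a) module"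
  where "F0 \<equiv> free_module R gens"

abbreviation F1 :: "('a, (('a \<times> 'a) set \<times> 'a) list \<Rightarrow> 'a) module"
  where "F1 \<equiv> free_module R rels"

sublocale F0: module R F0 by (rule free_module_module)
sublocale F1: module R F1 by (rule free_module_module)

text \<open>Write \<open>o\<^sub>n\<close> for the generator \<open>idx \<mm> (2n)\<close>, which will be sent to \<open>1\<close>, and \<open>y\<^sub>n\<close> for
  \<open>idx \<mm> (2n+1)\<close>, which will be sent to \<open>e\<^sub>n/s\<^sub>n\<close>. The relations are
  \<open>o\<^sub>n = s\<^sub>n y\<^sub>n + f\<^sub>n o\<^sub>n\<^sub>+\<^sub>1\<close> and \<open>y\<^sub>n = s\<^sub>n e\<^sub>n y\<^sub>n\<^sub>+\<^sub>1 + x\<^sub>n g\<^sub>n o\<^sub>n\<^sub>+\<^sub>2\<close>. All telescopes share \<open>o\<^sub>0\<close>, which is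
  the empty list.\<close>

definition next_idx :: "nat \<Rightarrow> nat"
  where "next_idx k = (if even k then k + 1 else k + 2)"

definition coeff_y :: "'a set \<Rightarrow> nat \<Rightarrow> 'a"
  where "coeff_y \<mm> k = (if even k then s \<mm> (k div 2) else s \<mm> (k div 2) \<otimes> e \<mm> (k div 2))"

definition coeff_o :: "'a set \<Rightarrow> nat \<Rightarrow> 'a"
  where "coeff_o \<mm> k = (if even k then f \<mm> (k div 2) else x \<mm> (k div 2) \<otimes> g \<mm> (k div 2))"

lemma coeff_carrier [simp]: "\<mm> \<in> \<Omega> \<Longrightarrow> coeff_y \<mm> k \<in> carrier R" "\<mm> \<in> \<Omega> \<Longrightarrow> coeff_o \<mm> k \<in> carrier R"
  by (auto simp: coeff_y_def coeff_o_def)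

definition rel :: "'a set \<Rightarrow> nat \<Rightarrow> (('a \<times> 'a) set \<times> 'a) list \<Rightarrow> 'a"
  where "rel \<mm> k = (\<lambda>i. unit_vec R (idx \<mm> k) i \<ominus>
     (coeff_y \<mm> k \<otimes> unit_vec R (idx \<mm> (next_idx k)) i \<oplus> coeff_o \<mm> k \<otimes> unit_vec R (idx \<mm> (Suc (next_idx k))) i))"

text \<open>Decodes an index: the domain of \<open>Id_on \<mm>\<close> is \<mm>, and subtracting 1
  from the length undoes the shift in \<open>rels\<close>.\<close>

definition rel_at :: "(('a \<times> 'a) set \<times> 'a) list \<Rightarrow> (('a \<times> 'a) set \<times> 'a) list \<Rightarrow> 'a"
  where "rel_at j = rel (Domain (fst (hd j))) (length j - 1)"

lemma rel_at_idx [simp]: "rel_at (idx \<mm> (Suc k)) = rel \<mm> k"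
  by (simp add: rel_at_def idx_def)

lemma sub_F0:
  assumes "\<phi> \<in> carrier F0" "\<psi> \<in> carrier F0"
  shows "(\<lambda>i. \<phi> i \<ominus> \<psi> i) \<in> carrier F0"
proof -
  have "{i. \<phi> i \<ominus> \<psi> i \<noteq> \<zero>} \<subseteq> {i. \<phi> i \<noteq> \<zero>} \<union> {i. \<psi> i \<noteq> \<zero>}"
    by (auto simp: minus_eq)
  with assms show ?thesis
    by (auto simp: free_module_def intro: finite_subset)
qed

lemma add_F0: "\<phi> \<in> carrier F0 \<Longrightarrow> \<psi> \<in> carrier F0 \<Longrightarrow> (\<lambda>i. \<phi> i \<oplus> \<psi> i) \<in> carrier F0"
  using F0.add.m_closed by simp

lemma smult_F0: "r \<in> carrier R \<Longrightarrow> \<phi> \<in> carrier F0 \<Longrightarrow> (\<lambda>i. r \<otimes> \<phi> i) \<in> carrier F0"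
  using F0.smult_closed by simp

lemma rel_F0 [simp]: "\<mm> \<in> \<Omega> \<Longrightarrow> rel \<mm> k \<in> carrier F0"
  unfolding rel_def by (intro sub_F0 add_F0 smult_F0 unit_vec_carrier) auto

lemma rel_at_carrier: "rel_at \<in> rels \<rightarrow> carrier F0"
  by (auto simp: rels_def)

definition d :: "((('a \<times> 'a) set \<times> 'a) list \<Rightarrow> 'a) \<Rightarrow> (('a \<times> 'a) set \<times> 'a) list \<Rightarrow> 'a"
  where "d = free_eval R F0 rel_at"

lemma d_hom: "d \<in> mod_hom R F1 F0"
  unfolding d_def by (rule F0.free_eval_hom[OF rel_at_carrier])

section \<open>Congruences modulo the image of \<open>d\<close>\<close>

definition B :: "((('a \<times> 'a) set \<times> 'a) list \<Rightarrow> 'a) set"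
  where "B = d ` carrier F1"

lemma B_F0: "\<phi> \<in> B \<Longrightarrow> \<phi> \<in> carrier F0"
  using mod_homD(1)[OF d_hom] by (auto simp: B_def)

lemma B_carrier: "\<phi> \<in> B \<Longrightarrow> \<phi> i \<in> carrier R"
  using free_moduleD(1)[OF B_F0] .

lemma B_add:
  assumes "\<phi> \<in> B" "\<psi> \<in> B"
  shows "(\<lambda>i. \<phi> i \<oplus> \<psi> i) \<in> B"
proof -
  obtain \<alpha> \<beta> where *: "\<alpha> \<in> carrier F1" "\<beta> \<in> carrier F1" "\<phi> = d \<alpha>" "\<psi> = d \<beta>"
    using assms by (auto simp: B_def)
  then show ?thesis
    using mod_homD(2)[OF d_hom *(1,2)] F1.add.m_closed[of \<alpha> \<beta>]
    unfolding B_def by (intro image_eqI[of _ _ "\<alpha> \<oplus>\<^bsub>F1\<^esub> \<beta>"]) auto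
qed

lemma B_smult:
  assumes r: "r \<in> carrier R" and "\<phi> \<in> B"
  shows "(\<lambda>i. r \<otimes> \<phi> i) \<in> B"
proof -
  obtain \<alpha> where *: "\<alpha> \<in> carrier F1" "\<phi> = d \<alpha>"
    using assms by (auto simp: B_def)
  then show ?thesis
    using mod_homD(3)[OF d_hom r *(1)] F1.smult_closed[OF r *(1)]
    unfolding B_def by (intro image_eqI[of _ _ "r \<odot>\<^bsub>F1\<^esub> \<alpha>"]) auto
qed

lemma rel_B [simp]:
  assumes "\<mm> \<in> \<Omega>"
  shows "rel \<mm> k \<in> B"
proof -
  have "d (unit_vec R (idx \<mm> (Suc k))) = rel \<mm> k"
    using F0.free_eval_unit(2)[OF rel_at_carrier rels_idx[OF assms, of k]]
    by (simp add: d_def unit_vec_def)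
  then show ?thesis
    unfolding B_def using assms by (metis imageI rels_idx unit_vec_carrier)
qed

lemma B_eqI: "\<psi> \<in> B \<Longrightarrow> (\<And>i. \<phi> i = \<psi> i) \<Longrightarrow> \<phi> \<in> B"
  by (metis ext)

lemma o_step:
  assumes m: "\<mm> \<in> \<Omega>"
  shows "(\<lambda>i. unit_vec R (idx \<mm> (2 * n)) i \<ominus> unit_vec R (idx \<mm> (2 * Suc n)) i) \<in> B"
proof (rule B_eqI)
  show "(\<lambda>i. (rel \<mm> (2 * n) i \<oplus> s \<mm> n \<otimes> rel \<mm> (Suc (2 * n)) i) \<oplus> (f \<mm> n \<ominus> \<one>) \<otimes> rel \<mm> (2 * Suc n) i) \<in> B"
    using m by (intro B_add B_smult rel_B) auto
  fix i
  define o0 o1 o2 y0 y1 where "o0 = unit_vec R (idx \<mm> (2 * n)) i"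
    and "o1 = unit_vec R (idx \<mm> (2 * Suc n)) i" and "o2 = unit_vec R (idx \<mm> (2 * Suc (Suc n))) i"
    and "y0 = unit_vec R (idx \<mm> (Suc (2 * n))) i" and "y1 = unit_vec R (idx \<mm> (Suc (2 * Suc n))) i"
  have [simp]: "o0 \<in> carrier R" "o1 \<in> carrier R" "o2 \<in> carrier R" "y0 \<in> carrier R" "y1 \<in> carrier R"
    by (auto simp: o0_def o1_def o2_def y0_def y1_def)
  note [simp] = m
  have 1: "rel \<mm> (2 * n) i = o0 \<ominus> (s \<mm> n \<otimes> y0 \<oplus> f \<mm> n \<otimes> o1)"
    by (simp add: rel_def coeff_y_def coeff_o_def next_idx_def o0_def o1_def y0_def)
  have 2: "rel \<mm> (Suc (2 * n)) i = y0 \<ominus> (s \<mm> n \<otimes> e \<mm> n \<otimes> y1 \<oplus> x \<mm> n \<otimes> g \<mm> n \<otimes> o2)"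
    by (simp add: rel_def coeff_y_def coeff_o_def next_idx_def o2_def y1_def y0_def)
  have 3: "rel \<mm> (2 * Suc n) i = o1 \<ominus> (s \<mm> n \<otimes> s \<mm> n \<otimes> y1 \<oplus> f \<mm> n \<otimes> g \<mm> n \<otimes> o2)"
    using m by (simp add: rel_def coeff_y_def coeff_o_def next_idx_def o1_def o2_def y1_def s_Suc f_Suc)
  have "o0 \<ominus> o1 = (rel \<mm> (2 * n) i \<oplus> s \<mm> n \<otimes> rel \<mm> (Suc (2 * n)) i) \<oplus> (f \<mm> n \<ominus> \<one>) \<otimes> rel \<mm> (2 * Suc n) i"
    unfolding 1 2 3 e_def by (rule o_step_identity) (use s_x[OF m, of n] in auto)
  then show "unit_vec R (idx \<mm> (2 * n)) i \<ominus> unit_vec R (idx \<mm> (2 * Suc n)) i = (rel \<mm> (2 * n) i \<oplus> s \<mm> n \<otimes> rel \<mm> (Suc (2 * n)) i) \<oplus> (f \<mm> n \<ominus> \<one>) \<otimes> rel \<mm> (2 * Suc n) i"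
    by (simp add: o0_def o1_def)
qed

lemma o_Nil:
  assumes m: "\<mm> \<in> \<Omega>"
  shows "(\<lambda>i. unit_vec R [] i \<ominus> unit_vec R (idx \<mm> (2 * n)) i) \<in> B"
proof (induction n)
  case 0
  show ?case
    using B_smult[OF zero_closed rel_B[OF m, of 0]] B_carrier[OF rel_B[OF m]]
    by (simp add: minus_eq r_neg)
next
  case (Suc n)
  have "(\<lambda>i. (unit_vec R [] i \<ominus> unit_vec R (idx \<mm> (2 * n)) i) \<oplus>
      (unit_vec R (idx \<mm> (2 * n)) i \<ominus> unit_vec R (idx \<mm> (2 * Suc n)) i)) \<in> B"
    using Suc o_step[OF m] by (rule B_add)
  moreover have "(a \<ominus> b) \<oplus> (b \<ominus> c) = a \<ominus> c"
    if [simp]: "a \<in> carrier R" "b \<in> carrier R" "c \<in> carrier R" for a b c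
    using that by algebra
  ultimately show ?case by simp
qed

lemma rel_even:
  "\<mm> \<in> \<Omega> \<Longrightarrow> rel \<mm> (2 * n) i = unit_vec R (idx \<mm> (2 * n)) i \<ominus>
    (s \<mm> n \<otimes> unit_vec R (idx \<mm> (Suc (2 * n))) i \<oplus> f \<mm> n \<otimes> unit_vec R (idx \<mm> (2 * Suc n)) i)"
  by (simp add: rel_def coeff_y_def coeff_o_def next_idx_def)

lemma rel_odd:
  "\<mm> \<in> \<Omega> \<Longrightarrow> rel \<mm> (Suc (2 * n)) i = unit_vec R (idx \<mm> (Suc (2 * n))) i \<ominus>
    (s \<mm> n \<otimes> e \<mm> n \<otimes> unit_vec R (idx \<mm> (Suc (2 * Suc n))) i \<oplus>
     x \<mm> n \<otimes> g \<mm> n \<otimes> unit_vec R (idx \<mm> (2 * Suc (Suc n))) i)"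
  by (simp add: rel_def coeff_y_def coeff_o_def next_idx_def)

text \<open>With \<open>o\<^sub>0\<close> read as 1, this and \<open>f_y\<close> say that
  multiplication by \<open>y\<^sub>n\<close> sends \<open>s\<^sub>n\<close> to
  \<open>e\<^sub>n\<close> and \<open>f\<^sub>n\<close> to \<open>x\<^sub>n\<close>. So
  \<open>y\<^sub>n\<close> behaves like an element of the inverse of the ideal generated by
  \<open>s\<^sub>n\<close> and \<open>f\<^sub>n\<close>.\<close>

lemma e_o:
  assumes m: "\<mm> \<in> \<Omega>"
  shows "(\<lambda>i. e \<mm> n \<otimes> unit_vec R [] i \<ominus> s \<mm> n \<otimes> unit_vec R (idx \<mm> (Suc (2 * n))) i) \<in> B"
proof (rule B_eqI)
  show "(\<lambda>i. (rel \<mm> (2 * n) i \<oplus> (unit_vec R [] i \<ominus> unit_vec R (idx \<mm> (2 * n)) i)) \<oplus>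
    (\<ominus> f \<mm> n) \<otimes> (unit_vec R [] i \<ominus> unit_vec R (idx \<mm> (2 * Suc n)) i)) \<in> B"
    using m by (intro B_add B_smult rel_B o_Nil) auto
qed (simp only: rel_even[OF m] e_def, rule e_step_identity, use m in auto)

lemma f_y:
  assumes m: "\<mm> \<in> \<Omega>"
  shows "(\<lambda>i. f \<mm> n \<otimes> unit_vec R (idx \<mm> (Suc (2 * n))) i \<ominus> x \<mm> n \<otimes> unit_vec R [] i) \<in> B"
proof (rule B_eqI)
  show "(\<lambda>i. (f \<mm> n \<otimes> rel \<mm> (Suc (2 * n)) i \<oplus> (\<ominus> x \<mm> n) \<otimes>
      (e \<mm> (Suc n) \<otimes> unit_vec R [] i \<ominus> s \<mm> (Suc n) \<otimes> unit_vec R (idx \<mm> (Suc (2 * Suc n))) i))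
    \<oplus> (\<ominus> (f \<mm> n \<otimes> g \<mm> n \<otimes> x \<mm> n)) \<otimes> (unit_vec R [] i \<ominus> unit_vec R (idx \<mm> (2 * Suc (Suc n))) i)) \<in> B"
    using m by (intro B_add B_smult rel_B e_o o_Nil) auto
qed (simp only: rel_odd[OF m] e_def f_Suc[OF m] s_Suc[OF m], rule f_step_identity, use m s_x[OF m] in auto)

lemma zero_B: "(\<lambda>_. \<zero>) \<in> B"
  using mod_hom_zero[OF F1.module_axioms F0.module_axioms d_hom] F1.zero_closed
  unfolding B_def by (intro image_eqI[of _ _ "\<zero>\<^bsub>F1\<^esub>"]) auto

text \<open>\<open>loc T v\<close> consists of the vectors that become multiples of \<open>v\<close> in \<open>(F0/B)\<^sub>T\<close>.\<close>

definition loc :: "'a set \<Rightarrow> ((('a \<times> 'a) set \<times> 'a) list \<Rightarrow> 'a) \<Rightarrow> ((('a \<times> 'a) set \<times> 'a) list \<Rightarrow> 'a) set"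
  where "loc T v = {\<phi> \<in> carrier F0. \<exists>a\<in>T. \<exists>b\<in>carrier R. (\<lambda>i. a \<otimes> \<phi> i \<ominus> b \<otimes> v i) \<in> B}"

lemma locI:
  assumes "\<phi> \<in> carrier F0" "a \<in> T" "b \<in> carrier R"
    and "\<And>i. a \<otimes> \<phi> i \<ominus> b \<otimes> v i = \<psi> i" "\<psi> \<in> B"
  shows "\<phi> \<in> loc T v"
proof -
  have "(\<lambda>i. a \<otimes> \<phi> i \<ominus> b \<otimes> v i) \<in> B"
    by (rule B_eqI[OF assms(5) assms(4)])
  with assms(1-3) show ?thesis
    unfolding loc_def by blast
qed

lemma locE:
  assumes "\<phi> \<in> loc T v"
  obtains a b where "\<phi> \<in> carrier F0" "a \<in> T" "b \<in> carrier R" "(\<lambda>i. a \<otimes> \<phi> i \<ominus> b \<otimes> v i) \<in> B"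
  using assms unfolding loc_def by auto

context
  fixes T and v :: "(('a \<times> 'a) set \<times> 'a) list \<Rightarrow> 'a"
  assumes T: "submonoid T R" and v: "v \<in> carrier F0"
begin

interpretation T: submonoid T R by (rule T)

lemma T_carrier: "a \<in> T \<Longrightarrow> a \<in> carrier R"
  using T.subset by auto

lemma loc_add:
  assumes \<phi>: "\<phi> \<in> loc T v" and \<psi>: "\<psi> \<in> loc T v"
  shows "(\<lambda>i. \<phi> i \<oplus> \<psi> i) \<in> loc T v"
proof -
  obtain a b where 1: "\<phi> \<in> carrier F0" "a \<in> T" "b \<in> carrier R" "(\<lambda>i. a \<otimes> \<phi> i \<ominus> b \<otimes> v i) \<in> B"
    using \<phi> by (rule locE)
  obtain a' b' where 2: "\<psi> \<in> carrier F0" "a' \<in> T" "b' \<in> carrier R" "(\<lambda>i. a' \<otimes> \<psi> i \<ominus> b' \<otimes> v i) \<in> B"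
    using \<psi> by (rule locE)
  note aR = T_carrier[OF 1(2)] T_carrier[OF 2(2)]
  have id: "(a \<otimes> a') \<otimes> (p \<oplus> q) \<ominus> (a' \<otimes> b \<oplus> a \<otimes> b') \<otimes> w = a' \<otimes> (a \<otimes> p \<ominus> b \<otimes> w) \<oplus> a \<otimes> (a' \<otimes> q \<ominus> b' \<otimes> w)"
    if [simp]: "p \<in> carrier R" "q \<in> carrier R" "w \<in> carrier R" "a \<in> carrier R" "b \<in> carrier R" "a' \<in> carrier R" "b' \<in> carrier R"
    for p q w a b a' b'
    using that by algebra
  show ?thesis
  proof (rule locI)
    show "(a \<otimes> a') \<otimes> (\<phi> i \<oplus> \<psi> i) \<ominus> (a' \<otimes> b \<oplus> a \<otimes> b') \<otimes> v i
        = a' \<otimes> (a \<otimes> \<phi> i \<ominus> b \<otimes> v i) \<oplus> a \<otimes> (a' \<otimes> \<psi> i \<ominus> b' \<otimes> v i)" for i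
      using aR 1(3) 2(3) free_moduleD(1)[OF 2(1)] free_moduleD(1)[OF 1(1)] free_moduleD(1)[OF v] by (intro id)
    show "(\<lambda>i. a' \<otimes> (a \<otimes> \<phi> i \<ominus> b \<otimes> v i) \<oplus> a \<otimes> (a' \<otimes> \<psi> i \<ominus> b' \<otimes> v i)) \<in> B"
      using aR 1 2 by (intro B_add B_smult)
  qed (use aR 1 2 in \<open>auto intro: add_F0\<close>)
qed

lemma loc_smult:
  assumes \<phi>: "\<phi> \<in> loc T v" and r: "r \<in> carrier R"
  shows "(\<lambda>i. r \<otimes> \<phi> i) \<in> loc T v"
proof -
  obtain a b where 1: "\<phi> \<in> carrier F0" "a \<in> T" "b \<in> carrier R" "(\<lambda>i. a \<otimes> \<phi> i \<ominus> b \<otimes> v i) \<in> B"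
    using \<phi> by (rule locE)
  have id: "a \<otimes> (r \<otimes> p) \<ominus> (r \<otimes> b) \<otimes> w = r \<otimes> (a \<otimes> p \<ominus> b \<otimes> w)"
    if [simp]: "p \<in> carrier R" "w \<in> carrier R" "a \<in> carrier R" "b \<in> carrier R" "r \<in> carrier R"
    for p w a b r
    using that by algebra
  show ?thesis
  proof (rule locI)
    show "a \<otimes> (r \<otimes> \<phi> i) \<ominus> (r \<otimes> b) \<otimes> v i = r \<otimes> (a \<otimes> \<phi> i \<ominus> b \<otimes> v i)" for i
      using T_carrier[OF 1(2)] 1(3) r free_moduleD(1)[OF 1(1)] free_moduleD(1)[OF v] by (intro id)
    show "(\<lambda>i. r \<otimes> (a \<otimes> \<phi> i \<ominus> b \<otimes> v i)) \<in> B"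
      using 1 r by (intro B_smult)
  qed (use 1 r in \<open>auto intro: smult_F0\<close>)
qed

lemma loc_saturated:
  assumes \<phi>: "\<phi> \<in> carrier F0" and r: "r \<in> T" and r\<phi>: "(\<lambda>i. r \<otimes> \<phi> i) \<in> loc T v"
  shows "\<phi> \<in> loc T v"
proof -
  obtain a b where 1: "a \<in> T" "b \<in> carrier R" "(\<lambda>i. a \<otimes> (r \<otimes> \<phi> i) \<ominus> b \<otimes> v i) \<in> B"
    using r\<phi> by (rule locE)
  show ?thesis
  proof (rule locI)
    show "(a \<otimes> r) \<otimes> \<phi> i \<ominus> b \<otimes> v i = a \<otimes> (r \<otimes> \<phi> i) \<ominus> b \<otimes> v i" for i
      using T_carrier[OF 1(1)] T_carrier[OF r] free_moduleD(1)[OF \<phi>] by (simp add: m_assoc)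
  qed (use 1 r \<phi> in auto)
qed

lemma loc_cong:
  assumes \<psi>: "\<psi> \<in> loc T v" and \<phi>: "\<phi> \<in> carrier F0" and diff: "(\<lambda>i. \<phi> i \<ominus> \<psi> i) \<in> B"
  shows "\<phi> \<in> loc T v"
proof -
  obtain a b where 1: "\<psi> \<in> carrier F0" "a \<in> T" "b \<in> carrier R" "(\<lambda>i. a \<otimes> \<psi> i \<ominus> b \<otimes> v i) \<in> B"
    using \<psi> by (rule locE)
  note aR = T_carrier[OF 1(2)]
  have id: "a \<otimes> p \<ominus> b \<otimes> w = a \<otimes> (p \<ominus> q) \<oplus> (a \<otimes> q \<ominus> b \<otimes> w)"
    if [simp]: "p \<in> carrier R" "q \<in> carrier R" "w \<in> carrier R" "a \<in> carrier R" "b \<in> carrier R" for p q w a b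
    using that by algebra
  show ?thesis
  proof (rule locI)
    show "a \<otimes> \<phi> i \<ominus> b \<otimes> v i = a \<otimes> (\<phi> i \<ominus> \<psi> i) \<oplus> (a \<otimes> \<psi> i \<ominus> b \<otimes> v i)" for i
      using aR 1(3) free_moduleD(1)[OF \<phi>] free_moduleD(1)[OF 1(1)] free_moduleD(1)[OF v] by (intro id)
    show "(\<lambda>i. a \<otimes> (\<phi> i \<ominus> \<psi> i) \<oplus> (a \<otimes> \<psi> i \<ominus> b \<otimes> v i)) \<in> B"
      using aR 1 diff by (intro B_add B_smult)
  qed (use 1(2-3) \<phi> in simp_all)
qed

lemma loc_cong':
  assumes \<psi>: "\<psi> \<in> loc T v" and \<phi>: "\<phi> \<in> carrier F0" and diff: "(\<lambda>i. \<psi> i \<ominus> \<phi> i) \<in> B"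
  shows "\<phi> \<in> loc T v"
proof (rule loc_cong[OF \<psi> \<phi>])
  have \<psi>F: "\<psi> \<in> carrier F0"
    using \<psi> by (rule locE)
  have id: "\<ominus> \<one> \<otimes> (b \<ominus> a) = a \<ominus> b" if [simp]: "a \<in> carrier R" "b \<in> carrier R" for a b
    using that by algebra
  have "(\<lambda>i. \<ominus> \<one> \<otimes> (\<psi> i \<ominus> \<phi> i)) \<in> B"
    using diff by (intro B_smult) auto
  then show "(\<lambda>i. \<phi> i \<ominus> \<psi> i) \<in> B"
    using free_moduleD(1)[OF \<phi>] free_moduleD(1)[OF \<psi>F] by (simp only: id)
qed

lemma loc_self: "v \<in> loc T v"
  using zero_B free_moduleD(1)[OF v]
  by (intro locI[of v \<one> T \<one> v "\<lambda>_. \<zero>"] v T.one_closed) (auto simp: minus_eq r_neg)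

lemma loc_trans:
  assumes w: "w \<in> loc T v" and \<phi>: "\<phi> \<in> loc T w"
  shows "\<phi> \<in> loc T v"
proof -
  obtain a b where 1: "\<phi> \<in> carrier F0" "a \<in> T" "b \<in> carrier R" "(\<lambda>i. a \<otimes> \<phi> i \<ominus> b \<otimes> w i) \<in> B"
    using \<phi> by (rule locE)
  show ?thesis
    by (rule loc_saturated[OF 1(1,2)], rule loc_cong[OF loc_smult[OF w 1(3)] _ 1(4)])
      (use 1 T_carrier in \<open>auto intro: smult_F0\<close>)
qed

end

section \<open>The cokernel localized at a maximal ideal, and at S\<close>

abbreviation cpl :: "'a set \<Rightarrow> 'a set"
  where "cpl \<mm> \<equiv> carrier R - \<mm>"

lemma cpl_submonoid:
  assumes m: "\<mm> \<in> \<Omega>"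
  shows "submonoid (cpl \<mm>) R"
proof -
  interpret m: primeideal \<mm> R by (rule prime[OF m])
  show ?thesis
    by unfold_locales (use m.one_notin m.I_prime in auto)
qed

text \<open>The vector \<open>s\<^sub>n y\<^sub>n\<^sub>+\<^sub>1\<close>, standing for
  \<open>e\<^sub>n\<^sub>+\<^sub>1/s\<^sub>n\<close>. As \<open>e\<^sub>n\<^sub>+\<^sub>1\<close> is
  a unit at \<mm>, it plays the role of \<open>1/s\<^sub>n\<close> there and generates the n-th
  stage of the localized cokernel.\<close>

definition top_elem :: "'a set \<Rightarrow> nat \<Rightarrow> (('a \<times> 'a) set \<times> 'a) list \<Rightarrow> 'a"
  where "top_elem \<mm> n = (\<lambda>i. s \<mm> n \<otimes> unit_vec R (idx \<mm> (Suc (2 * Suc n))) i)"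

lemma top_elem_F0 [simp]: "\<mm> \<in> \<Omega> \<Longrightarrow> top_elem \<mm> n \<in> carrier F0"
  unfolding top_elem_def by (intro smult_F0) auto

lemma Nil_loc:
  assumes m: "\<mm> \<in> \<Omega>"
  shows "unit_vec R [] \<in> loc (cpl \<mm>) (top_elem \<mm> n)"
  using m e_notin[OF m]
  by (intro locI[OF _ _ _ _ e_o[OF m, of "Suc n"]]) (auto simp: top_elem_def s_Suc m_assoc)

lemma o_loc:
  assumes T: "submonoid T R" and v: "v \<in> carrier F0" and n: "\<nn> \<in> \<Omega>" and Nil: "unit_vec R [] \<in> loc T v"
  shows "unit_vec R (idx \<nn> (2 * k)) \<in> loc T v"
  using n by (intro loc_cong'[OF T v Nil _ o_Nil]) auto

text \<open>Relation 2n+1 writes \<open>y\<^sub>n\<close> as \<open>e\<^sub>n\<close> times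
  \<open>top_elem \<mm> n\<close> plus a multiple of an o-generator, and the latter is congruent to
  \<open>o\<^sub>0\<close>, which \<open>Nil_loc\<close> handles.\<close>

lemma y_loc:
  assumes m: "\<mm> \<in> \<Omega>"
  shows "unit_vec R (idx \<mm> (Suc (2 * n))) \<in> loc (cpl \<mm>) (top_elem \<mm> n)"
proof (rule loc_cong[OF cpl_submonoid[OF m]])
  note T = cpl_submonoid[OF m] top_elem_F0[OF m, of n]
  show "(\<lambda>i. e \<mm> n \<otimes> top_elem \<mm> n i \<oplus> (x \<mm> n \<otimes> g \<mm> n) \<otimes> unit_vec R (idx \<mm> (2 * Suc (Suc n))) i)
      \<in> loc (cpl \<mm>) (top_elem \<mm> n)"
    using m by (intro loc_add[OF T] loc_smult[OF T] loc_self[OF T] o_loc[OF T] Nil_loc) auto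
  have "e \<mm> n \<otimes> top_elem \<mm> n i = s \<mm> n \<otimes> e \<mm> n \<otimes> unit_vec R (idx \<mm> (Suc (2 * Suc n))) i" for i
    using m by (simp add: top_elem_def m_ac)
  then show "(\<lambda>i. unit_vec R (idx \<mm> (Suc (2 * n))) i \<ominus> (e \<mm> n \<otimes> top_elem \<mm> n i \<oplus>
      (x \<mm> n \<otimes> g \<mm> n) \<otimes> unit_vec R (idx \<mm> (2 * Suc (Suc n))) i)) \<in> B"
    using rel_B[OF m, of "Suc (2 * n)"] by (simp add: rel_odd[OF m, abs_def])
qed (use m in auto)

text \<open>The stages increase: \<open>top_elem \<mm> k\<close> is a multiple of
  \<open>y\<^sub>k\<^sub>+\<^sub>1\<close>, which \<open>y_loc\<close> places in stage k+1.\<close>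

lemma loc_mono:
  assumes m: "\<mm> \<in> \<Omega>" and "n \<le> k" and \<phi>: "\<phi> \<in> loc (cpl \<mm>) (top_elem \<mm> n)"
  shows "\<phi> \<in> loc (cpl \<mm>) (top_elem \<mm> k)"
  using assms(2)
proof (induction rule: dec_induct)
  case base
  then show ?case by (rule \<phi>)
next
  case (step k)
  note T = cpl_submonoid[OF m] top_elem_F0[OF m, of "Suc k"]
  have "top_elem \<mm> k \<in> loc (cpl \<mm>) (top_elem \<mm> (Suc k))"
    unfolding top_elem_def[of \<mm> k] using m by (intro loc_smult[OF T] y_loc) auto
  from loc_trans[OF T this] step(3) show ?case by simp
qed

text \<open>Once \<open>s\<^sub>n\<close> is invertible, \<open>e_o\<close> gives
  \<open>y\<^sub>n\<close> as \<open>e\<^sub>n/s\<^sub>n\<close> times \<open>o\<^sub>0\<close>.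
  \<open>T\<close> is general because it is applied both to \<open>S\<close> and to the complement
  of a prime.\<close>

lemma y_loc_of_s:
  assumes T: "submonoid T R" and v: "v \<in> carrier F0" and n: "\<nn> \<in> \<Omega>" and Nil: "unit_vec R [] \<in> loc T v"
    and s: "s \<nn> n \<in> T"
  shows "unit_vec R (idx \<nn> (Suc (2 * n))) \<in> loc T v"
proof (rule loc_saturated[OF T v _ s])
  show "(\<lambda>i. s \<nn> n \<otimes> unit_vec R (idx \<nn> (Suc (2 * n))) i) \<in> loc T v"
    using n by (intro loc_cong'[OF T v loc_smult[OF T v Nil] _ e_o[OF n]] smult_F0) auto
qed (use n in auto)

text \<open>Localized at \<mm>, a foreign telescope collapses onto \<open>o\<^sub>0\<close>: one of
  \<open>s \<nn> n\<close> and \<open>f \<nn> n\<close> becomes invertible, and then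
  \<open>y\<^sub>n\<close> is e/s or x/f by \<open>e_o\<close> or \<open>f_y\<close>.\<close>

lemma y_loc_other:
  assumes m: "\<mm> \<in> \<Omega>" and n: "\<nn> \<in> \<Omega>" and neq: "\<mm> \<noteq> \<nn>"
  shows "unit_vec R (idx \<nn> (Suc (2 * n))) \<in> loc (cpl \<mm>) (top_elem \<mm> k)"
proof -
  note T = cpl_submonoid[OF m] top_elem_F0[OF m, of k]
  have "s \<nn> n \<in> cpl \<mm> \<or> f \<nn> n \<in> cpl \<mm>"
    using separated[OF n m, of n] neq n by auto
  then show ?thesis
  proof
    assume *: "f \<nn> n \<in> cpl \<mm>"
    show ?thesis
    proof (rule loc_saturated[OF T _ *])
      show "(\<lambda>i. f \<nn> n \<otimes> unit_vec R (idx \<nn> (Suc (2 * n))) i) \<in> loc (cpl \<mm>) (top_elem \<mm> k)"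
        using n by (intro loc_cong[OF T loc_smult[OF T Nil_loc[OF m]] _ f_y[OF n]] smult_F0) auto
    qed (use n in auto)
  qed (intro y_loc_of_s[OF T n Nil_loc[OF m]])
qed

lemma gens_cases:
  assumes "j \<in> gens"
  obtains "j = []" | \<nn> n where "\<nn> \<in> \<Omega>" "j = idx \<nn> (2 * n)" | \<nn> n where "\<nn> \<in> \<Omega>" "j = idx \<nn> (Suc (2 * n))"
proof (cases "j = []")
  case False
  then obtain \<nn> k where "\<nn> \<in> \<Omega>" "j = idx \<nn> k"
    using assms by (auto simp: gens_def)
  moreover have "k = 2 * (k div 2) \<or> k = Suc (2 * (k div 2))"
    by presburger
  ultimately show thesis
    using that(2,3) by metis
qed (rule that(1))

text \<open>At \<mm> the cokernel is an increasing union of cyclic modules, so every vector already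
  lies in one of them.\<close>

lemma eventually_loc:
  assumes m: "\<mm> \<in> \<Omega>" and "\<phi> \<in> carrier F0"
  shows "\<exists>n. \<phi> \<in> loc (cpl \<mm>) (top_elem \<mm> n)"
  using assms(2)
proof (induction rule: free_module_induct)
  case zero
  note T = cpl_submonoid[OF m] top_elem_F0[OF m, of 0]
  have "(\<lambda>i. \<zero> \<otimes> unit_vec R [] i) \<in> loc (cpl \<mm>) (top_elem \<mm> 0)"
    using m by (intro loc_smult[OF T] Nil_loc) auto
  then show ?case by auto
next
  case (add \<phi> \<psi>)
  then obtain k l where "\<phi> \<in> loc (cpl \<mm>) (top_elem \<mm> k)" "\<psi> \<in> loc (cpl \<mm>) (top_elem \<mm> l)"
    by auto
  then have "\<phi> \<in> loc (cpl \<mm>) (top_elem \<mm> (max k l))" "\<psi> \<in> loc (cpl \<mm>) (top_elem \<mm> (max k l))"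
    using loc_mono[OF m, of k "max k l" \<phi>] loc_mono[OF m, of l "max k l" \<psi>] by simp_all
  then show ?case
    by (intro exI) (rule loc_add[OF cpl_submonoid[OF m] top_elem_F0[OF m]])
next
  case (smult r \<phi>)
  then obtain n where "\<phi> \<in> loc (cpl \<mm>) (top_elem \<mm> n)"
    by auto
  then show ?case
    using loc_smult[OF cpl_submonoid[OF m] top_elem_F0[OF m]] smult.hyps by (intro exI)
next
  case (unit j)
  then show ?case
  proof (cases rule: gens_cases)
    case 1
    then show ?thesis using Nil_loc[OF m] by auto
  next
    case (2 \<nn> n)
    then show ?thesis
      using o_loc[OF cpl_submonoid[OF m] top_elem_F0[OF m] _ Nil_loc[OF m]] by blast
  next
    case (3 \<nn> n)
    then show ?thesis
      using y_loc[OF m] y_loc_other[OF m 3(1)] by blast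
  qed
qed

lemma clear_denominator:
  assumes "\<phi> \<in> carrier F0"
  shows "\<phi> \<in> loc S (unit_vec R [])"
proof -
  have T: "submonoid S R" "unit_vec R [] \<in> carrier F0"
    by (unfold_locales) (auto simp: S_carrier)
  note Nil = loc_self[OF T]
  show ?thesis
    using assms
  proof (induction rule: free_module_induct)
    case zero
    have "(\<lambda>i. \<zero> \<otimes> unit_vec R [] i) \<in> loc S (unit_vec R [])"
      by (intro loc_smult[OF T] Nil) auto
    then show ?case by simp
  next
    case (unit j)
    then show ?case
    proof (cases rule: gens_cases)
      case 1
      then show ?thesis using Nil by simp
    next
      case (2 \<nn> n)
      then show ?thesis using o_loc[OF T _ Nil] by simp
    next
      case (3 \<nn> n)
      then show ?thesis using y_loc_of_s[OF T _ Nil] by simp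
    qed
  qed (intro loc_add[OF T] loc_smult[OF T]; assumption)+
qed

end

section \<open>The kernel of \<open>d\<close>, computed coordinate by coordinate\<close>

section \<open>Injectivity of the relations\<close>

context cring
begin

lemma y_coord_identity:
  assumes [simp]: "p \<in> carrier R" "s \<in> carrier R" "f \<in> carrier R" "z \<in> carrier R"
    and h: "p \<oplus> (f \<otimes> z \<otimes> (\<ominus> (s \<otimes> s)) \<oplus> s \<otimes> z \<otimes> (\<ominus> (s \<otimes> (\<one> \<ominus> f)))) = \<zero>"
  shows "p = s \<otimes> s \<otimes> z"
proof (rule eq_minusI)
  have "p \<ominus> s \<otimes> s \<otimes> z = p \<oplus> (f \<otimes> z \<otimes> (\<ominus> (s \<otimes> s)) \<oplus> s \<otimes> z \<otimes> (\<ominus> (s \<otimes> (\<one> \<ominus> f))))"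
    using assms(1-4) by algebra
  then show "p \<ominus> s \<otimes> s \<otimes> z = \<zero>"
    unfolding h .
qed simp_all

lemma o_coord_identity:
  assumes [simp]: "p \<in> carrier R" "s \<in> carrier R" "f \<in> carrier R" "z \<in> carrier R" "x \<in> carrier R" "g \<in> carrier R"
    and sx: "s \<otimes> x = f \<ominus> f \<otimes> f"
    and h: "p \<oplus> (f \<otimes> z \<otimes> (\<ominus> (f \<otimes> g)) \<oplus> s \<otimes> z \<otimes> (\<ominus> (x \<otimes> g))) = \<zero>"
  shows "p = f \<otimes> g \<otimes> z"
proof (rule eq_minusI)
  have "p \<ominus> f \<otimes> g \<otimes> z = p \<oplus> (f \<otimes> z \<otimes> (\<ominus> (f \<otimes> g)) \<oplus> s \<otimes> z \<otimes> (\<ominus> (x \<otimes> g))) \<oplus>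
      (s \<otimes> x \<ominus> (f \<ominus> f \<otimes> f)) \<otimes> (g \<otimes> z)"
    using assms(1-6) by algebra
  then show "p \<ominus> f \<otimes> g \<otimes> z = \<zero>"
    unfolding h using sx by (simp add: minus_eq r_neg)
qed simp_all

lemma annihilator_ideal:
  assumes a: "a \<in> carrier R"
  shows "ideal {r \<in> carrier R. r \<otimes> a = \<zero>} R"
proof (rule idealI[OF ring_axioms])
  show "subgroup {r \<in> carrier R. r \<otimes> a = \<zero>} (add_monoid R)"
    using a by (intro group.subgroupI[OF a_group]) (auto simp: l_distr l_minus a_inv_def[symmetric])
  fix r q assume "r \<in> {r \<in> carrier R. r \<otimes> a = \<zero>}" and q: "q \<in> carrier R"
  then have r: "r \<in> carrier R" "r \<otimes> a = \<zero>" by auto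
  then have "q \<otimes> r \<otimes> a = \<zero>"
    using q a by (simp add: m_assoc)
  with r q show "q \<otimes> r \<in> {r \<in> carrier R. r \<otimes> a = \<zero>}" "r \<otimes> q \<in> {r \<in> carrier R. r \<otimes> a = \<zero>}"
    by (auto simp: m_comm[of r q])
qed

end

context telescope
begin

lemma d_apply:
  assumes "\<phi> \<in> carrier F1" "finite A" "A \<subseteq> rels"
    "\<And>j. j \<in> rels - A \<Longrightarrow> \<phi> j = \<zero> \<or> rel_at j i = \<zero>"
  shows "d \<phi> i = (\<Oplus>j\<in>A. \<phi> j \<otimes> rel_at j i)"
  unfolding d_def using assms by (intro free_eval_apply[OF rel_at_carrier])

lemma rel_coord:
  assumes "\<nn> \<in> \<Omega>"
  shows "rel \<nn> k (idx \<mm> (Suc l)) = (if \<nn> = \<mm> then (if k = Suc l then \<one> else \<zero>) \<ominus>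
    ((if next_idx k = Suc l then coeff_y \<mm> k else \<zero>) \<oplus> (if next_idx k = l then coeff_o \<mm> k else \<zero>)) else \<zero>)"
  using assms by (auto simp: rel_def unit_vec_apply minus_eq)

lemma rel_Nil: "\<nn> \<in> \<Omega> \<Longrightarrow> rel \<nn> k [] = (if k = 0 then \<one> else \<zero>)"
  using idx_eq_iff[of \<nn> _ \<nn> 0]
  by (auto simp: rel_def unit_vec_apply next_idx_def minus_eq idx_def)

lemma next_idx_eq: "next_idx k = l \<longleftrightarrow> odd l \<and> (l = Suc k \<or> l = Suc (Suc k) \<and> odd k)"
  by (auto simp: next_idx_def)

text \<open>A generator other than \<open>o\<^sub>0\<close> occurs only in relations of its own
  telescope; \<open>A\<close> may be any finite set containing the numbers of those
  relations.\<close>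

lemma d_coord:
  assumes \<phi>: "\<phi> \<in> carrier F1" and m: "\<mm> \<in> \<Omega>" and A: "finite A"
    "\<And>k. k = Suc l \<or> next_idx k = Suc l \<or> next_idx k = l \<Longrightarrow> k \<in> A"
  shows "d \<phi> (idx \<mm> (Suc l)) = (\<Oplus>k\<in>A. \<phi> (idx \<mm> (Suc k)) \<otimes> rel \<mm> k (idx \<mm> (Suc l)))"
proof -
  have inj: "inj_on (\<lambda>k. idx \<mm> (Suc k)) A"
    by (auto simp: inj_on_def)
  have "d \<phi> (idx \<mm> (Suc l)) = (\<Oplus>j\<in>(\<lambda>k. idx \<mm> (Suc k)) ` A. \<phi> j \<otimes> rel_at j (idx \<mm> (Suc l)))"
  proof (rule d_apply[OF \<phi>])
    fix j assume j: "j \<in> rels - (\<lambda>k. idx \<mm> (Suc k)) ` A"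
    then obtain \<nn> k where n: "\<nn> \<in> \<Omega>" "j = idx \<nn> (Suc k)"
      by (auto simp: rels_def)
    with j have "\<nn> \<noteq> \<mm> \<or> k \<notin> A" by auto
    then have "rel \<nn> k (idx \<mm> (Suc l)) = \<zero>"
      unfolding rel_coord[OF n(1)] using A(2)[of k] by (auto simp: minus_eq)
    then show "\<phi> j = \<zero> \<or> rel_at j (idx \<mm> (Suc l)) = \<zero>"
      using n by simp
  qed (use A m in auto)
  also have "\<dots> = (\<Oplus>k\<in>A. \<phi> (idx \<mm> (Suc k)) \<otimes> rel_at (idx \<mm> (Suc k)) (idx \<mm> (Suc l)))"
    using free_moduleD(1)[OF \<phi>] free_moduleD(1)[OF rel_F0[OF m]] inj
    by (intro finsum_reindex) auto
  finally show ?thesis by simp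
qed

text \<open>Comparing coefficients at successive generators solves \<open>d \<phi> = 0\<close>
  recursively: the coefficients of relations 2n+1 and 2n+2 are determined by that of relation
  0.\<close>

lemma d_zero_coords:
  assumes \<phi>: "\<phi> \<in> carrier F1" and d0: "\<And>i. d \<phi> i = \<zero>" and m: "\<mm> \<in> \<Omega>"
  shows "\<phi> (idx \<mm> (Suc (Suc (2 * n)))) = s \<mm> n \<otimes> \<phi> (idx \<mm> (Suc 0)) \<and>
    \<phi> (idx \<mm> (Suc (2 * Suc n))) = f \<mm> n \<otimes> \<phi> (idx \<mm> (Suc 0))"
proof (induction n)
  note [simp] = free_moduleD(1)[OF \<phi>] m
  have s_eq: "a = p \<otimes> b" if "a \<oplus> b \<otimes> (\<ominus> p) = \<zero>" "a \<in> carrier R" "b \<in> carrier R" "p \<in> carrier R" for a b p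
  proof (rule eq_minusI)
    have "a \<ominus> p \<otimes> b = a \<oplus> b \<otimes> (\<ominus> p)"
      using that(2-4) by (simp add: minus_eq r_minus m_comm)
    then show "a \<ominus> p \<otimes> b = \<zero>"
      using that(1) by simp
  qed (use that in auto)
  {
    case 0
    \<comment> \<open>\<open>y\<^sub>0\<close> occurs only in relations 1 and 0, and
      \<open>o\<^sub>1\<close>, treated next, only in relations 2 and 0.\<close>
    have "d \<phi> (idx \<mm> (Suc 0)) = (\<Oplus>k\<in>{1, 0}. \<phi> (idx \<mm> (Suc k)) \<otimes> rel \<mm> k (idx \<mm> (Suc 0)))"
      by (rule d_coord[OF \<phi> m]) (auto simp: next_idx_eq)
    also have "\<dots> = \<phi> (idx \<mm> (Suc 1)) \<oplus> \<phi> (idx \<mm> (Suc 0)) \<otimes> (\<ominus> s \<mm> 0)"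
      by (simp add: rel_coord next_idx_def coeff_y_def coeff_o_def minus_eq)
    finally have 1: "\<phi> (idx \<mm> (Suc 1)) = s \<mm> 0 \<otimes> \<phi> (idx \<mm> (Suc 0))"
      using d0 by (intro s_eq) auto
    have "d \<phi> (idx \<mm> (Suc 1)) = (\<Oplus>k\<in>{2, 0}. \<phi> (idx \<mm> (Suc k)) \<otimes> rel \<mm> k (idx \<mm> (Suc 1)))"
      by (rule d_coord[OF \<phi> m]) (auto simp: next_idx_eq)
    also have "\<dots> = \<phi> (idx \<mm> (Suc 2)) \<oplus> \<phi> (idx \<mm> (Suc 0)) \<otimes> (\<ominus> f \<mm> 0)"
      by (simp add: rel_coord next_idx_def coeff_y_def coeff_o_def minus_eq)
    finally have "\<phi> (idx \<mm> (Suc 2)) = f \<mm> 0 \<otimes> \<phi> (idx \<mm> (Suc 0))"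
      using d0 by (intro s_eq) auto
    with 1 show ?case by (simp add: numeral_2_eq_2)
  next
    case (Suc n)
    let ?z = "\<phi> (idx \<mm> (Suc 0))" and ?a = "Suc (2 * n)" and ?b = "2 * Suc n"
    have IH: "\<phi> (idx \<mm> (Suc ?a)) = s \<mm> n \<otimes> ?z" "\<phi> (idx \<mm> (Suc ?b)) = f \<mm> n \<otimes> ?z"
      using Suc by auto
    \<comment> \<open>From here on a third relation contributes:
      \<open>y\<^sub>n\<^sub>+\<^sub>1\<close> occurs in relations 2n+3, 2n+2 and 2n+1, and
      \<open>o\<^sub>n\<^sub>+\<^sub>2\<close> in relations 2n+4, 2n+2 and 2n+1.\<close>
    have "d \<phi> (idx \<mm> (Suc ?b)) = (\<Oplus>k\<in>{Suc ?b, ?b, ?a}. \<phi> (idx \<mm> (Suc k)) \<otimes> rel \<mm> k (idx \<mm> (Suc ?b)))"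
      by (rule d_coord[OF \<phi> m]) (auto simp: next_idx_eq)
    also have "\<dots> = \<phi> (idx \<mm> (Suc (Suc ?b))) \<oplus> (\<phi> (idx \<mm> (Suc ?b)) \<otimes> (\<ominus> s \<mm> (Suc n)) \<oplus>
        \<phi> (idx \<mm> (Suc ?a)) \<otimes> (\<ominus> (s \<mm> n \<otimes> e \<mm> n)))"
      by (simp add: rel_coord next_idx_def coeff_y_def coeff_o_def minus_eq)
    finally have 1: "\<phi> (idx \<mm> (Suc (Suc ?b))) = s \<mm> (Suc n) \<otimes> ?z"
      unfolding IH using d0 unfolding s_Suc[OF m] e_def by (intro y_coord_identity[of _ _ "f \<mm> n"]) auto
    have "d \<phi> (idx \<mm> (Suc (Suc ?b))) = (\<Oplus>k\<in>{Suc (Suc ?b), ?b, ?a}. \<phi> (idx \<mm> (Suc k)) \<otimes> rel \<mm> k (idx \<mm> (Suc (Suc ?b))))"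
      by (rule d_coord[OF \<phi> m]) (auto simp: next_idx_eq)
    also have "\<dots> = \<phi> (idx \<mm> (Suc (Suc (Suc ?b)))) \<oplus> (\<phi> (idx \<mm> (Suc ?b)) \<otimes> (\<ominus> f \<mm> (Suc n)) \<oplus>
        \<phi> (idx \<mm> (Suc ?a)) \<otimes> (\<ominus> (x \<mm> n \<otimes> g \<mm> n)))"
      by (simp add: rel_coord next_idx_def coeff_y_def coeff_o_def minus_eq)
    finally have "\<phi> (idx \<mm> (Suc (Suc (Suc ?b)))) = f \<mm> (Suc n) \<otimes> ?z"
      unfolding IH using d0 unfolding f_Suc[OF m] by (intro o_coord_identity[OF _ _ _ _ _ _ s_x[OF m]]) auto
    with 1 show ?case by simp
  }
qed

text \<open>Finite support of \<phi> forces the late coefficients from \<open>d_zero_coords\<close>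
  to vanish. So the coefficient of relation 0 is killed by a pair that lies in no member of \<Omega>
  except possibly \<mm>.\<close>

lemma d_zero_torsion:
  assumes \<phi>: "\<phi> \<in> carrier F1" and d0: "\<And>i. d \<phi> i = \<zero>" and m: "\<mm> \<in> \<Omega>"
  obtains n where "s \<mm> n \<otimes> \<phi> (idx \<mm> (Suc 0)) = \<zero>" "f \<mm> n \<otimes> \<phi> (idx \<mm> (Suc 0)) = \<zero>"
proof -
  have "finite ((\<lambda>k. idx \<mm> (Suc k)) -` {j. \<phi> j \<noteq> \<zero>})"
    using free_moduleD(2)[OF \<phi>] by (intro finite_vimageI) (auto simp: inj_on_def)
  then obtain n where n: "\<And>k. k \<ge> n \<Longrightarrow> \<phi> (idx \<mm> (Suc k)) = \<zero>"
    unfolding finite_nat_iff_bounded by (auto simp: not_less[symmetric] subset_iff)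
  show thesis
    using d_zero_coords[OF assms, of n] n[of "Suc (2 * n)"] n[of "2 * Suc n"] by (intro that[of n]) auto
qed

text \<open>The coordinate at \<open>o\<^sub>0\<close> shows that the coefficients
  \<open>z \<mm>\<close> of the relations 0 sum to zero. Their supports are disjoint, so each
  vanishes, and \<open>d_zero_coords\<close> then kills all other coefficients.\<close>

lemma d_injective:
  assumes \<phi>: "\<phi> \<in> carrier F1" and d0: "\<And>i. d \<phi> i = \<zero>"
  shows "\<phi> j = \<zero>"
proof -
  note [simp] = free_moduleD(1)[OF \<phi>]
  define z where "z = (\<lambda>\<mm>. \<phi> (idx \<mm> (Suc 0)))"
  have [simp]: "z \<mm> \<in> carrier R" for \<mm> by (simp add: z_def)
  define M where "M = {\<mm> \<in> \<Omega>. z \<mm> \<noteq> \<zero>}"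
  have "finite ((\<lambda>\<mm>. idx \<mm> (Suc 0)) -` {j. \<phi> j \<noteq> \<zero>})"
    using free_moduleD(2)[OF \<phi>] by (intro finite_vimageI) (auto simp: inj_on_def)
  then have fin: "finite M"
    by (rule finite_subset[rotated]) (auto simp: M_def z_def)
  \<comment> \<open>\<open>o\<^sub>0\<close> occurs only in relation 0 of each telescope, with
    coefficient 1.\<close>
  have "d \<phi> [] = (\<Oplus>j\<in>(\<lambda>\<mm>. idx \<mm> (Suc 0)) ` M. \<phi> j \<otimes> rel_at j [])"
  proof (rule d_apply[OF \<phi>])
    fix j assume j: "j \<in> rels - (\<lambda>\<mm>. idx \<mm> (Suc 0)) ` M"
    then obtain \<nn> k where n: "\<nn> \<in> \<Omega>" "j = idx \<nn> (Suc k)"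
      by (auto simp: rels_def)
    with j show "\<phi> j = \<zero> \<or> rel_at j [] = \<zero>"
      by (cases "k = 0") (auto simp: rel_Nil M_def z_def)
  qed (use fin in \<open>auto simp: M_def\<close>)
  also have "\<dots> = (\<Oplus>\<mm>\<in>M. \<phi> (idx \<mm> (Suc 0)) \<otimes> rel_at (idx \<mm> (Suc 0)) [])"
    using free_moduleD(1)[OF rel_F0]
    by (intro finsum_reindex) (auto simp: inj_on_def M_def)
  also have "\<dots> = (\<Oplus>\<mm>\<in>M. z \<mm>)"
    by (intro finsum_cong') (auto simp: rel_Nil M_def z_def)
  finally have sum0: "(\<Oplus>\<mm>\<in>M. z \<mm>) = \<zero>"
    using d0 by simp
  have "M = {}"
  proof (rule ccontr)
    assume "M \<noteq> {}"
    then obtain \<mm> where mM: "\<mm> \<in> M" by auto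
    then have m: "\<mm> \<in> \<Omega>" and zm: "z \<mm> \<noteq> \<zero>" by (auto simp: M_def)
    interpret m: primeideal \<mm> R by (rule prime[OF m])
    \<comment> \<open>For each other \<nn>, one of the two elements killing \<open>z \<nn>\<close>
      lies outside \<mm>; \<open>a\<close> is the product of these choices.\<close>
    have "\<exists>a\<in>carrier R - \<mm>. \<forall>\<nn>\<in>N. a \<otimes> z \<nn> = \<zero>" if "finite N" "N \<subseteq> \<Omega> - {\<mm>}" for N
      using that
    proof (induction N rule: finite_induct)
      case empty
      then show ?case using m.one_notin by auto
    next
      case (insert \<nn> N)
      then obtain a where a: "a \<in> carrier R" "a \<notin> \<mm>" "\<And>\<kk>. \<kk> \<in> N \<Longrightarrow> a \<otimes> z \<kk> = \<zero>"
        by auto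
      have n: "\<nn> \<in> \<Omega>" "\<nn> \<noteq> \<mm>" using insert by auto
      obtain k where k: "s \<nn> k \<otimes> z \<nn> = \<zero>" "f \<nn> k \<otimes> z \<nn> = \<zero>"
        using d_zero_torsion[OF \<phi> d0 n(1)] by (auto simp: z_def)
      then obtain b where b: "b \<in> carrier R" "b \<notin> \<mm>" "b \<otimes> z \<nn> = \<zero>"
        using separated[OF n(1) m n(2), of k] n(1) by (metis s_carrier f_carrier)
      have "a \<otimes> b \<in> carrier R - \<mm>"
        using a b m.I_prime by auto
      moreover have "(a \<otimes> b) \<otimes> z \<kk> = \<zero>" if "\<kk> \<in> insert \<nn> N" for \<kk>
      proof (cases "\<kk> = \<nn>")
        case True
        then show ?thesis using a b by (simp add: m_assoc)
      next
        case False
        then have "b \<otimes> (a \<otimes> z \<kk>) = \<zero>"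
          using a(3)[of \<kk>] b(1) that by simp
        then show ?thesis using a b by (simp add: m_ac)
      qed
      ultimately show ?case by blast
    qed
    from this[of "M - {\<mm>}"] fin obtain a where a: "a \<in> carrier R" "a \<notin> \<mm>"
        "\<And>\<nn>. \<nn> \<in> M - {\<mm>} \<Longrightarrow> a \<otimes> z \<nn> = \<zero>"
      by (auto simp: M_def)
    have "\<zero> = a \<otimes> (\<Oplus>\<nn>\<in>insert \<mm> (M - {\<mm>}). z \<nn>)"
      using sum0 mM a(1) by (simp add: insert_absorb)
    also have "\<dots> = a \<otimes> z \<mm> \<oplus> a \<otimes> (\<Oplus>\<nn>\<in>M - {\<mm>}. z \<nn>)"
      using fin a(1) by (simp add: finsum_insert r_distr del: insert_Diff_single)
    also have "a \<otimes> (\<Oplus>\<nn>\<in>M - {\<mm>}. z \<nn>) = (\<Oplus>\<nn>\<in>M - {\<mm>}. a \<otimes> z \<nn>)"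
      using fin a(1) by (intro finsum_rdistr) auto
    also have "\<dots> = (\<Oplus>\<nn>\<in>M - {\<mm>}. \<zero>)"
      using a(3) by (intro finsum_cong') auto
    finally have az: "a \<otimes> z \<mm> = \<zero>"
      using a(1) by simp
    obtain k where k: "s \<mm> k \<otimes> z \<mm> = \<zero>" "f \<mm> k \<otimes> z \<mm> = \<zero>"
      using d_zero_torsion[OF \<phi> d0 m] by (auto simp: z_def)
    \<comment> \<open>A nonzero \<open>z \<mm>\<close> has a proper annihilator, which meets
      \<open>S\<close> in \<open>s \<mm> k\<close>. By \<open>separated\<close> the only member of
      \<Omega> that could contain it is \<mm>, but \<open>a\<close> is in the annihilator and not in
      \<mm>.\<close>
    have "\<exists>\<nn>\<in>\<Omega>. {r \<in> carrier R. r \<otimes> z \<mm> = \<zero>} \<subseteq> \<nn>"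
      using k zm m by (intro cover[OF annihilator_ideal, of _ "s \<mm> k"]) auto
    then obtain \<nn> where n: "\<nn> \<in> \<Omega>" "{r \<in> carrier R. r \<otimes> z \<mm> = \<zero>} \<subseteq> \<nn>"
      by blast
    then have "s \<mm> k \<in> \<nn>" "f \<mm> k \<in> \<nn>" "a \<in> \<nn>"
      using k az a(1) m by auto
    then show False
      using separated[OF m n(1)] a(2) by auto
  qed
  then have z0: "z \<mm> = \<zero>" if "\<mm> \<in> \<Omega>" for \<mm>
    using that by (auto simp: M_def)
  have "\<phi> (idx \<mm> (Suc k)) = \<zero>" if m: "\<mm> \<in> \<Omega>" for \<mm> k
  proof (cases k)
    case 0
    then show ?thesis using z0[OF m] by (simp add: z_def)
  next
    case (Suc l)
    have "k = Suc (2 * (l div 2)) \<or> k = 2 * Suc (l div 2)"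
      using Suc by presburger
    then show ?thesis
      using d_zero_coords[OF \<phi> d0 m, of "l div 2"] z0[OF m] m by (auto simp: z_def)
  qed
  then show ?thesis
    using free_moduleD(3)[OF \<phi>] by (auto simp: rels_def)
qed

end

section \<open>The augmentation onto the localization: its kernel and its image\<close>

section \<open>Exactness at the localization\<close>

context cring
begin

lemma val_even_identity:
  assumes [simp]: "s \<in> carrier R" "f \<in> carrier R"
  shows "s \<oplus> (\<ominus> s \<otimes> (\<one> \<ominus> f) \<oplus> \<ominus> f \<otimes> s) = \<zero>"
  using assms by algebra

lemma absorb_identity:
  assumes [simp]: "q \<in> carrier R" "e \<in> carrier R" "b \<in> carrier R" "s \<in> carrier R"
    "u \<in> carrier R" "v \<in> carrier R"
    and h: "q \<otimes> s = u \<otimes> v"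
  shows "(q \<otimes> e \<otimes> b) \<otimes> s = (b \<otimes> v \<otimes> e) \<otimes> u"
proof -
  have "(q \<otimes> e \<otimes> b) \<otimes> s = (e \<otimes> b) \<otimes> (q \<otimes> s)"
    by (simp add: m_ac)
  then show ?thesis
    unfolding h by (simp add: m_ac)
qed

lemma m_rotate_identity:
  "b \<in> carrier R \<Longrightarrow> v \<in> carrier R \<Longrightarrow> e \<in> carrier R \<Longrightarrow> u \<in> carrier R \<Longrightarrow>
    (b \<otimes> v \<otimes> e) \<otimes> u = v \<otimes> (u \<otimes> (b \<otimes> e))"
  by (simp add: m_ac)

lemma sub_add_identity:
  "p \<in> carrier R \<Longrightarrow> a \<in> carrier R \<Longrightarrow> q \<in> carrier R \<Longrightarrow> c \<in> carrier R \<Longrightarrow> z \<in> carrier R \<Longrightarrow>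
    p \<otimes> (a \<otimes> q \<ominus> c \<otimes> z) \<oplus> (p \<otimes> c) \<otimes> z = (p \<otimes> a) \<otimes> q"
  by (simp add: minus_eq r_distr r_minus m_assoc a_assoc l_neg)

lemma kill_identity:
  assumes [simp]: "q \<in> carrier R" "e \<in> carrier R" "b \<in> carrier R" "s \<in> carrier R"
    "a \<in> carrier R" "y \<in> carrier R" "c \<in> carrier R" "z \<in> carrier R"
    and h: "(q \<otimes> e \<otimes> b) \<otimes> s = \<zero>"
  shows "(q \<otimes> e \<otimes> b) \<otimes> (a \<otimes> y \<ominus> c \<otimes> (s \<otimes> z)) = (q \<otimes> e \<otimes> a \<otimes> b) \<otimes> y"
proof (rule eq_minusI)
  have "(q \<otimes> e \<otimes> b) \<otimes> (a \<otimes> y \<ominus> c \<otimes> (s \<otimes> z)) \<ominus> (q \<otimes> e \<otimes> a \<otimes> b) \<otimes> y =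
      \<ominus> (c \<otimes> z) \<otimes> ((q \<otimes> e \<otimes> b) \<otimes> s)"
    using assms(1-8) by algebra
  then show "(q \<otimes> e \<otimes> b) \<otimes> (a \<otimes> y \<ominus> c \<otimes> (s \<otimes> z)) \<ominus> (q \<otimes> e \<otimes> a \<otimes> b) \<otimes> y = \<zero>"
    unfolding h by simp
qed simp_all

lemma val_odd_identity:
  assumes [simp]: "s \<in> carrier R" "f \<in> carrier R" "x \<in> carrier R" "g \<in> carrier R"
    and h: "s \<otimes> x = f \<ominus> f \<otimes> f"
  shows "s \<otimes> (\<one> \<ominus> f) \<oplus> (\<ominus> (s \<otimes> (\<one> \<ominus> f)) \<otimes> (\<one> \<ominus> f \<otimes> g) \<oplus> \<ominus> (x \<otimes> g) \<otimes> (s \<otimes> s)) = \<zero>"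
    (is "?l = \<zero>")
proof -
  have "?l = (s \<otimes> x \<ominus> (f \<ominus> f \<otimes> f)) \<otimes> (\<ominus> (g \<otimes> s))"
    using assms(1-4) by algebra
  then show ?thesis
    using h by (simp add: minus_eq r_neg)
qed

end

lemma (in mult_subset) frac_eqI:
  assumes "a \<in> carrier R" "s \<in> S" "b \<in> carrier R" "t \<in> S" "a \<otimes> t = b \<otimes> s"
  shows "fraction R S a s = fraction R S b t"
  unfolding frac_eq_iff[OF assms(1-4)] using assms(5) by (intro bexI[of _ \<one>]) auto

context telescope
begin

abbreviation L where "L \<equiv> localization R S"

sublocale L: module R L
  using localization_algebra by (rule algebra.axioms)

lemma L_zero_iff: "a \<in> carrier R \<Longrightarrow> t \<in> S \<Longrightarrow> fraction R S a t = \<zero>\<^bsub>L\<^esub> \<longleftrightarrow> (\<exists>u\<in>S. u \<otimes> a = \<zero>)"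
  unfolding localization_zero by (subst frac_eq_iff) (auto simp: S_carrier)

definition gen_val :: "(('a \<times> 'a) set \<times> 'a) list \<Rightarrow> ('a \<times> 'a) set"
  where "gen_val j = (if odd (length j)
    then fraction R S (e (Domain (fst (hd j))) (length j div 2)) (s (Domain (fst (hd j))) (length j div 2))
    else fraction R S \<one> \<one>)"

lemma gen_val_even [simp]: "gen_val (idx \<mm> (2 * n)) = fraction R S \<one> \<one>" "gen_val [] = fraction R S \<one> \<one>"
  by (simp_all add: gen_val_def idx_def)

lemma gen_val_odd [simp]: "gen_val (idx \<mm> (Suc (2 * n))) = fraction R S (e \<mm> n) (s \<mm> n)"
  by (simp add: gen_val_def idx_def)

lemma gen_val_carrier: "gen_val \<in> gens \<rightarrow> carrier L"
proof
  fix j assume "j \<in> gens"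
  then show "gen_val j \<in> carrier L"
    by (cases rule: gens_cases) (auto simp del: mult_Suc_right)
qed

definition \<pi> :: "((('a \<times> 'a) set \<times> 'a) list \<Rightarrow> 'a) \<Rightarrow> ('a \<times> 'a) set"
  where "\<pi> = free_eval R L gen_val"

lemma \<pi>_hom: "\<pi> \<in> mod_hom R F0 L"
  unfolding \<pi>_def by (rule L.free_eval_hom[OF gen_val_carrier])

lemma \<pi>_closed: "\<phi> \<in> carrier F0 \<Longrightarrow> \<pi> \<phi> \<in> carrier L"
  by (rule mod_homD(1)[OF \<pi>_hom])

lemma \<pi>_add: "\<phi> \<in> carrier F0 \<Longrightarrow> \<psi> \<in> carrier F0 \<Longrightarrow> \<pi> (\<lambda>i. \<phi> i \<oplus> \<psi> i) = \<pi> \<phi> \<oplus>\<^bsub>L\<^esub> \<pi> \<psi>"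
  using mod_homD(2)[OF \<pi>_hom] by simp

lemma \<pi>_smult: "r \<in> carrier R \<Longrightarrow> \<phi> \<in> carrier F0 \<Longrightarrow> \<pi> (\<lambda>i. r \<otimes> \<phi> i) = r \<odot>\<^bsub>L\<^esub> \<pi> \<phi>"
  using mod_homD(3)[OF \<pi>_hom] by simp

lemma \<pi>_zero: "\<pi> (\<lambda>_. \<zero>) = \<zero>\<^bsub>L\<^esub>"
  using mod_hom_zero[OF F0.module_axioms L.module_axioms \<pi>_hom] by simp

lemma \<pi>_unit_vec: "j \<in> gens \<Longrightarrow> \<pi> (unit_vec R j) = gen_val j"
  using L.free_eval_unit(2)[OF gen_val_carrier] by (simp add: \<pi>_def unit_vec_def)

text \<open>Evaluates a vector of the shape of \<open>rel\<close> once the values of its three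
  generators share a denominator. \<open>\<pi>_rel\<close> takes \<open>s\<^sub>n\<close> for even
  relations and \<open>s\<^sub>n\<^sub>+\<^sub>1\<close> for odd ones.\<close>

lemma \<pi>_lin3:
  assumes "i \<in> gens" "j \<in> gens" "k \<in> gens" and [simp]: "p \<in> carrier R" "q \<in> carrier R"
    and "t \<in> S" and [simp]: "a \<in> carrier R" "b \<in> carrier R" "c \<in> carrier R"
    and "gen_val i = fraction R S a t" "gen_val j = fraction R S b t" "gen_val k = fraction R S c t"
  shows "\<pi> (\<lambda>l. unit_vec R i l \<ominus> (p \<otimes> unit_vec R j l \<oplus> q \<otimes> unit_vec R k l)) =
    fraction R S (a \<oplus> (\<ominus> p \<otimes> b \<oplus> \<ominus> q \<otimes> c)) t"
proof -
  have "(\<lambda>l. unit_vec R i l \<ominus> (p \<otimes> unit_vec R j l \<oplus> q \<otimes> unit_vec R k l)) =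
    (\<lambda>l. unit_vec R i l \<oplus> (\<ominus> p \<otimes> unit_vec R j l \<oplus> \<ominus> q \<otimes> unit_vec R k l))"
    using assms(4,5) by (simp add: minus_eq minus_add l_minus)
  then show ?thesis
    using assms by (simp add: \<pi>_add \<pi>_smult \<pi>_unit_vec add_F0 smult_F0 localization_smult frac_same_denominator)
qed

lemma \<pi>_rel:
  assumes m: "\<mm> \<in> \<Omega>"
  shows "\<pi> (rel \<mm> k) = \<zero>\<^bsub>L\<^esub>"
proof -
  note [simp] = m
  have one: "fraction R S \<one> \<one> = fraction R S t t" if "t \<in> S" for t
    using frac_cancel[of \<one> \<one> t] that by (simp add: S_carrier)
  obtain n where "k = 2 * n \<or> k = Suc (2 * n)"
    by (metis evenE oddE Suc_eq_plus1)
  then show ?thesis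
  proof
    assume k: "k = 2 * n"
    have "\<pi> (rel \<mm> k) = fraction R S (s \<mm> n \<oplus> (\<ominus> s \<mm> n \<otimes> e \<mm> n \<oplus> \<ominus> f \<mm> n \<otimes> s \<mm> n)) (s \<mm> n)"
      unfolding k rel_even[OF m, abs_def]
      by (rule \<pi>_lin3) (use one[of "s \<mm> n"] in \<open>simp_all del: mult_Suc_right\<close>)
    also have "s \<mm> n \<oplus> (\<ominus> s \<mm> n \<otimes> e \<mm> n \<oplus> \<ominus> f \<mm> n \<otimes> s \<mm> n) = \<zero>"
      unfolding e_def using val_even_identity[of "s \<mm> n" "f \<mm> n"] by simp
    finally show ?thesis
      by (simp add: frac_zero)
  next
    assume k: "k = Suc (2 * n)"
    have y: "fraction R S (e \<mm> n) (s \<mm> n) = fraction R S (s \<mm> n \<otimes> e \<mm> n) (s \<mm> (Suc n))"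
      using frac_cancel[of "e \<mm> n" "s \<mm> n" "s \<mm> n"] by (simp add: s_Suc)
    have "\<pi> (rel \<mm> k) = fraction R S (s \<mm> n \<otimes> e \<mm> n \<oplus> (\<ominus> (s \<mm> n \<otimes> e \<mm> n) \<otimes> e \<mm> (Suc n) \<oplus>
        \<ominus> (x \<mm> n \<otimes> g \<mm> n) \<otimes> s \<mm> (Suc n))) (s \<mm> (Suc n))"
      unfolding k rel_odd[OF m, abs_def]
      by (rule \<pi>_lin3) (use one[of "s \<mm> (Suc n)"] y in \<open>simp_all del: mult_Suc_right\<close>)
    also have "s \<mm> n \<otimes> e \<mm> n \<oplus> (\<ominus> (s \<mm> n \<otimes> e \<mm> n) \<otimes> e \<mm> (Suc n) \<oplus>
        \<ominus> (x \<mm> n \<otimes> g \<mm> n) \<otimes> s \<mm> (Suc n)) = \<zero>"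
      unfolding e_def f_Suc[OF m] s_Suc[OF m] 
      using val_odd_identity[OF _ _ _ _ s_x[OF m]] by simp
    finally show ?thesis
      by (simp add: frac_zero)
  qed
qed

lemma \<pi>_B:
  assumes "\<phi> \<in> B"
  shows "\<pi> \<phi> = \<zero>\<^bsub>L\<^esub>"
proof -
  obtain \<alpha> where \<alpha>: "\<alpha> \<in> carrier F1" "\<phi> = d \<alpha>"
    using assms by (auto simp: B_def)
  have "\<pi> \<phi> = free_eval R L (\<pi> \<circ> rel_at) \<alpha>"
    unfolding \<alpha>(2) d_def by (rule mod_hom_free_eval[OF F0.module_axioms L.module_axioms \<pi>_hom rel_at_carrier \<alpha>(1)])
  also have "\<dots> = (\<Oplus>\<^bsub>L\<^esub>j\<in>{j. \<alpha> j \<noteq> \<zero>}. \<zero>\<^bsub>L\<^esub>)"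
    unfolding free_eval_def
  proof (rule L.finsum_cong')
    fix j assume "j \<in> {j. \<alpha> j \<noteq> \<zero>}"
    then have "j \<in> rels"
      using free_moduleD(3)[OF \<alpha>(1)] by auto
    then show "\<alpha> j \<odot>\<^bsub>L\<^esub> (\<pi> \<circ> rel_at) j = \<zero>\<^bsub>L\<^esub>"
      using free_moduleD(1)[OF \<alpha>(1)] by (auto simp: rels_def \<pi>_rel)
  qed auto
  finally show ?thesis by simp
qed

lemma \<pi>_sub_B:
  assumes "(\<lambda>i. \<phi> i \<ominus> \<psi> i) \<in> B" and \<phi>: "\<phi> \<in> carrier F0" and \<psi>: "\<psi> \<in> carrier F0"
  shows "\<pi> \<phi> = \<pi> \<psi>"
proof -
  have "\<phi> = (\<lambda>i. (\<phi> i \<ominus> \<psi> i) \<oplus> \<psi> i)"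
    using free_moduleD(1)[OF \<phi>] free_moduleD(1)[OF \<psi>] by (simp add: minus_eq a_assoc l_neg)
  then have "\<pi> \<phi> = \<pi> (\<lambda>i. (\<phi> i \<ominus> \<psi> i) \<oplus> \<psi> i)"
    by (rule arg_cong)
  also have "\<dots> = \<pi> (\<lambda>i. \<phi> i \<ominus> \<psi> i) \<oplus>\<^bsub>L\<^esub> \<pi> \<psi>"
    using B_F0[OF assms(1)] \<psi> by (rule \<pi>_add)
  also have "\<dots> = \<pi> \<psi>"
    using \<pi>_B[OF assms(1)] \<pi>_closed[OF \<psi>] by simp
  finally show ?thesis .
qed

lemma kernel_ideal:
  assumes \<phi>: "\<phi> \<in> carrier F0"
  shows "ideal {r \<in> carrier R. (\<lambda>i. r \<otimes> \<phi> i) \<in> B} R"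
proof (rule idealI[OF ring_axioms])
  note \<phi>R = free_moduleD(1)[OF \<phi>]
  show "subgroup {r \<in> carrier R. (\<lambda>i. r \<otimes> \<phi> i) \<in> B} (add_monoid R)"
  proof (rule group.subgroupI[OF a_group])
    have "\<zero> \<in> {r \<in> carrier R. (\<lambda>i. r \<otimes> \<phi> i) \<in> B}"
      using zero_B \<phi>R by simp
    then show "{r \<in> carrier R. (\<lambda>i. r \<otimes> \<phi> i) \<in> B} \<noteq> {}" by blast
    fix a assume a: "a \<in> {r \<in> carrier R. (\<lambda>i. r \<otimes> \<phi> i) \<in> B}"
    have "(\<lambda>i. \<ominus> \<one> \<otimes> (a \<otimes> \<phi> i)) \<in> B"
      by (rule B_smult) (use a in auto)
    then show "inv\<^bsub>add_monoid R\<^esub> a \<in> {r \<in> carrier R. (\<lambda>i. r \<otimes> \<phi> i) \<in> B}"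
      using a \<phi>R by (simp add: a_inv_def[symmetric] l_minus)
    fix b assume b: "b \<in> {r \<in> carrier R. (\<lambda>i. r \<otimes> \<phi> i) \<in> B}"
    have "(\<lambda>i. a \<otimes> \<phi> i \<oplus> b \<otimes> \<phi> i) \<in> B"
      by (rule B_add) (use a b in auto)
    then show "a \<otimes>\<^bsub>add_monoid R\<^esub> b \<in> {r \<in> carrier R. (\<lambda>i. r \<otimes> \<phi> i) \<in> B}"
      using a b \<phi>R by (simp add: l_distr)
  qed auto
  fix a c assume a: "a \<in> {r \<in> carrier R. (\<lambda>i. r \<otimes> \<phi> i) \<in> B}" and c: "c \<in> carrier R"
  have "(\<lambda>i. c \<otimes> (a \<otimes> \<phi> i)) \<in> B"
    by (rule B_smult) (use a c in auto)
  then show "c \<otimes> a \<in> {r \<in> carrier R. (\<lambda>i. r \<otimes> \<phi> i) \<in> B}"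
    using a c \<phi>R by (simp add: m_assoc)
  then show "a \<otimes> c \<in> {r \<in> carrier R. (\<lambda>i. r \<otimes> \<phi> i) \<in> B}"
    using a c by (simp add: m_comm)
qed

text \<open>The hypothesis on \<open>u\<close> says that \<open>b\<close> times
  \<open>y\<^sub>n\<close> maps to zero. At \<mm>, \<open>y\<^sub>n\<close> is a multiple of
  \<open>s\<^sub>k y\<^sub>k\<^sub>+\<^sub>1\<close> with \<open>s\<^sub>k\<close> divisible by
  \<open>u\<close>, so multiplying by \<open>b\<close> and the unit \<open>e\<^sub>n\<close>
  annihilates it.\<close>

lemma y_killed:
  assumes m: "\<mm> \<in> \<Omega>" and b: "b \<in> carrier R" and u: "u \<in> S" "u \<otimes> (b \<otimes> e \<mm> n) = \<zero>"
  shows "\<exists>a\<in>cpl \<mm>. (\<lambda>i. (a \<otimes> b) \<otimes> unit_vec R (idx \<mm> (Suc (2 * n))) i) \<in> B"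
proof -
  let ?y = "unit_vec R (idx \<mm> (Suc (2 * n)))"
  interpret T: submonoid "cpl \<mm>" R by (rule cpl_submonoid[OF m])
  obtain q k v where q: "q \<in> cpl \<mm>" "n \<le> k" "v \<in> carrier R" "q \<otimes> s \<mm> k = u \<otimes> v"
    using absorb[OF m u(1)] by blast
  obtain a c where ac: "a \<in> cpl \<mm>" "c \<in> carrier R" "(\<lambda>i. a \<otimes> ?y i \<ominus> c \<otimes> top_elem \<mm> k i) \<in> B"
    using loc_mono[OF m q(2) y_loc[OF m]] by (rule locE)
  have uR: "u \<in> carrier R" by (simp add: S_carrier u(1))
  note [simp] = m b uR q(3) ac(2)
  have [simp]: "q \<in> carrier R" "a \<in> carrier R" using q ac by auto
  let ?z = "unit_vec R (idx \<mm> (Suc (2 * Suc k)))"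
  have "(q \<otimes> e \<mm> n \<otimes> b) \<otimes> s \<mm> k = (b \<otimes> v \<otimes> e \<mm> n) \<otimes> u"
    by (rule absorb_identity[OF _ _ _ _ _ _ q(4)]) simp_all
  also have "\<dots> = v \<otimes> (u \<otimes> (b \<otimes> e \<mm> n))"
    by (rule m_rotate_identity) simp_all
  finally have ps: "(q \<otimes> e \<mm> n \<otimes> b) \<otimes> s \<mm> k = \<zero>"
    by (simp add: u(2))
  have "(\<lambda>i. (q \<otimes> e \<mm> n \<otimes> b) \<otimes> (a \<otimes> ?y i \<ominus> c \<otimes> top_elem \<mm> k i)) \<in> B"
    by (intro B_smult ac(3)) simp
  then have "(\<lambda>i. (q \<otimes> e \<mm> n \<otimes> a \<otimes> b) \<otimes> ?y i) \<in> B"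
    unfolding top_elem_def
    by (rule B_eqI) (rule kill_identity[symmetric, OF _ _ _ _ _ _ _ _ ps], simp_all)
  moreover have "e \<mm> n \<in> cpl \<mm>"
    using e_notin[OF m] by simp
  then have "q \<otimes> e \<mm> n \<otimes> a \<in> cpl \<mm>"
    by (intro T.m_closed q(1) ac(1))
  ultimately show ?thesis
    by (rule bexI)
qed

text \<open>Local-global argument for the ideal \<open>?J\<close> of multipliers carrying \<phi>
  into \<open>B\<close>: it meets \<open>S\<close> by \<open>clear_denominator\<close>, and no \<mm>
  in \<Omega> contains it by \<open>eventually_loc\<close> and \<open>y_killed\<close>, so
  \<open>cover\<close> yields 1.\<close>

lemma \<pi>_kernel:
  assumes \<phi>: "\<phi> \<in> carrier F0" and \<pi>0: "\<pi> \<phi> = \<zero>\<^bsub>L\<^esub>"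
  shows "\<phi> \<in> B"
proof -
  note \<phi>R = free_moduleD(1)[OF \<phi>]
  let ?J = "{r \<in> carrier R. (\<lambda>i. r \<otimes> \<phi> i) \<in> B}"
  have \<pi>_mult: "b \<odot>\<^bsub>L\<^esub> \<pi> v = \<zero>\<^bsub>L\<^esub>"
    if "(\<lambda>i. a \<otimes> \<phi> i \<ominus> b \<otimes> v i) \<in> B" "a \<in> carrier R" "b \<in> carrier R" "v \<in> carrier F0" for a b v
  proof -
    have "\<pi> (\<lambda>i. a \<otimes> \<phi> i) = \<pi> (\<lambda>i. b \<otimes> v i)"
      using that \<phi> by (intro \<pi>_sub_B smult_F0) auto
    then show ?thesis
      using that \<phi> \<pi>0 by (simp add: \<pi>_smult)
  qed
  obtain t r where t: "t \<in> S" "r \<in> carrier R" "(\<lambda>i. t \<otimes> \<phi> i \<ominus> r \<otimes> unit_vec R [] i) \<in> B"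
    using clear_denominator[OF \<phi>] by (rule locE)
  \<comment> \<open>Modulo \<open>B\<close>, t \<phi> is r times \<open>o\<^sub>0\<close>, and
    \<open>o\<^sub>0\<close> maps to 1. So r vanishes in the localization, some \<open>u\<close> in
    \<open>S\<close> kills it, and \<open>u \<otimes> t\<close> lies in \<open>?J\<close>.\<close>
  have "fraction R S r \<one> = \<zero>\<^bsub>L\<^esub>"
    using \<pi>_mult[OF t(3)] t S_carrier by (simp add: \<pi>_unit_vec localization_smult)
  then obtain u where u: "u \<in> S" "u \<otimes> r = \<zero>"
    using t L_zero_iff[of r \<one>] by auto
  have "(\<lambda>i. u \<otimes> (t \<otimes> \<phi> i \<ominus> r \<otimes> unit_vec R [] i)) \<in> B"
    using t u by (intro B_smult S_carrier)
  moreover have "u \<otimes> (t \<otimes> \<phi> i \<ominus> r \<otimes> unit_vec R [] i) = (u \<otimes> t) \<otimes> \<phi> i" for i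
  proof -
    have [simp]: "u \<in> carrier R" "t \<in> carrier R" using t u S_carrier by auto
    have "u \<otimes> (t \<otimes> \<phi> i \<ominus> r \<otimes> unit_vec R [] i) = (u \<otimes> t) \<otimes> \<phi> i \<ominus> (u \<otimes> r) \<otimes> unit_vec R [] i"
      using t(2) \<phi>R by (simp add: minus_eq r_distr r_minus m_assoc)
    then show ?thesis
      using \<phi>R by (simp add: u(2) minus_eq)
  qed
  ultimately have utJ: "u \<otimes> t \<in> ?J"
    using t u S_carrier by simp
  have "\<one> \<in> ?J"
  proof (rule ccontr)
    assume "\<one> \<notin> ?J"
    then obtain \<mm> where m: "\<mm> \<in> \<Omega>" "?J \<subseteq> \<mm>"
      using cover[OF kernel_ideal[OF \<phi>] _ utJ] t u by auto
    interpret T: submonoid "cpl \<mm>" R by (rule cpl_submonoid[OF m(1)])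
    obtain n where "\<phi> \<in> loc (cpl \<mm>) (top_elem \<mm> n)"
      using eventually_loc[OF m(1) \<phi>] by blast
    then obtain a b where ab: "a \<in> cpl \<mm>" "b \<in> carrier R" "(\<lambda>i. a \<otimes> \<phi> i \<ominus> b \<otimes> top_elem \<mm> n i) \<in> B"
      by (rule locE)
    let ?y = "unit_vec R (idx \<mm> (Suc (2 * Suc n)))"
    define c where "c = b \<otimes> s \<mm> n"
    have [simp]: "c \<in> carrier R" "a \<in> carrier R" using ab m(1) by (auto simp: c_def)
    have acB: "(\<lambda>i. a \<otimes> \<phi> i \<ominus> c \<otimes> ?y i) \<in> B"
      using ab m(1) by (simp add: top_elem_def c_def m_assoc)
    \<comment> \<open>Near \<mm>, a \<phi> is congruent to c times
      \<open>y\<^sub>n\<^sub>+\<^sub>1\<close>; applying \<pi> turns this into a vanishing fraction,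
      the input for \<open>y_killed\<close>.\<close>
    have "fraction R S (c \<otimes> e \<mm> (Suc n)) (s \<mm> (Suc n)) = \<zero>\<^bsub>L\<^esub>"
      using \<pi>_mult[OF acB] m(1) by (simp add: \<pi>_unit_vec localization_smult del: mult_Suc_right)
    then obtain w where w: "w \<in> S" "w \<otimes> (c \<otimes> e \<mm> (Suc n)) = \<zero>"
      using L_zero_iff[of "c \<otimes> e \<mm> (Suc n)" "s \<mm> (Suc n)"] m(1) by auto
    obtain p where p: "p \<in> cpl \<mm>" "(\<lambda>i. (p \<otimes> c) \<otimes> ?y i) \<in> B"
      using y_killed[OF m(1) _ w] by auto
    have pR [simp]: "p \<in> carrier R" using p by simp
    have "(\<lambda>i. p \<otimes> (a \<otimes> \<phi> i \<ominus> c \<otimes> ?y i) \<oplus> (p \<otimes> c) \<otimes> ?y i) \<in> B"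
      by (rule B_add[OF B_smult[OF pR acB] p(2)])
    moreover have "p \<otimes> (a \<otimes> \<phi> i \<ominus> c \<otimes> ?y i) \<oplus> (p \<otimes> c) \<otimes> ?y i = (p \<otimes> a) \<otimes> \<phi> i" for i
      using \<phi>R by (intro sub_add_identity) simp_all
    ultimately have "p \<otimes> a \<in> ?J"
      by simp
    then have "p \<otimes> a \<in> \<mm>"
      by (rule subsetD[OF m(2)])
    then show False
      using T.m_closed[OF p(1) ab(1)] by simp
  qed
  then show ?thesis
    using \<phi>R by simp
qed

lemma image_ideal:
  assumes X: "X \<in> carrier L"
  shows "ideal {r \<in> carrier R. r \<odot>\<^bsub>L\<^esub> X \<in> \<pi> ` carrier F0} R" (is "ideal ?J R")
proof (rule idealI[OF ring_axioms])
  have smult: "r \<odot>\<^bsub>L\<^esub> Y \<in> \<pi> ` carrier F0" if r: "r \<in> carrier R" and Y: "Y \<in> \<pi> ` carrier F0" for r Y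
  proof -
    obtain \<phi> where \<phi>: "\<phi> \<in> carrier F0" "Y = \<pi> \<phi>" using Y by auto
    show ?thesis
      using \<pi>_smult[OF r \<phi>(1)] smult_F0[OF r \<phi>(1)] \<phi>(2)
      by (intro image_eqI[of _ \<pi> "\<lambda>i. r \<otimes> \<phi> i"]) simp_all
  qed
  have add: "Y \<oplus>\<^bsub>L\<^esub> Z \<in> \<pi> ` carrier F0" if Y: "Y \<in> \<pi> ` carrier F0" and Z: "Z \<in> \<pi> ` carrier F0" for Y Z
  proof -
    obtain \<phi> \<psi> where \<phi>: "\<phi> \<in> carrier F0" "Y = \<pi> \<phi>" "\<psi> \<in> carrier F0" "Z = \<pi> \<psi>" using Y Z by auto
    show ?thesis
      using \<pi>_add[OF \<phi>(1,3)] add_F0[OF \<phi>(1,3)] \<phi>(2,4)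
      by (intro image_eqI[of _ \<pi> "\<lambda>i. \<phi> i \<oplus> \<psi> i"]) simp_all
  qed
  have mem: "c \<otimes> a \<in> ?J" if "a \<in> ?J" "c \<in> carrier R" for a c
    using that X smult[of c "a \<odot>\<^bsub>L\<^esub> X"] by (simp add: L.smult_assoc1)
  show "subgroup ?J (add_monoid R)"
  proof (rule group.subgroupI[OF a_group])
    have "\<zero> \<in> ?J"
      using X \<pi>_zero F0.zero_closed by (force intro: rev_image_eqI)
    then show "?J \<noteq> {}" by blast
    fix a assume a: "a \<in> ?J"
    have "\<ominus> \<one> \<otimes> a \<in> ?J"
      using a by (intro mem) auto
    then show "inv\<^bsub>add_monoid R\<^esub> a \<in> ?J"
      using a by (simp add: a_inv_def[symmetric] l_minus)
    fix b assume b: "b \<in> ?J"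
    then show "a \<otimes>\<^bsub>add_monoid R\<^esub> b \<in> ?J"
      using a X add[of "a \<odot>\<^bsub>L\<^esub> X" "b \<odot>\<^bsub>L\<^esub> X"] by (simp add: L.smult_l_distr)
  qed auto
  fix a c assume "a \<in> ?J" "c \<in> carrier R"
  then show "c \<otimes> a \<in> ?J" "a \<otimes> c \<in> ?J"
    using mem[of a c] by (auto simp: m_comm)
qed

text \<open>The same local-global argument for the multipliers bringing X = a/t into the image. The
  denominator \<open>t\<close> is one of them. At \<mm>, \<open>absorb\<close> turns q a/t into a
  v/\<open>s\<^sub>k\<close>, and multiplying by the unit \<open>e\<^sub>k\<close> gives the image
  of a v \<open>y\<^sub>k\<close>.\<close>

lemma \<pi>_surj: "\<pi> ` carrier F0 = carrier L"
proof
  show "\<pi> ` carrier F0 \<subseteq> carrier L"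
    using \<pi>_closed by auto
  show "carrier L \<subseteq> \<pi> ` carrier F0"
  proof
    fix X assume X: "X \<in> carrier L"
    then obtain a t where at: "a \<in> carrier R" "t \<in> S" "X = fraction R S a t"
      by (auto simp: localization_carrier)
    have [simp]: "a \<in> carrier R" "t \<in> carrier R" using at S_carrier by auto
    let ?J = "{r \<in> carrier R. r \<odot>\<^bsub>L\<^esub> X \<in> \<pi> ` carrier F0}"
    have "t \<odot>\<^bsub>L\<^esub> X = fraction R S a \<one>"
      using at frac_cancel[of a \<one> t] by (simp add: localization_smult)
    also have "\<dots> = \<pi> (\<lambda>i. a \<otimes> unit_vec R [] i)"
      using at by (simp add: \<pi>_smult \<pi>_unit_vec localization_smult)
    finally have tJ: "t \<in> ?J"
      using smult_F0[OF at(1), of "unit_vec R []"] by simp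
    have "\<one> \<in> ?J"
    proof (rule ccontr)
      assume "\<one> \<notin> ?J"
      then obtain \<mm> where m: "\<mm> \<in> \<Omega>" "?J \<subseteq> \<mm>"
        using cover[OF image_ideal[OF X] at(2) tJ] by auto
      interpret T: submonoid "cpl \<mm>" R by (rule cpl_submonoid[OF m(1)])
      obtain q k v where q: "q \<in> cpl \<mm>" "v \<in> carrier R" "q \<otimes> s \<mm> k = t \<otimes> v"
        using absorb[OF m(1) at(2)] by blast
      have [simp]: "q \<in> carrier R" using q by simp
      note [simp] = q(2) m(1)
      let ?y = "unit_vec R (idx \<mm> (Suc (2 * k)))"
      have eq: "(q \<otimes> e \<mm> k \<otimes> a) \<otimes> s \<mm> k = (a \<otimes> v \<otimes> e \<mm> k) \<otimes> t"
        by (rule absorb_identity[OF _ _ _ _ _ _ q(3)]) simp_all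
      have "(q \<otimes> e \<mm> k) \<odot>\<^bsub>L\<^esub> X = fraction R S (q \<otimes> e \<mm> k \<otimes> a) t"
        using at by (simp add: localization_smult)
      also have "\<dots> = fraction R S (a \<otimes> v \<otimes> e \<mm> k) (s \<mm> k)"
        using at eq by (intro frac_eqI) simp_all
      also have "\<dots> = \<pi> (\<lambda>i. (a \<otimes> v) \<otimes> ?y i)"
        by (simp add: \<pi>_smult \<pi>_unit_vec localization_smult)
      finally have qJ: "q \<otimes> e \<mm> k \<in> ?J"
        using smult_F0[of "a \<otimes> v" ?y] by simp
      have "q \<otimes> e \<mm> k \<in> cpl \<mm>"
        using q e_notin by (intro T.m_closed) auto
      then show False
        using subsetD[OF m(2) qJ] by simp
    qed
    then show "X \<in> \<pi> ` carrier F0"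
      using X by simp
  qed
qed

section \<open>The resolution by \<open>F1\<close> and \<open>F0\<close>, continued by zero
  modules\<close>

theorem proj_dim_le_1: "proj_dim R L \<le> 1"
proof -
  define P where "P i = (if i = 0 then F0 else if i = 1 then F1 else free_module R {})" for i :: nat
  define \<delta> where "\<delta> i = (if i = 0 then d else (\<lambda>_ _. \<zero>))" for i :: nat
  have trivial: "carrier (free_module R ({} :: (('a \<times> 'a) set \<times> 'a) list set)) = {\<lambda>_. \<zero>}"
    by (auto simp: free_module_def fun_eq_iff)
  have zero_mem: "(\<lambda>_. \<zero>) \<in> carrier (free_module R X)" for X :: "(('a \<times> 'a) set \<times> 'a) list set"
    by (simp add: free_module_def)
  have zero_hom: "(\<lambda>_ _. \<zero>) \<in> mod_hom R (free_module R X) (free_module R Y)" for X Y :: "(('a \<times> 'a) set \<times> 'a) list set"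
    by (auto simp: mod_hom_def zero_mem)
  have "projective_resolution R L P \<delta> \<pi>"
    unfolding projective_resolution_def
  proof (intro conjI allI)
    fix i
    show "projective_module R (P i)"
      by (simp add: P_def projective_free_module)
    show "\<delta> i \<in> mod_hom R (P (Suc i)) (P i)"
      using d_hom zero_hom by (auto simp: P_def \<delta>_def)
    show "\<delta> (Suc i) ` carrier (P (Suc (Suc i))) = a_kernel (P (Suc i)) (P i) (\<delta> i)"
    proof (cases "i = 0")
      case True
      \<comment> \<open>Exactness at \<open>F1\<close> is injectivity of \<open>d\<close>, as the
        incoming module is zero.\<close>
      have "{\<phi> \<in> carrier F1. d \<phi> = (\<lambda>_. \<zero>)} = {\<lambda>_. \<zero>}"
        using d_injective mod_hom_zero[OF F1.module_axioms F0.module_axioms d_hom] zero_mem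
        by (auto simp: fun_eq_iff)
      then show ?thesis
        using True by (simp add: P_def \<delta>_def trivial a_kernel_def')
    next
      case False
      then show ?thesis
        by (auto simp: P_def \<delta>_def trivial a_kernel_def')
    qed
  next
    show "\<pi> \<in> mod_hom R (P 0) L" "\<pi> ` carrier (P 0) = carrier L"
      by (simp_all add: P_def \<pi>_hom \<pi>_surj)
    show "\<delta> 0 ` carrier (P 1) = a_kernel (P 0) L \<pi>"
      using \<pi>_kernel \<pi>_B B_F0 by (auto simp: P_def \<delta>_def a_kernel_def' B_def)
  qed
  moreover have "\<forall>i>1. carrier (P i) = {\<zero>\<^bsub>P i\<^esub>}"
    by (auto simp: P_def trivial)
  ultimately have "has_projective_resolution_of_length R L 1"
    unfolding has_projective_resolution_of_length_def by blast
  then have "proj_dim R L \<le> enat 1"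
    unfolding proj_dim_def by (intro Inf_lower) blast
  then show ?thesis
    by (simp add: one_enat_def)
qed

end

section \<open>Building a telescope from an S-h-nil ring\<close>

theorem (in mult_subset) proj_dim_localization_le_1:
  assumes "S_h_nil R S"
  shows "proj_dim R (localization R S) \<le> 1"
proof -
  let ?\<Omega> = "{\<mm>. maximalideal \<mm> R \<and> \<mm> \<inter> S \<noteq> {}}"
  have "\<forall>\<mm>\<in>?\<Omega>. \<exists>sfxg. isolating_sequence S \<mm> sfxg"
    using isolating_sequence_exists[OF assms submonoid_axioms] by auto
  then obtain F where F: "\<forall>\<mm>\<in>?\<Omega>. isolating_sequence S \<mm> (F \<mm>)"
    by (rule bchoice[THEN exE])
  define s f x g where "s \<mm> = fst (F \<mm>)" and "f \<mm> = fst (snd (F \<mm>))"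
    and "x \<mm> = fst (snd (snd (F \<mm>)))" and "g \<mm> = snd (snd (snd (F \<mm>)))" for \<mm>
  have seq: "isolating_sequence S \<mm> (s \<mm>, f \<mm>, x \<mm>, g \<mm>)" if "\<mm> \<in> ?\<Omega>" for \<mm>
    using F that by (simp add: s_def f_def x_def g_def)
  note seqD = seq[unfolded isolating_sequence_def prod.case, rule_format]
  interpret telescope R S ?\<Omega> s f x g
  proof (intro telescope.intro telescope_axioms.intro mult_subset_axioms)
    fix \<mm> assume m: "\<mm> \<in> ?\<Omega>"
    then show "primeideal \<mm> R"
      using maximalideal_prime by simp
    fix n
    show "s \<mm> n \<in> S" "f \<mm> n \<in> \<mm>" "x \<mm> n \<in> carrier R" "g \<mm> n \<in> carrier R"
      "s \<mm> n \<otimes> x \<mm> n = f \<mm> n \<ominus> f \<mm> n \<otimes> f \<mm> n" "s \<mm> (Suc n) = s \<mm> n \<otimes> s \<mm> n" "f \<mm> (Suc n) = f \<mm> n \<otimes> g \<mm> n"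
      using seqD[OF m] by simp_all
    \<comment> \<open>\<mm> is the only maximal ideal that can contain both \<open>s \<mm> n\<close>
      and \<open>f \<mm> n\<close>.\<close>
    show "s \<mm> n \<notin> \<nn> \<or> f \<mm> n \<notin> \<nn>" if "\<nn> \<in> ?\<Omega>" "\<mm> \<noteq> \<nn>" for \<nn>
      using seqD[OF m] that by blast
    show "\<exists>q\<in>carrier R - \<mm>. \<exists>k\<ge>n. \<exists>v\<in>carrier R. q \<otimes> s \<mm> k = u \<otimes> v" if "u \<in> S" for u
      using seqD[OF m] that by blast
  next
    fix J t assume J: "ideal J R" "t \<in> S" "t \<in> J" "\<one> \<notin> J"
    then obtain \<mm> where "maximalideal \<mm> R" "J \<subseteq> \<mm>"
      using proper_ideal_maximal[OF assms] by metis
    \<comment> \<open>The maximal ideal found contains \<open>t\<close>, so it meets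
      \<open>S\<close> and belongs to the index set.\<close>
    with J show "\<exists>\<mm>\<in>?\<Omega>. J \<subseteq> \<mm>"
      by blast
  qed
  show ?thesis
    by (rule proj_dim_le_1)
qed

theorem theorem6p13:
  fixes R :: "('a, 'c) ring_scheme" and S :: "'a set"
  assumes "cring R"
    and "submonoid S R"
    and "S_h_nil R S"
  shows "proj_dim R (localization R S) \<le> 1"
  using assms by (intro mult_subset.proj_dim_localization_le_1) (simp_all add: mult_subset_def)

end
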